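(* Let $\delta\in(0,1/3)$, $B>0$, and $\kappa:=R/r$. Let $(\ell_t)$ be any adversarial sequence of $B$-Lipschitz convex losses on $\mathcal{C}$ and let $(x_t)$ be the iterates of the Projection-Free Wrapper in response to the observed subgradients $(g_t\in\partial\ell_t(x_t))$. If the Wrapper is run with subroutine $\mathsf{A}$ set to FTRL-proximal with parameter $R$, with oracle $\mathcal{O}_{\mathcal{C}^\circ}=1\mathsf{D}\text{-}\mathsf{OPT}_{\mathcal{C}^\circ}$, and with tolerances $\delta_t=\delta\, t^{-1/2}$, $t\ge1$, then $x_t\in\mathcal{C}$ for all $t$ and, for all $\rho\in(0,1)$, $T\ge d\ln(1/\rho)$, and $x\in\mathcal{C}$, $$\mathbb{P}\left[\sum_{t=1}^T\langle g_t,x_t-x\rangle\le 8RB(\kappa+\delta)\sqrt{dT(3+2\ln(1/\rho))}+2dBR\cdot\big(2\kappa+2\delta+3\delta\sqrt T/\rho\big)\right]\ge1-\rho.$$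
   Context: **Setting.** $\mathbb{R}^d$ carries the standard inner product and Euclidean norm $\|\cdot\|$; $\mathcal{B}(\rho)$ is the closed Euclidean ball of radius $\rho$ centered at $0$; $\mathcal{B}_\infty(u,\nu)$ is the closed $\ell_\infty$-ball of radius $\nu$ centered at $u$; $[n]=\{1,\dots,n\}$; $\mathbb{I}$ denotes an indicator; $\Pi_{\mathcal{B}(D)}$ is Euclidean projection onto $\mathcal{B}(D)$. $\mathcal{C}\subseteq\mathbb{R}^d$ is a closed convex set with $\mathcal{B}(r)\subseteq\mathcal{C}\subseteq\mathcal{B}(R)$ for some $0<r\le R$. **Online protocol.** At round $t\ge1$ the learner outputs $x_t\in\mathcal{C}$, then a convex loss $\ell_t:\mathcal{C}\to\mathbb{R}$ is revealed and a subgradient $g_t\in\partial\ell_t(x_t)$ is observed. The sequence is adversarial: $\ell_t$ may depend on $x_t$ and on $(x_s,\ell_s)_{s\in[t-1]}$ (but not otherwise on the learner's internal random draws), and $g_t$ is determined by $\ell_t$ and $x_t$. The losses are $B$-Lipschitz if $\|g\|\le B$ for all $t\ge1$, $x\in\mathcal{C}$, $g\in\partial\ell_t(x)$. **Approximate Membership Oracle.** For $\epsilon>0$ let $\mathcal{B}(\mathcal{C},\epsilon)=\{x:\exists y\in\mathcal{C},\|x-y\|\le\epsilon\}$ and $\mathcal{B}(\mathcal{C},-\epsilon)=\{x:x+y\in\mathcal{C}\ \forall y\in\mathcal{B}(\epsilon)\}$. $\mathsf{MEM}(\cdot;\epsilon):\mathbb{R}^d\to\{0,1\}$ is any (deterministic)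 map equal to $1$ on $\mathcal{B}(\mathcal{C},-\epsilon)$ and to $0$ outside $\mathcal{B}(\mathcal{C},\epsilon)$. **$\mathsf{GAU}(w;\delta)$** (for $\delta\in(0,1)$, $w\in\mathcal{B}(6R/5)$): let $\epsilon=\delta r/(4\kappa)^2$. If $\mathsf{MEM}(2w;\epsilon)=1$ or $\|w\|\le r/2$, return $0$. Otherwise set $\alpha=0,\beta=2,\mu=1$; while $\beta-\alpha>\delta/(8\kappa^2)$: set $\alpha=\mu$ if $\mathsf{MEM}(\mu w;\epsilon)=1$ and $\beta=\mu$ otherwise, then $\mu=(\alpha+\beta)/2$. Return $(\alpha-\delta/(8\kappa^2))^{-1}$. **$1\mathsf{D}\text{-}\mathsf{OPT}_{\mathcal{C}^\circ}(w;\delta)$** (for $w\in\mathcal{B}(R)$, $\delta\in(0,1/3)$): let $\varepsilon=\frac{r^2\delta^3}{10^3d^{7/2}R^2}$, $\nu_1=\frac{r\delta}{10d}$, $\nu_2=\sqrt{\varepsilon\nu_1r/d^{1/2}}$. Sample (with fresh randomness at each call) $I$ uniformly in $[d]$, and independently $u$ uniformly in $\mathcal{B}_\infty(w,\nu_1)$ and then $z$ uniformly in $\mathcal{B}_\infty(u,\nu_2)$. Let $w_I,w_I'$ be the endpoints of $\mathcal{B}_\infty(u,\nu_2)\cap\{z+\lambda e_I:\lambda\in\mathbb{R}\}$, $w_I'$ having the larger $I$-th coordinate, and $\tilde s_I=\frac1{2\nu_2}(\mathsf{GAU}(w_I';\varepsilon)-\mathsf{GAU}(w_I;\varepsilon))$.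 Return $(\hat\gamma,\hat s)$ with $\hat\gamma=\mathsf{GAU}(w;\delta)$, $\hat s=d\,\tilde s_I\,e_I$. **Projection-Free Wrapper** (inputs: an OCO algorithm $\mathsf{A}$ with outputs in $\mathcal{B}(R)$, tolerances $(\delta_t)\subset(0,1/3)$, oracle $\mathcal{O}_{\mathcal{C}^\circ}$ returning a pair in $\mathbb{R}_{\ge0}\times\mathbb{R}^d$). Let $w_1$ be the first output of $\mathsf{A}$. For $t=1,2,\dots$: set $(\gamma_t,s_t)=\mathcal{O}_{\mathcal{C}^\circ}(w_t;\delta_t)$ and $\nu_t=\mathbb{I}_{\{\gamma_t\ge1\}}s_t$; play $x_t=w_t/\gamma_t$ if $\gamma_t\ge1$ and $x_t=w_t$ otherwise; observe $g_t\in\partial\ell_t(x_t)$; set $\tilde g_t=g_t-\mathbb{I}_{\{\langle g_t,w_t\rangle<0\}}\langle g_t,x_t\rangle\nu_t$; give $\mathsf{A}$ the $t$-th loss $f_t(w)=\langle\tilde g_t,w\rangle$ and let $w_{t+1}$ be its next output. **FTRL-proximal with parameter $D$.** Outputs $w_1=0$; $G_0=0,V_0=0,\eta_0=\infty,\Sigma_0=0$. Upon observing a subgradient $\nabla_t$ of the $t$-th loss at $w_t$: $G_t=G_{t-1}+\nabla_t$, $V_t=V_{t-1}+\|\nabla_t\|^2$, $\eta_t=\sqrt2D/\sqrt{V_t}$, $\sigma_t=1/\eta_t-1/\eta_{t-1}$ (with $1/\infty=0$), $\Sigma_t=\Sigma_{t-1}+\sigma_t$, and $w_{t+1}=\Pi_{\mathcal{B}(D)}\big((-G_t+\sum_{s\le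 t}\sigma_sw_s)/\Sigma_t\big)$ (with $w_{t+1}=0$ if $\Sigma_t=0$). *)

theory Defs
  imports "HOL-Probability.Probability" "HOL-Library.While_Combinator"
begin

section \<open>Sets, subgradients, membership oracles\<close>

definition cball_inf :: "real^'n \<Rightarrow> real \<Rightarrow> (real^'n) set" where
  "cball_inf u \<nu> = {x. infnorm (x - u) \<le> \<nu>}"

definition inflate :: "(real^'n) set \<Rightarrow> real \<Rightarrow> (real^'n) set" where
  "inflate C \<epsilon> = {x. \<exists>y\<in>C. norm (x - y) \<le> \<epsilon>}"

definition deflate :: "(real^'n) set \<Rightarrow> real \<Rightarrow> (real^'n) set" where
  "deflate C \<epsilon> = {x. \<forall>y\<in>cball 0 \<epsilon>. x + y \<in> C}"

definition membership_oracle :: "(real^'n) set \<Rightarrow> (real^'n \<Rightarrow> real \<Rightarrow> bool) \<Rightarrow> bool" where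
  "membership_oracle C mem \<longleftrightarrow>
     (\<forall>\<epsilon>>0. (\<forall>x\<in>deflate C \<epsilon>. mem x \<epsilon>) \<and> (\<forall>x. x \<notin> inflate C \<epsilon> \<longrightarrow> \<not> mem x \<epsilon>))"

text \<open>
  The subdifferential of a function with domain \<^term>\<open>E\<close>; values of \<^term>\<open>f\<close> outside
  \<^term>\<open>E\<close> are irrelevant.
\<close>

definition subdifferential :: "(real^'n) set \<Rightarrow> (real^'n \<Rightarrow> real) \<Rightarrow> real^'n \<Rightarrow> (real^'n) set" where
  "subdifferential E f x = {g. \<forall>y\<in>E. f x + g \<bullet> (y - x) \<le> f y}"

text \<open>
  Lipschitz continuity on \<^term>\<open>C\<close> in terms of subgradients. The domain \<^term>\<open>E\<close> of the loss is kept
  separate from \<^term>\<open>C\<close>: for \<^term>\<open>E = C\<close> the subdifferential at a boundary point of \<^term>\<open>C\<close>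
  absorbs the normal cone of \<^term>\<open>C\<close> and so is empty or unbounded, which rules out, for
  example, all linear losses.
\<close>

definition subgradients_bounded ::
    "(real^'n) set \<Rightarrow> (real^'n) set \<Rightarrow> real \<Rightarrow> (real^'n \<Rightarrow> real) \<Rightarrow> bool" where
  "subgradients_bounded C E B f \<longleftrightarrow> (\<forall>x\<in>C. \<forall>g\<in>subdifferential E f x. norm g \<le> B)"


section \<open>Approximate gauge function and its stochastic subgradients\<close>

definition gau :: "real \<Rightarrow> real \<Rightarrow> (real^'n \<Rightarrow> real \<Rightarrow> bool) \<Rightarrow> real^'n \<Rightarrow> real \<Rightarrow> real" where
  "gau r R mem w \<delta> =
    (let \<kappa> = R / r; \<epsilon> = \<delta> * r / (4 * \<kappa>)\<^sup>2 in
     if mem (2 *\<^sub>R w) \<epsilon> \<or> norm w \<le> r / 2 then 0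
     else
       (case while (\<lambda>(\<alpha>, \<beta>, \<mu>). \<beta> - \<alpha> > \<delta> / (8 * \<kappa>\<^sup>2))
               (\<lambda>(\<alpha>, \<beta>, \<mu>).
                  let (\<alpha>', \<beta>') = (if mem (\<mu> *\<^sub>R w) \<epsilon> then (\<mu>, \<beta>) else (\<alpha>, \<mu>))
                  in (\<alpha>', \<beta>', (\<alpha>' + \<beta>') / 2))
               (0, 2, 1)
        of (\<alpha>, \<beta>, \<mu>) \<Rightarrow> inverse (\<alpha> - \<delta> / (8 * \<kappa>\<^sup>2))))"

text \<open>
  The random draws of one oracle call: a uniform coordinate and two independent uniform points of
  the unit cube. The points \<open>u\<close> and \<open>z\<close> are obtained from the latter by translation and
  scaling, see \<open>distr_affine_uniform_cball_inf\<close> below.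
\<close>

type_synonym 'n draw = "'n \<times> (real^'n) \<times> (real^'n)"

definition draw_measure :: "'n::finite draw measure" where
  "draw_measure = uniform_count_measure UNIV \<Otimes>\<^sub>M
     (uniform_measure lborel (cball_inf 0 1) \<Otimes>\<^sub>M uniform_measure lborel (cball_inf 0 1))"

definition one_d_opt ::
    "real \<Rightarrow> real \<Rightarrow> (real^'n \<Rightarrow> real \<Rightarrow> bool) \<Rightarrow> real^'n \<Rightarrow> real \<Rightarrow> 'n::finite draw \<Rightarrow> real \<times> (real^'n)"
  where
  "one_d_opt r R mem w \<delta> = (\<lambda>(I, U, Z).
    (let d = real CARD('n);
         \<epsilon> = r\<^sup>2 * \<delta> ^ 3 / (10 ^ 3 * d powr (7 / 2) * R\<^sup>2);
         \<nu>\<^sub>1 = r * \<delta> / (10 * d);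
         \<nu>\<^sub>2 = sqrt (\<epsilon> * \<nu>\<^sub>1 * r / sqrt d);
         u = w + \<nu>\<^sub>1 *\<^sub>R U;
         z = u + \<nu>\<^sub>2 *\<^sub>R Z;
         w\<^sub>I = (\<chi> i. if i = I then u $ i - \<nu>\<^sub>2 else z $ i);
         w\<^sub>I' = (\<chi> i. if i = I then u $ i + \<nu>\<^sub>2 else z $ i);
         s\<^sub>I = (gau r R mem w\<^sub>I' \<epsilon> - gau r R mem w\<^sub>I \<epsilon>) / (2 * \<nu>\<^sub>2)
     in (gau r R mem w \<delta>, (d * s\<^sub>I) *\<^sub>R axis I 1)))"

lemma mem_cball_inf: "x \<in> cball_inf u \<nu> \<longleftrightarrow> (\<forall>i. \<bar>x $ i - u $ i\<bar> \<le> \<nu>)"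
proof
  assume "x \<in> cball_inf u \<nu>"
  then show "\<forall>i. \<bar>x $ i - u $ i\<bar> \<le> \<nu>"
    using component_le_infnorm_cart[of "x - u"] order_trans by (fastforce simp: cball_inf_def)
next
  assume "\<forall>i. \<bar>x $ i - u $ i\<bar> \<le> \<nu>"
  then show "x \<in> cball_inf u \<nu>"
    unfolding cball_inf_def infnorm_cart by (auto intro!: cSup_least)
qed

text \<open>The points \<open>w\<^sub>I\<close> and \<open>w\<^sub>I'\<close> are the endpoints of a coordinate chord of the cube.\<close>

lemma cball_inf_chord:
  fixes z u :: "real^'n"
  assumes "z \<in> cball_inf u \<nu>"
  shows "cball_inf u \<nu> \<inter> {z + c *\<^sub>R axis I 1 | c. True} =
    closed_segment (\<chi> i. if i = I then u $ i - \<nu> else z $ i)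
                   (\<chi> i. if i = I then u $ i + \<nu> else z $ i)"
    (is "?L = closed_segment ?a ?b")
proof -
  have nu: "0 \<le> \<nu>"
    using assms by (meson abs_ge_zero mem_cball_inf order_trans)
  show ?thesis
  proof (rule set_eqI, rule iffI)
    fix x assume "x \<in> ?L"
    then obtain c where c: "x = z + c *\<^sub>R axis I 1" and x: "x \<in> cball_inf u \<nu>" by auto
    have xI: "u $ I - \<nu> \<le> x $ I" "x $ I \<le> u $ I + \<nu>"
      using x[unfolded mem_cball_inf, rule_format, of I] by auto
    define s where "s = (if \<nu> = 0 then 0 else (x $ I - u $ I + \<nu>) / (2 * \<nu>))"
    have s: "0 \<le> s" "s \<le> 1" "x $ I = u $ I - \<nu> + s * (2 * \<nu>)"
      using xI nu by (auto simp: s_def field_simps)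
    have "x = (1 - s) *\<^sub>R ?a + s *\<^sub>R ?b"
      by (simp add: vec_eq_iff s(3)) (simp add: c axis_def algebra_simps)
    then show "x \<in> closed_segment ?a ?b"
      using s(1,2) by (auto simp: closed_segment_def)
  next
    fix x assume "x \<in> closed_segment ?a ?b"
    then obtain s where s: "0 \<le> s" "s \<le> 1" "x = (1 - s) *\<^sub>R ?a + s *\<^sub>R ?b"
      by (auto simp: closed_segment_def)
    have comp: "x $ i = (if i = I then u $ i + (2 * s - 1) * \<nu> else z $ i)" for i
      by (simp add: s(3) algebra_simps)
    have "\<bar>(2 * s - 1) * \<nu>\<bar> \<le> 1 * \<nu>"
      unfolding abs_mult using s(1,2) nu by (intro mult_mono) auto
    then have "x \<in> cball_inf u \<nu>"
      using assms by (simp add: mem_cball_inf comp)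
    moreover have "x = z + (x $ I - z $ I) *\<^sub>R axis I 1"
      by (simp add: vec_eq_iff comp axis_def)
    ultimately show "x \<in> ?L" by blast
  qed
qed

lemma distr_affine_uniform_cball_inf:
  fixes w :: "real^'n"
  assumes "\<nu> > 0"
  shows "distr (uniform_measure lborel (cball_inf 0 1)) borel (\<lambda>U. w + \<nu> *\<^sub>R U) =
    uniform_measure lborel (cball_inf w \<nu>)"
proof -
  let ?T = "\<lambda>U. w + \<nu> *\<^sub>R U"
  let ?c = "ennreal (\<bar>\<nu>\<bar> ^ DIM(real^'n))"
  have cube: "cball_inf u \<mu> = cbox (u - (\<chi> i. \<mu>)) (u + (\<chi> i. \<mu>))" for u :: "real^'n" and \<mu>
    by (auto simp: mem_cball_inf mem_box_cart abs_le_iff algebra_simps)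
  have meas: "cball_inf u \<mu> \<in> sets borel" for u :: "real^'n" and \<mu>
    by (simp add: cube)
  have c: "?c \<noteq> 0" "?c \<noteq> top" using assms by auto
  have scale: "emeasure lborel A = ?c * emeasure lborel (?T -` A)" if "A \<in> sets borel" for A
  proof -
    have "emeasure lborel A =
        emeasure (density (distr lborel borel ?T) (\<lambda>_. \<bar>\<nu>\<bar> ^ DIM(real^'n))) A"
      using lborel_affine[of \<nu> w] assms by simp
    also have "\<dots> = ?c * emeasure lborel (?T -` A)"
      using that by (simp add: emeasure_density emeasure_distr nn_integral_cmult_indicator)
    finally show ?thesis .
  qed
  have pre: "?T -` cball_inf w \<nu> = cball_inf 0 1"
    using assms by (auto simp: mem_cball_inf abs_mult)
  show ?thesis
  proof (rule measure_eqI)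
    fix A assume "A \<in> sets (distr (uniform_measure lborel (cball_inf 0 1)) borel ?T)"
    then have A: "A \<in> sets borel" by simp
    have TA: "?T -` A \<in> sets borel"
      using A measurable_sets[of ?T borel borel A] by simp
    have "emeasure (distr (uniform_measure lborel (cball_inf 0 1)) borel ?T) A =
        emeasure lborel (cball_inf 0 1 \<inter> ?T -` A) / emeasure lborel (cball_inf (0::real^'n) 1)"
      using A TA meas by (simp add: emeasure_distr)
    also have "\<dots> = (?c * emeasure lborel (cball_inf 0 1 \<inter> ?T -` A)) /
        (?c * emeasure lborel (cball_inf (0::real^'n) 1))"
      using c by (subst (1 2) mult.commute[of ?c]) (simp only: divide_mult_eq infinity_ennreal_def not_False_eq_True)
    also have "\<dots> = emeasure lborel (cball_inf w \<nu> \<inter> A) / emeasure lborel (cball_inf w \<nu>)"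
      using scale[of "cball_inf w \<nu> \<inter> A"] scale[of "cball_inf w \<nu>"] A meas
      by (simp add: pre vimage_Int)
    also have "\<dots> = emeasure (uniform_measure lborel (cball_inf w \<nu>)) A"
      using A meas by simp
    finally show "emeasure (distr (uniform_measure lborel (cball_inf 0 1)) borel ?T) A =
      emeasure (uniform_measure lborel (cball_inf w \<nu>)) A" .
  qed simp
qed


section \<open>FTRL-proximal\<close>

text \<open>
  Division by zero does the right thing here: if the gradients up to \<open>t\<close> vanish, then
  \<open>ftrl_eta D v t = 0\<close> instead of infinity, and its reciprocal is \<open>0\<close>, as required of
  \<open>1 / \<infinity>\<close>. The case \<open>t = 0\<close> is an instance of this.
\<close>

definition ftrl_eta :: "real \<Rightarrow> (nat \<Rightarrow> 'a::euclidean_space) \<Rightarrow> nat \<Rightarrow> real" where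
  "ftrl_eta D v t = sqrt 2 * D / sqrt (\<Sum>s=1..t. (norm (v s))\<^sup>2)"

definition ftrl_sigma :: "real \<Rightarrow> (nat \<Rightarrow> 'a::euclidean_space) \<Rightarrow> nat \<Rightarrow> real" where
  "ftrl_sigma D v t = 1 / ftrl_eta D v t - 1 / ftrl_eta D v (t - 1)"

text \<open>
  \<open>ftrl_proximal D v t\<close> is the \<open>t\<close>-th output, for \<open>t \<ge> 1\<close>; it depends on \<open>v s\<close>
  for \<open>1 \<le> s < t\<close> only.
\<close>

declare sum.cong [fundef_cong]

fun ftrl_proximal :: "real \<Rightarrow> (nat \<Rightarrow> 'a::euclidean_space) \<Rightarrow> nat \<Rightarrow> 'a" where
  "ftrl_proximal D v 0 = 0"
| "ftrl_proximal D v (Suc t) =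
     (let G = (\<Sum>s=1..t. v s); S = (\<Sum>s=1..t. ftrl_sigma D v s) in
      if S = 0 then 0
      else closest_point (cball 0 D)
             ((- G + (\<Sum>s=1..t. ftrl_sigma D v s *\<^sub>R ftrl_proximal D v s)) /\<^sub>R S))"

declare ftrl_proximal.simps(2) [simp del]


section \<open>The projection-free wrapper\<close>

record 'n round =
  played :: "real^'n"
  subgrad :: "real^'n"
  surrogate :: "real^'n"

text \<open>
  \<open>wrapper A orc \<delta> adv sg \<xi> t\<close> is what happens in round \<open>t \<ge> 1\<close>. Here \<open>A\<close> maps the (sub)gradients
  of the linear losses of the earlier rounds to the next output; \<open>orc\<close> is the oracle, which
  consumes the random draw \<open>\<xi> t\<close>; \<open>adv t\<close> maps the points played in the rounds \<open>1..t\<close> to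
  the loss of round \<open>t\<close> (the earlier losses are in turn functions of the earlier points); and
  \<open>sg t\<close> selects the subgradient from that loss and the point played.
\<close>

fun wrapper ::
    "((nat \<Rightarrow> real^'n) \<Rightarrow> nat \<Rightarrow> real^'n) \<Rightarrow>
     (real^'n \<Rightarrow> real \<Rightarrow> 'b \<Rightarrow> real \<times> (real^'n)) \<Rightarrow>
     (nat \<Rightarrow> real) \<Rightarrow>
     (nat \<Rightarrow> (nat \<Rightarrow> real^'n) \<Rightarrow> real^'n \<Rightarrow> real) \<Rightarrow>
     (nat \<Rightarrow> (real^'n \<Rightarrow> real) \<Rightarrow> real^'n \<Rightarrow> real^'n) \<Rightarrow>
     (nat \<Rightarrow> 'b) \<Rightarrow> nat \<Rightarrow> 'n round" where
  "wrapper A orc \<delta> adv sg \<xi> t =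
    (let past = (\<lambda>s. if s \<in> {1..<t} then wrapper A orc \<delta> adv sg \<xi> s else undefined);
         w = A (\<lambda>s\<in>{1..<t}. surrogate (past s)) t;
         (\<gamma>, s) = orc w (\<delta> t) (\<xi> t);
         \<nu> = (if \<gamma> \<ge> 1 then s else 0);
         x = (if \<gamma> \<ge> 1 then w /\<^sub>R \<gamma> else w);
         loss = adv t (\<lambda>s\<in>{1..t}. if s < t then played (past s) else x);
         g = sg t loss x;
         g' = g - (if g \<bullet> w < 0 then (g \<bullet> x) *\<^sub>R \<nu> else 0)
     in \<lparr>played = x, subgrad = g, surrogate = g'\<rparr>)"

declare wrapper.simps [simp del]

text \<open>
  The randomness of the whole game: a seed of the adversary, and, independently of it, the
  independent draws of the learner in each round.
\<close>

definition game_space :: "'s measure \<Rightarrow> ('s \<times> (nat \<Rightarrow> 'n::finite draw)) measure" where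
  "game_space N = N \<Otimes>\<^sub>M (\<Pi>\<^sub>M t\<in>UNIV. draw_measure)"

end

theory Submission
  imports Defs
begin

text \<open>
  The gauge \<open>\<gamma>\<close> of \<open>C\<close> is convex, \<open>1/r\<close>-Lipschitz, and at most \<open>1\<close> exactly on \<open>C\<close>. If a played point
  is obtained by dividing \<open>w\<close> by an estimate of \<open>\<gamma> w \<ge> 1\<close>, then the loss incurred by this retraction
  is proportional to \<open>\<gamma> w - 1\<close>, which is convex in \<open>w\<close>: adding a multiple of a subgradient \<open>s\<close> of \<open>\<gamma>\<close>
  to the observed subgradient turns the constrained problem into an unconstrained linear one over a
  ball, for which FTRL-proximal has regret \<open>2 \<surd>2 R\<close> times the root of the sum of the squared norms of
  its inputs (\<open>ftrl_proximal_regret\<close>). Three further points have to be settled.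

  The subgradient is replaced by a random estimate supported on one coordinate \<open>I\<close>: the slope of
  \<open>\<gamma>\<close> along a chord of a small cube, in direction \<open>I\<close>, through a uniform point \<open>Z\<close>. Resampling the coordinate
  \<open>I\<close> of \<open>Z\<close> does not change the distribution of \<open>Z\<close>, so the slope of the chord is on average the partial
  derivative at a uniform point of the cube. In this sense the vector of all chord slopes behaves like a
  subgradient at a random point. Two consequences are needed: the sum of the squared slopes has expectation
  at most \<open>1/r\<^sup>2\<close>, by Jensen's inequality, and the subgradient inequality holds in expectation, up to an
  error proportional to the distance of the cube from the query point. Both are instances of
  \<open>unit_cube_chord_average\<close>. Since \<open>I\<close> is uniform among \<open>d\<close> coordinates and the slope is multiplied by \<open>d\<close>, the estimate has second moment of order \<open>d/r\<^sup>2\<close>, whereas its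
  square may be as large as \<open>d\<^sup>2/r\<^sup>2\<close>.

  The values of \<open>\<gamma>\<close> are known only through bisection with an approximate membership oracle
  (\<open>gau_accuracy\<close>). The radius of the cube is so large compared with the accuracy of the bisection that a
  slope is off by at most \<open>\<delta> / (20 d R)\<close>, and so small that all points of the cube still lie where
  the bisection is accurate.

  The bound with high probability comes from a single exponential supermartingale. By the inequality of
  the arithmetic and the geometric mean, the root in the regret bound of FTRL-proximal is at most a constant
  plus a multiple of the sum of the squared norms. This makes the total regret at most a sum over the rounds
  of a quantity that is quadratic in the current estimate, and given the past the exponential moment of this
  quantity, once scaled to stay below \<open>3/2\<close>, is controlled by its first two moments
  (\<open>round_exponential_moment\<close>). The requirement \<open>T \<ge> d ln (1/\<rho>)\<close> is what allows the optimal scale to satisfy this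
  restriction (\<open>tuning_constants\<close>). Markov's inequality then costs probability \<open>\<rho>\<close> only once.
\<close>

section \<open>The gauge of a convex body\<close>

locale convex_body =
  fixes C :: "(real^'n) set" and r R :: real
  assumes closed_C: "closed C" and convex_C: "convex C"
    and r_pos: "0 < r" and r_le_R: "r \<le> R"
    and ball_sub: "cball 0 r \<subseteq> C" and sub_ball: "C \<subseteq> cball 0 R"
begin

lemma R_pos: "0 < R" using r_pos r_le_R by linarith

lemma zero_in_C: "0 \<in> C" using ball_sub r_pos by auto

definition polar :: "(real^'n) set" where
  "polar = {s. \<forall>x\<in>C. s \<bullet> x \<le> 1}"

text \<open>
  By the bipolar theorem this support function of the polar set is the gauge
  \<open>w \<mapsto> inf {c \<ge> 0. w \<in> c C}\<close>. In this form convexity, homogeneity and the Lipschitz bound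
  are immediate, and the maximizers are the subgradients; only \<open>gauge_le_1_iff\<close> needs a separation
  argument.
\<close>

definition body_gauge :: "real^'n \<Rightarrow> real" where
  "body_gauge w = (SUP s\<in>polar. s \<bullet> w)"

lemma zero_in_polar: "0 \<in> polar"
  by (simp add: polar_def)

lemma norm_polar_le: assumes "s \<in> polar" shows "norm s \<le> 1 / r"
proof (cases "s = 0")
  case False
  have "(r / norm s) *\<^sub>R s \<in> C"
    using ball_sub r_pos False by (intro subsetD[OF ball_sub]) simp
  then have "s \<bullet> ((r / norm s) *\<^sub>R s) \<le> 1" using assms by (auto simp: polar_def)
  then have "r * norm s \<le> 1"
    using False by (simp add: dot_square_norm power2_eq_square)
  then show ?thesis using r_pos by (simp add: field_simps)
qed (use r_pos in simp)

lemma compact_polar: "compact polar"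
proof -
  have "polar = (\<Inter>x\<in>C. {s. s \<bullet> x \<le> 1})" by (auto simp: polar_def)
  moreover have "closed {s. s \<bullet> x \<le> 1}" for x :: "real^'n"
    by (intro closed_Collect_le continuous_intros)
  ultimately have "closed polar" by auto
  moreover have "bounded polar" using norm_polar_le by (auto simp: bounded_iff)
  ultimately show ?thesis by (simp add: compact_eq_bounded_closed)
qed

lemma gauge_attained: "\<exists>s\<in>polar. body_gauge w = s \<bullet> w"
proof -
  have "continuous_on polar (\<lambda>s. s \<bullet> w)" by (intro continuous_intros)
  then obtain s where s: "s \<in> polar" "\<forall>s'\<in>polar. s' \<bullet> w \<le> s \<bullet> w"
    using continuous_attains_sup[OF compact_polar] zero_in_polar by blast
  then have "body_gauge w = s \<bullet> w"
    unfolding body_gauge_def by (intro cSup_eq_maximum) auto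
  with s show ?thesis by blast
qed

lemma polar_le_gauge: assumes "s \<in> polar" shows "s \<bullet> w \<le> body_gauge w"
proof -
  have "continuous_on polar (\<lambda>s. s \<bullet> w)" by (intro continuous_intros)
  then have "bdd_above ((\<lambda>s. s \<bullet> w) ` polar)"
    by (intro bounded_imp_bdd_above compact_imp_bounded compact_continuous_image compact_polar)
  then show ?thesis unfolding body_gauge_def using assms by (rule cSUP_upper[rotated])
qed

lemma gauge_nonneg: "0 \<le> body_gauge w"
  using polar_le_gauge[OF zero_in_polar] by simp

lemma gauge_scale: assumes "0 \<le> c" shows "body_gauge (c *\<^sub>R w) = c * body_gauge w"
proof (rule antisym)
  obtain s where s: "s \<in> polar" "body_gauge (c *\<^sub>R w) = s \<bullet> (c *\<^sub>R w)"
    using gauge_attained by blast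
  then show "body_gauge (c *\<^sub>R w) \<le> c * body_gauge w"
    using polar_le_gauge[OF s(1), of w] assms by (auto intro: mult_left_mono)
  obtain s where s: "s \<in> polar" "body_gauge w = s \<bullet> w"
    using gauge_attained by blast
  then show "c * body_gauge w \<le> body_gauge (c *\<^sub>R w)"
    using polar_le_gauge[OF s(1), of "c *\<^sub>R w"] by simp
qed

lemma gauge_diff_le: "body_gauge v - body_gauge w \<le> norm (v - w) / r"
proof -
  obtain s where s: "s \<in> polar" "body_gauge v = s \<bullet> v"
    using gauge_attained by blast
  have "body_gauge v - body_gauge w \<le> s \<bullet> (v - w)"
    using s polar_le_gauge[OF s(1), of w] by (simp add: inner_diff_right)
  also have "\<dots> \<le> norm s * norm (v - w)" by (rule norm_cauchy_schwarz)
  also have "\<dots> \<le> (1 / r) * norm (v - w)"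
    using norm_polar_le[OF s(1)] by (intro mult_right_mono) auto
  finally show ?thesis by simp
qed

lemma gauge_lipschitz: "\<bar>body_gauge v - body_gauge w\<bar> \<le> norm (v - w) / r"
  using gauge_diff_le[of v w] gauge_diff_le[of w v] by (simp add: norm_minus_commute abs_le_iff)

lemma gauge_le_norm: "body_gauge w \<le> norm w / r"
  using gauge_diff_le[of w 0] gauge_scale[of 0 0] by simp

lemma gauge_subgradient:
  "\<exists>s. norm s \<le> 1 / r \<and> (\<forall>v. body_gauge w + s \<bullet> (v - w) \<le> body_gauge v)"
proof -
  obtain s where s: "s \<in> polar" "body_gauge w = s \<bullet> w"
    using gauge_attained by blast
  then show ?thesis
    using polar_le_gauge[OF s(1)] norm_polar_le[OF s(1)]
    by (auto simp: inner_diff_right intro!: exI[of _ s])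
qed

text \<open>
  A point outside \<open>C\<close> is strictly separated from \<open>C\<close> by a hyperplane. As \<open>0 \<in> C\<close>, the normal vector
  can be scaled to lie in the polar set, and it then certifies a gauge above \<open>1\<close>.
\<close>

lemma gauge_le_1_iff: "body_gauge w \<le> 1 \<longleftrightarrow> w \<in> C"
proof
  assume "w \<in> C"
  then show "body_gauge w \<le> 1"
    using gauge_attained[of w] by (auto simp: polar_def)
next
  assume g: "body_gauge w \<le> 1"
  show "w \<in> C"
  proof (rule ccontr)
    assume "w \<notin> C"
    then obtain a b where ab: "a \<bullet> w < b" "\<forall>x\<in>C. b < a \<bullet> x"
      using separating_hyperplane_closed_point[OF convex_C closed_C] by blast
    then have b: "b < 0" using zero_in_C by force
    have "(1 / b) *\<^sub>R a \<in> polar"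
      using ab b unfolding polar_def by (auto simp: divide_le_eq less_imp_le)
    from polar_le_gauge[OF this, of w] g have "(a \<bullet> w) / b \<le> 1" by simp
    then show False using b ab by (simp add: divide_le_eq)
  qed
qed

lemma scaled_in_C: assumes "body_gauge w \<le> c" "0 < c" shows "w /\<^sub>R c \<in> C"
proof -
  have "inverse c * body_gauge w \<le> 1" using assms by (simp add: divide_simps)
  then show ?thesis using assms gauge_scale[of "inverse c" w]
    by (simp add: gauge_le_1_iff[symmetric])
qed

text \<open>
  Together with \<open>gauge_deflate\<close> this says that an answer of the membership oracle at accuracy \<open>\<epsilon>\<close>
  decides whether the gauge exceeds \<open>1\<close> up to an error \<open>\<epsilon> / r\<close>, because the gauge is \<open>1/r\<close>-Lipschitz.
\<close>

lemma inflate_gauge: assumes "w \<in> inflate C \<epsilon>" shows "body_gauge w \<le> 1 + \<epsilon> / r"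
proof -
  obtain y where y: "y \<in> C" "norm (w - y) \<le> \<epsilon>" using assms by (auto simp: inflate_def)
  have "norm (w - y) / r \<le> \<epsilon> / r" using y r_pos by (simp add: divide_right_mono)
  then show ?thesis using gauge_diff_le[of w y] y gauge_le_1_iff[of y] by linarith
qed

lemma gauge_deflate: assumes "body_gauge w \<le> 1 - \<epsilon> / r" shows "w \<in> deflate C \<epsilon>"
  unfolding deflate_def
proof (intro CollectI ballI)
  fix y :: "real^'n" assume "y \<in> cball 0 \<epsilon>"
  then have "norm y / r \<le> \<epsilon> / r" using r_pos by (simp add: divide_right_mono)
  then have "body_gauge (w + y) \<le> 1" using gauge_diff_le[of "w + y" w] assms by simp
  then show "w + y \<in> C" by (simp add: gauge_le_1_iff)
qed

end

section \<open>Estimating the gauge by bisection\<close>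

text \<open>
  The state \<open>(\<alpha>, \<beta>, \<mu>)\<close> of the loop of \<open>gau\<close> after \<open>n\<close> iterations, where \<open>p \<mu>\<close> is the answer
  of the membership oracle at \<open>\<mu> w\<close>.
\<close>

definition bisect :: "(real \<Rightarrow> bool) \<Rightarrow> nat \<Rightarrow> real \<times> real \<times> real" where
  "bisect p n = ((\<lambda>(\<alpha>, \<beta>, \<mu>). let (\<alpha>', \<beta>') = (if p \<mu> then (\<mu>, \<beta>) else (\<alpha>, \<mu>))
     in (\<alpha>', \<beta>', (\<alpha>' + \<beta>') / 2)) ^^ n) (0, 2, 1)"

lemma bisect_0: "bisect p 0 = (0, 2, 1)"
  by (simp add: bisect_def)

lemma bisect_Suc: "bisect p (Suc n) = (case bisect p n of (\<alpha>, \<beta>, \<mu>) \<Rightarrow>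
    if p \<mu> then (\<mu>, \<beta>, (\<mu> + \<beta>) / 2) else (\<alpha>, \<mu>, (\<alpha> + \<mu>) / 2))"
  by (auto simp: bisect_def split: prod.splits if_splits)

text \<open>
  The width \<open>2 / 2 ^ n\<close> does not depend on the answers \<open>p\<close>. Hence the number of iterations of the loop
  of \<open>gau\<close> is the same for all points, which is what makes \<open>gau\<close> measurable. The initial end points are
  the only ones whose oracle answer is not recorded in the state.
\<close>

lemma bisect_invariant:
  assumes "bisect p n = (\<alpha>, \<beta>, \<mu>)"
  shows "\<mu> = (\<alpha> + \<beta>) / 2 \<and> \<beta> - \<alpha> = 2 / 2 ^ n \<and> 0 \<le> \<alpha> \<and> \<beta> \<le> 2 \<and>
    (\<alpha> = 0 \<or> p \<alpha>) \<and> (\<beta> = 2 \<or> \<not> p \<beta>)"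
  using assms
proof (induction n arbitrary: \<alpha> \<beta> \<mu>)
  case (Suc n)
  obtain a b m where abm: "bisect p n = (a, b, m)" by (cases "bisect p n") auto
  note IH = Suc.IH[OF abm]
  define e where "e = 2 / (2::real) ^ n"
  have e: "0 < e" "2 / (2::real) ^ Suc n = e / 2" by (simp_all add: e_def)
  have m: "m = (a + b) / 2" and be: "b - a = e" and bounds: "0 \<le> a" "b \<le> 2"
    and pab: "a = 0 \<or> p a" "b = 2 \<or> \<not> p b"
    using IH by (simp_all add: e_def)
  have half: "b - m = e / 2" "m - a = e / 2" "0 \<le> m" "m \<le> 2"
    using m be bounds e(1) by (simp_all add: field_simps)
  show ?case
  proof (cases "p m")
    case True
    then have eq: "\<alpha> = m" "\<beta> = b" "\<mu> = (m + b) / 2"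
      using Suc.prems by (simp_all add: bisect_Suc abm)
    show ?thesis unfolding eq e(2) using True half bounds pab by simp
  next
    case False
    then have eq: "\<alpha> = a" "\<beta> = m" "\<mu> = (a + m) / 2"
      using Suc.prems by (simp_all add: bisect_Suc abm)
    show ?thesis unfolding eq e(2) using False half bounds pab by simp
  qed
qed (simp add: bisect_0)

lemma while_eq_funpow:
  assumes "\<And>i. i < n \<Longrightarrow> b ((c ^^ i) s)" and "\<not> b ((c ^^ n) s)"
  shows "while b c s = (c ^^ n) s"
  using assms
proof (induction n arbitrary: s)
  case (Suc n)
  have "while b c s = while b c (c s)"
    using Suc.prems(1)[of 0] by (simp add: while_unfold)
  also have "\<dots> = (c ^^ n) (c s)"
    using Suc.prems(1)[of "Suc _"] Suc.prems(2) by (intro Suc.IH) (auto simp: funpow_swap1)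
  finally show ?case by (simp add: funpow_swap1)
qed (simp add: while_unfold)

definition bisect_steps :: "real \<Rightarrow> nat" where
  "bisect_steps tol = (LEAST n. 2 / 2 ^ n \<le> tol)"

lemma bisect_steps:
  assumes "0 < tol"
  shows "2 / 2 ^ bisect_steps tol \<le> tol" and "i < bisect_steps tol \<Longrightarrow> tol < 2 / 2 ^ i"
proof -
  obtain n where "(1 / 2) ^ n < tol / (2::real)"
    using real_arch_pow_inv[of "tol / 2" "1 / 2"] assms by auto
  then have "2 / 2 ^ n \<le> tol" by (simp add: power_divide field_simps)
  then show "2 / 2 ^ bisect_steps tol \<le> tol"
    unfolding bisect_steps_def by (rule LeastI)
  show "tol < 2 / 2 ^ i" if "i < bisect_steps tol"
    using not_less_Least[OF that[unfolded bisect_steps_def]] by simp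
qed

lemma gau_eq_bisect:
  fixes w :: "real^'n"
  assumes "0 < \<delta>" "0 < r" "0 < R"
  defines "tol \<equiv> \<delta> / (8 * (R / r)\<^sup>2)" and "\<epsilon> \<equiv> \<delta> * r / (4 * (R / r))\<^sup>2"
  shows "gau r R mem w \<delta> =
    (if mem (2 *\<^sub>R w) \<epsilon> \<or> norm w \<le> r / 2 then 0
     else inverse (fst (bisect (\<lambda>\<mu>. mem (\<mu> *\<^sub>R w) \<epsilon>) (bisect_steps tol)) - tol))"
proof -
  have tol: "0 < tol" using assms by (simp add: tol_def)
  let ?p = "\<lambda>\<mu>. mem (\<mu> *\<^sub>R w) \<epsilon>"
  have "while (\<lambda>(\<alpha>, \<beta>, \<mu>). \<beta> - \<alpha> > tol)
      (\<lambda>(\<alpha>, \<beta>, \<mu>). let (\<alpha>', \<beta>') = (if ?p \<mu> then (\<mu>, \<beta>) else (\<alpha>, \<mu>))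
         in (\<alpha>', \<beta>', (\<alpha>' + \<beta>') / 2)) (0, 2, 1) = bisect ?p (bisect_steps tol)"
    unfolding bisect_def
  proof (rule while_eq_funpow)
    fix i assume i: "i < bisect_steps tol"
    obtain a b m where abm: "bisect ?p i = (a, b, m)" by (cases "bisect ?p i") auto
    show "case ((\<lambda>(\<alpha>, \<beta>, \<mu>). let (\<alpha>', \<beta>') = (if ?p \<mu> then (\<mu>, \<beta>) else (\<alpha>, \<mu>))
         in (\<alpha>', \<beta>', (\<alpha>' + \<beta>') / 2)) ^^ i) (0, 2, 1) of (\<alpha>, \<beta>, \<mu>) \<Rightarrow> \<beta> - \<alpha> > tol"
      unfolding bisect_def[symmetric] abm
      using bisect_invariant[OF abm] bisect_steps(2)[OF tol i] by simp
  next
    obtain a b m where abm: "bisect ?p (bisect_steps tol) = (a, b, m)"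
      by (cases "bisect ?p (bisect_steps tol)") auto
    show "\<not> (case ((\<lambda>(\<alpha>, \<beta>, \<mu>). let (\<alpha>', \<beta>') = (if ?p \<mu> then (\<mu>, \<beta>) else (\<alpha>, \<mu>))
         in (\<alpha>', \<beta>', (\<alpha>' + \<beta>') / 2)) ^^ bisect_steps tol) (0, 2, 1) of (\<alpha>, \<beta>, \<mu>) \<Rightarrow> \<beta> - \<alpha> > tol)"
      unfolding bisect_def[symmetric] abm
      using bisect_invariant[OF abm] bisect_steps(1)[OF tol] by simp
  qed
  then show ?thesis
    unfolding gau_def Let_def tol_def[symmetric] \<epsilon>_def[symmetric]
    by (simp add: case_prod_unfold)
qed

lemma measurable_gau[measurable]:
  fixes mem :: "real^'n \<Rightarrow> real \<Rightarrow> bool"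
  assumes mem: "\<And>\<epsilon>. \<epsilon> > 0 \<Longrightarrow> {x. mem x \<epsilon>} \<in> sets borel" and pos: "0 < \<delta>" "0 < r" "0 < R"
  shows "(\<lambda>w. gau r R mem w \<delta>) \<in> borel_measurable borel"
proof -
  define \<epsilon> where "\<epsilon> = \<delta> * r / (4 * (R / r))\<^sup>2"
  have "\<epsilon> > 0" using pos by (simp add: \<epsilon>_def)
  then have pred_mem[measurable]: "Measurable.pred borel (\<lambda>x. mem x \<epsilon>)"
    using mem by (simp add: pred_def)
  have *: "(\<lambda>w. fst (bisect (\<lambda>\<mu>. mem (\<mu> *\<^sub>R w) \<epsilon>) n)) \<in> borel_measurable borel \<and>
      (\<lambda>w. fst (snd (bisect (\<lambda>\<mu>. mem (\<mu> *\<^sub>R w) \<epsilon>) n))) \<in> borel_measurable borel \<and>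
      (\<lambda>w. snd (snd (bisect (\<lambda>\<mu>. mem (\<mu> *\<^sub>R w) \<epsilon>) n))) \<in> borel_measurable borel" for n
  proof (induction n)
    case (Suc n)
    then have [measurable]:
      "(\<lambda>w. fst (bisect (\<lambda>\<mu>. mem (\<mu> *\<^sub>R w) \<epsilon>) n)) \<in> borel_measurable borel"
      "(\<lambda>w. fst (snd (bisect (\<lambda>\<mu>. mem (\<mu> *\<^sub>R w) \<epsilon>) n))) \<in> borel_measurable borel"
      "(\<lambda>w. snd (snd (bisect (\<lambda>\<mu>. mem (\<mu> *\<^sub>R w) \<epsilon>) n))) \<in> borel_measurable borel" by auto
    show ?case
      unfolding bisect_Suc case_prod_unfold if_distrib[of fst] if_distrib[of snd] fst_conv snd_conv
      by measurable
  qed (simp add: bisect_0)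
  note [measurable] = *[THEN conjunct1]
  show ?thesis
    unfolding gau_eq_bisect[OF pos] \<epsilon>_def[symmetric] by measurable
qed

context convex_body
begin

text \<open>
  At the end of the bisection \<open>\<alpha>\<close> and \<open>\<beta>\<close> enclose \<open>1 / \<gamma> w\<close> up to the error of the oracle, and
  subtracting the tolerance from \<open>\<alpha>\<close> turns its inverse into an upper estimate of the gauge. The
  bound on the norm of \<open>w\<close> limits the gauge to \<open>6 \<kappa> / 5\<close>, so the tolerance of order
  \<open>\<delta> / \<kappa>\<^sup>2\<close> for the inverse is of order \<open>\<delta>\<close> for the gauge itself. In the remaining case, where
  the bisection is skipped, \<open>w\<close> is well inside \<open>C\<close>.
\<close>

lemma gau_accuracy:
  assumes "0 < \<delta>" "\<delta> < 1" and w: "norm w \<le> 6 * R / 5" and mem: "membership_oracle C mem"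
  shows "gau r R mem w \<delta> = 0 \<and> body_gauge w < 3 / 5 \<or>
    body_gauge w \<le> gau r R mem w \<delta> \<and> gau r R mem w \<delta> \<le> body_gauge w + \<delta>"
proof -
  define \<kappa> where "\<kappa> = R / r"
  define \<epsilon> where "\<epsilon> = \<delta> * r / (4 * \<kappa>)\<^sup>2"
  define tol where "tol = \<delta> / (8 * \<kappa>\<^sup>2)"
  define g where "g = body_gauge w"
  have \<kappa>: "1 \<le> \<kappa>" using r_pos r_le_R by (simp add: \<kappa>_def)
  have eps_pos: "\<epsilon> > 0" using assms r_pos \<kappa> by (simp add: \<epsilon>_def)
  have eps_r: "\<epsilon> / r = tol / 2" using r_pos by (simp add: \<epsilon>_def tol_def power_mult_distrib)
  have tol_pos: "0 < tol" using assms \<kappa> by (simp add: tol_def)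
  have tol_le: "tol \<le> \<delta> / 8"
    unfolding tol_def using assms(1) \<kappa> by (intro divide_left_mono) (auto simp: one_le_power)
  have in_C: "body_gauge v \<le> 1 + tol / 2" if "mem v \<epsilon>" for v
    using mem eps_pos that inflate_gauge[of v \<epsilon>] unfolding membership_oracle_def eps_r by blast
  have out_C: "1 - tol / 2 < body_gauge v" if "\<not> mem v \<epsilon>" for v
    using mem eps_pos that gauge_deflate[of v \<epsilon>] unfolding membership_oracle_def eps_r by fastforce
  have g_eq: "body_gauge (c *\<^sub>R w) = c * g" if "0 \<le> c" for c
    using gauge_scale[OF that] by (simp add: g_def)
  show ?thesis
  proof (cases "mem (2 *\<^sub>R w) \<epsilon> \<or> norm w \<le> r / 2")
    case True
    then have "gau r R mem w \<delta> = 0"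
      using gau_eq_bisect[of \<delta> r R mem w] assms r_pos R_pos by (simp add: \<epsilon>_def \<kappa>_def)
    moreover from True have "g < 3 / 5"
    proof
      assume "mem (2 *\<^sub>R w) \<epsilon>"
      from in_C[OF this] have "2 * g \<le> 1 + tol / 2" by (simp add: g_eq)
      then show ?thesis using tol_le assms by linarith
    next
      assume "norm w \<le> r / 2"
      then have "norm w / r \<le> 1 / 2" using r_pos by (simp add: field_simps)
      then show ?thesis using gauge_le_norm[of w] by (simp add: g_def)
    qed
    ultimately show ?thesis by (simp add: g_def)
  next
    case False
    let ?p = "\<lambda>\<mu>. mem (\<mu> *\<^sub>R w) \<epsilon>"
    obtain \<alpha> \<beta> \<mu> where st: "bisect ?p (bisect_steps tol) = (\<alpha>, \<beta>, \<mu>)"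
      by (cases "bisect ?p (bisect_steps tol)") auto
    note inv = bisect_invariant[OF st]
    have gau: "gau r R mem w \<delta> = inverse (\<alpha> - tol)"
      using gau_eq_bisect[of \<delta> r R mem w] assms r_pos R_pos False st
      by (simp add: \<epsilon>_def \<kappa>_def tol_def)
    have width: "\<beta> - \<alpha> \<le> tol" using inv bisect_steps(1)[OF tol_pos] by simp
    have lower: "\<alpha> * g \<le> 1 + tol / 2"
      using inv in_C[of "\<alpha> *\<^sub>R w"] g_eq[of \<alpha>] tol_pos by auto
    have "0 < 2 / (2::real) ^ bisect_steps tol" by simp
    then have "0 \<le> \<beta>" "\<alpha> \<le> 2" using inv by linarith+
    then have upper: "1 - tol / 2 < \<beta> * g"
      using inv False out_C[of "\<beta> *\<^sub>R w"] g_eq[of \<beta>] by auto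
    have g_nn: "0 \<le> g" by (simp add: g_def gauge_nonneg)
    have g_pos: "0 < g" using g_nn upper tol_le assms by (cases "g = 0") auto
    have "norm w / r \<le> 6 * \<kappa> / 5" using w r_pos by (simp add: \<kappa>_def field_simps)
    then have g_le: "g \<le> 6 * \<kappa> / 5" using gauge_le_norm[of w] unfolding g_def by linarith
    have k2: "\<kappa> * tol = \<delta> / (8 * \<kappa>)" using \<kappa> by (simp add: tol_def power2_eq_square)
    have "\<delta> / (8 * \<kappa>) \<le> \<delta> / 8" using \<kappa> assms by (intro divide_left_mono) auto
    moreover have "tol * g \<le> tol * (6 * \<kappa> / 5)" using g_le tol_pos by (intro mult_left_mono) auto
    moreover have "tol * (6 * \<kappa> / 5) = 6 / 5 * (\<delta> / (8 * \<kappa>))" unfolding k2[symmetric] by simp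
    ultimately have tg: "tol * g \<le> 3 * \<delta> / 20" by linarith
    have "\<beta> * g \<le> (\<alpha> + tol) * g" using width g_nn by (intro mult_right_mono) auto
    then have low: "1 - tol / 2 - 2 * (tol * g) < (\<alpha> - tol) * g"
      using upper by (simp add: algebra_simps)
    have low': "63 / 100 < (\<alpha> - tol) * g" using low tg tol_le assms by linarith
    then have a_pos: "0 < \<alpha> - tol" using g_nn mult_nonpos_nonneg[of "\<alpha> - tol" g] by fastforce
    \<comment> \<open>for gauge at most \<open>1/2\<close> the trivial bound \<open>\<alpha> \<le> 2\<close> suffices; otherwise \<open>tol\<close> outweighs the oracle error\<close>
    have up: "(\<alpha> - tol) * g \<le> 1"
    proof (cases "g \<le> 1 / 2")
      case True
      have "(\<alpha> - tol) * g \<le> 2 * (1 / 2)"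
        using True \<open>\<alpha> \<le> 2\<close> tol_pos g_nn a_pos by (intro mult_mono) auto
      then show ?thesis by simp
    next
      case False
      then have "tol / 2 \<le> tol * g" using tol_pos by simp
      then show ?thesis using lower by (simp add: algebra_simps)
    qed
    have "g \<le> inverse (\<alpha> - tol)" using up a_pos by (simp add: field_simps)
    moreover have "inverse (\<alpha> - tol) \<le> g + \<delta>"
    proof -
      have "g * (1 - (\<alpha> - tol) * g) \<le> g * (tol / 2 + 2 * (tol * g))"
        using low g_nn by (intro mult_left_mono) auto
      also have "\<dots> = tol * g / 2 + 2 * (tol * g) * g" by (simp add: algebra_simps)
      also have "\<dots> \<le> 3 * \<delta> / 40 + 9 / 25 * \<delta>"
      proof -
        have "(tol * g) * g \<le> (tol * (6 * \<kappa> / 5)) * (6 * \<kappa> / 5)"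
          using g_le g_nn tol_pos \<kappa> by (intro mult_mono) auto
        also have "\<dots> = 9 / 50 * \<delta>" using \<kappa> by (simp add: tol_def power2_eq_square)
        finally show ?thesis using tg by linarith
      qed
      also have "\<dots> \<le> \<delta> * (63 / 100)" using assms by simp
      also have "\<dots> \<le> \<delta> * ((\<alpha> - tol) * g)" using low' assms by (intro mult_left_mono) auto
      finally have "g * 1 \<le> g * ((\<alpha> - tol) * (g + \<delta>))" by (simp add: algebra_simps)
      then have "1 \<le> (\<alpha> - tol) * (g + \<delta>)" using g_pos by (simp only: mult_le_cancel_left_pos)
      then show ?thesis using a_pos by (simp add: field_simps)
    qed
    ultimately show ?thesis by (simp add: gau g_def)
  qed
qed

end

section \<open>Coordinate chords of a cube\<close>

lemma measurable_PiM_update: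
  "(\<lambda>(X, y). X(j := y)) \<in> PiM UNIV M \<Otimes>\<^sub>M M j \<rightarrow>\<^sub>M PiM UNIV M"
proof (rule measurable_PiM_single')
  fix i
  show "(\<lambda>p. (case p of (X, y) \<Rightarrow> X(j := y)) i) \<in> PiM UNIV M \<Otimes>\<^sub>M M j \<rightarrow>\<^sub>M M i"
    by (cases "i = j") (auto simp: case_prod_unfold)
qed (auto simp: space_PiM space_pair_measure PiE_iff)

text \<open>
  Replacing one coordinate of a random sequence with independent coordinates by a fresh draw does
  not change its distribution. This is used twice: for the coordinates of a uniform point of a cube,
  and for the draws of the rounds of the game.
\<close>

lemma distr_PiM_resample:
  fixes M :: "'i \<Rightarrow> 'a measure"
  assumes M: "\<And>i. prob_space (M i)"
  shows "distr (PiM UNIV M \<Otimes>\<^sub>M M j) (PiM UNIV M) (\<lambda>(X, y). X(j := y)) = PiM UNIV M"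
proof -
  interpret product_prob_space M UNIV
    using M by (simp add: product_prob_space_def product_prob_space_axioms_def product_sigma_finite_def
        prob_space_imp_sigma_finite)
  have Mj_sigma: "sigma_finite_measure (M j)"
    using M by (rule prob_space_imp_sigma_finite)
  have meas[measurable]: "(\<lambda>(X, y). X(j := y)) \<in> PiM UNIV M \<Otimes>\<^sub>M M j \<rightarrow>\<^sub>M PiM UNIV M"
    by (rule measurable_PiM_update)
  show ?thesis
  proof (rule PiM_eq)
    fix J and A :: "'i \<Rightarrow> 'a set"
    assume J: "finite J" "J \<subseteq> UNIV" and A: "\<And>i. i \<in> J \<Longrightarrow> A i \<in> sets (M i)"
    let ?E = "prod_emb UNIV M J (Pi\<^sub>E J A)"
    let ?E' = "prod_emb UNIV M (J - {j}) (Pi\<^sub>E (J - {j}) A)"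
    let ?Y = "if j \<in> J then A j else space (M j)"
    have E: "?E \<in> sets (PiM UNIV M)" and E': "?E' \<in> sets (PiM UNIV M)"
      using J A by (auto intro!: sets_PiM_I)
    have Y: "?Y \<in> sets (M j)" using A by auto
    have emb: "f \<in> prod_emb UNIV M K (Pi\<^sub>E K A) \<longleftrightarrow> (\<forall>i. f i \<in> space (M i)) \<and> (\<forall>i\<in>K. f i \<in> A i)" for f K
      by (auto simp: prod_emb_iff PiE_iff)
    have "y \<in> space (M j)" if "y \<in> ?Y" for y
      using sets.sets_into_space[OF Y] that by blast
    then have "(\<lambda>(X, y). X(j := y)) -` ?E \<inter> space (PiM UNIV M \<Otimes>\<^sub>M M j) = ?E' \<times> ?Y"
      by (cases "j \<in> J") (fastforce simp: emb space_pair_measure space_PiM PiE_iff split: if_splits)+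
    then have "emeasure (distr (PiM UNIV M \<Otimes>\<^sub>M M j) (PiM UNIV M) (\<lambda>(X, y). X(j := y))) ?E =
        emeasure (PiM UNIV M) ?E' * emeasure (M j) ?Y"
      using E E' Y by (simp add: emeasure_distr sigma_finite_measure.emeasure_pair_measure_Times[OF Mj_sigma])
    also have "\<dots> = (\<Prod>i\<in>J - {j}. emeasure (M i) (A i)) * emeasure (M j) ?Y"
      using J A by (subst emeasure_PiM_emb) auto
    also have "\<dots> = (\<Prod>i\<in>J. emeasure (M i) (A i))"
      using J by (auto simp: prod.remove prob_space.emeasure_space_1[OF M] mult.commute)
    finally show "emeasure (distr (PiM UNIV M \<Otimes>\<^sub>M M j) (PiM UNIV M) (\<lambda>(X, y). X(j := y))) ?E =
      (\<Prod>i\<in>J. emeasure (M i) (A i))" .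
  qed simp
qed

abbreviation cube_measure :: "(real^'n) measure" where
  "cube_measure \<equiv> uniform_measure lborel (cball_inf 0 1)"

abbreviation segment_measure :: "real measure" where
  "segment_measure \<equiv> uniform_measure lborel {-1..1}"

abbreviation vec_upd :: "'a^'n \<Rightarrow> 'n \<Rightarrow> 'a \<Rightarrow> 'a^'n" where
  "vec_upd z I t \<equiv> (\<chi> i. if i = I then t else z $ i)"

lemma cball_inf_eq_cbox: "cball_inf (u::real^'n) \<nu> = cbox (u - (\<chi> i. \<nu>)) (u + (\<chi> i. \<nu>))"
  by (auto simp: mem_cball_inf mem_box_cart abs_le_iff algebra_simps)

lemma cball_inf_borel[measurable]: "cball_inf (u::real^'n) \<nu> \<in> sets borel"
  by (simp add: cball_inf_eq_cbox)

lemma emeasure_lborel_pi_vec: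
  fixes A :: "'n::finite \<Rightarrow> real set"
  assumes A: "\<And>i. A i \<in> sets borel"
  shows "emeasure lborel {x::real^'n. \<forall>i. x $ i \<in> A i} = (\<Prod>i\<in>UNIV. emeasure lborel (A i))"
proof -
  define idx :: "real^'n \<Rightarrow> 'n" where "idx b = (THE i. b = axis i 1)" for b
  have idx: "idx (axis i 1) = i" for i by (simp add: idx_def axis_eq_axis)
  have Basis: "(Basis :: (real^'n) set) = (\<lambda>i. axis i 1) ` UNIV"
    by (auto simp: Basis_vec_def)
  have inj: "inj_on (\<lambda>i. axis i 1 :: real^'n) UNIV" by (auto simp: inj_on_def axis_eq_axis)
  have [measurable]: "A i \<in> sets borel" for i by (rule A)
  have meas: "{x::real^'n. \<forall>i. x $ i \<in> A i} \<in> sets borel" by measurable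
  have ind: "indicator {x::real^'n. \<forall>i. x $ i \<in> A i} x =
      (\<Prod>b\<in>Basis. indicator (A (idx b)) (x \<bullet> b) :: ennreal)" for x
  proof -
    have "(\<Prod>b\<in>Basis. indicator (A (idx b)) (x \<bullet> b) :: ennreal) = (\<Prod>i\<in>UNIV. indicator (A i) (x $ i))"
      unfolding Basis by (subst prod.reindex[OF inj]) (simp add: idx inner_axis)
    also have "\<dots> = indicator {x. \<forall>i. x $ i \<in> A i} x"
      by (auto simp: indicator_def prod_eq_1_iff)
    finally show ?thesis by simp
  qed
  have "emeasure lborel {x::real^'n. \<forall>i. x $ i \<in> A i} =
      (\<integral>\<^sup>+x. indicator {x::real^'n. \<forall>i. x $ i \<in> A i} x \<partial>lborel)"
    using meas by simp
  also have "\<dots> = (\<Prod>b\<in>(Basis :: (real^'n) set). (\<integral>\<^sup>+x. indicator (A (idx b)) x \<partial>lborel))"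
    unfolding ind by (rule nn_integral_lborel_prod) auto
  also have "\<dots> = (\<Prod>i\<in>UNIV. emeasure lborel (A i))"
    unfolding Basis by (subst prod.reindex[OF inj]) (simp add: idx)
  finally show ?thesis .
qed

lemma emeasure_unit_cube: "emeasure lborel (cball_inf (0::real^'n) 1) = 2 ^ CARD('n)"
proof -
  have "cball_inf (0::real^'n) 1 = {x. \<forall>i. x $ i \<in> {-1..1}}"
    by (auto simp: mem_cball_inf abs_le_iff minus_le_iff)
  then show ?thesis using emeasure_lborel_pi_vec[where A = "\<lambda>_::'n. {-1..1}"] by simp
qed

lemma prob_space_unit_cube: "prob_space (cube_measure :: (real^'n) measure)"
proof (rule prob_space_uniform_measure)
  have "emeasure lborel (cball_inf (0::real^'n) 1) < \<infinity>"
    unfolding cball_inf_eq_cbox by (rule emeasure_lborel_cbox_finite)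
  then show "emeasure lborel (cball_inf (0::real^'n) 1) \<noteq> \<infinity>" by simp
qed (simp add: emeasure_unit_cube)

lemma prob_space_segment: "prob_space segment_measure"
  by (intro prob_space_uniform_measure) auto

lemma AE_unit_cube: "AE z in cube_measure. z \<in> cball_inf (0::real^'n) 1"
  by (rule AE_uniform_measureI) auto

lemma measurable_vec_lambda[measurable (raw)]:
  assumes "\<And>i. (\<lambda>x. f x i) \<in> borel_measurable M"
  shows "(\<lambda>x. (\<chi> i. f x i) :: real^'n) \<in> borel_measurable M"
  using assms by (subst borel_measurable_euclidean_space) (auto simp: Basis_vec_def inner_axis)

text \<open>
  A uniform point of the cube has independent uniform coordinates, so \<open>distr_PiM_resample\<close> applies to it.
\<close>

lemma unit_cube_eq_PiM:
  "distr (PiM UNIV (\<lambda>_::'n::finite. segment_measure)) borel (\<lambda>X. \<chi> i. X i) = cube_measure"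
proof -
  interpret product_prob_space "\<lambda>_::'n. segment_measure" UNIV
    using prob_space_segment
    by (simp add: product_prob_space_def product_prob_space_axioms_def product_sigma_finite_def
        prob_space_imp_sigma_finite)
  let ?P = "PiM UNIV (\<lambda>_::'n. segment_measure)"
  have [measurable]: "(\<lambda>x::real^'n. \<lambda>i. x $ i) \<in> cube_measure \<rightarrow>\<^sub>M ?P"
    by (rule measurable_PiM_single') auto
  have [measurable]: "(\<lambda>X. \<chi> i. X i) \<in> ?P \<rightarrow>\<^sub>M (borel :: (real^'n) measure)"
    by (intro measurable_vec_lambda) (auto intro: measurable_compose[OF measurable_component_singleton])
  have "distr (cube_measure :: (real^'n) measure) ?P (\<lambda>x i. x $ i) = ?P"
  proof (rule PiM_eqI)
    fix A :: "'n \<Rightarrow> real set" assume "\<And>i. i \<in> UNIV \<Longrightarrow> A i \<in> sets segment_measure"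
    then have A[measurable]: "\<And>i. A i \<in> sets borel" by simp
    have *: "(\<lambda>x::real^'n. \<lambda>i. x $ i) -` Pi\<^sub>E UNIV A = {x. \<forall>i. x $ i \<in> A i}" by (auto simp: PiE_iff)
    have "cball_inf (0::real^'n) 1 \<inter> {x. \<forall>i. x $ i \<in> A i} = {x. \<forall>i. x $ i \<in> {-1..1} \<inter> A i}"
      by (auto simp: mem_cball_inf abs_le_iff minus_le_iff)
    then have "emeasure (distr (cube_measure :: (real^'n) measure) ?P (\<lambda>x i. x $ i)) (Pi\<^sub>E UNIV A) =
        (\<Prod>i\<in>UNIV. emeasure lborel ({-1..1} \<inter> A i)) / 2 ^ CARD('n)"
      using emeasure_lborel_pi_vec[of "\<lambda>i. {-1..1} \<inter> A i"]
      by (simp add: emeasure_distr * emeasure_unit_cube)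
    also have "\<dots> = (\<Prod>i\<in>UNIV. emeasure lborel ({-1..1} \<inter> A i) / 2)"
      by (simp add: divide_ennreal_def prod.distrib ennreal_inverse_power)
    finally show "emeasure (distr (cube_measure :: (real^'n) measure) ?P (\<lambda>x i. x $ i)) (Pi\<^sub>E UNIV A) =
      (\<Prod>i\<in>UNIV. emeasure segment_measure (A i))"
      by simp
  qed auto
  then have "distr ?P borel (\<lambda>X. \<chi> i. X i) =
      distr (distr (cube_measure :: (real^'n) measure) ?P (\<lambda>x i. x $ i)) borel (\<lambda>X. \<chi> i. X i)"
    by simp
  also have "\<dots> = distr cube_measure borel (\<lambda>x. x)"
    by (subst distr_distr) (simp_all add: o_def)
  finally show ?thesis by (simp add: distr_id2)
qed

lemma measurable_vec_upd[measurable (raw)]: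
  assumes [measurable]: "f \<in> borel_measurable M" "g \<in> borel_measurable M"
  shows "(\<lambda>x. vec_upd (f x) I (g x) :: real^'n) \<in> borel_measurable M"
proof (intro measurable_vec_lambda)
  show "(\<lambda>x. if i = I then g x else f x $ i) \<in> borel_measurable M" for i
    by (cases "i = I")
      (auto intro!: measurable_compose[OF assms(1)] borel_measurable_continuous_onI continuous_intros)
qed

lemma unit_cube_resample:
  fixes I :: "'n::finite"
  shows "distr (cube_measure \<Otimes>\<^sub>M segment_measure) borel (\<lambda>(z, t). vec_upd z I t) =
    (cube_measure :: (real^'n) measure)"
proof -
  let ?P = "PiM UNIV (\<lambda>_::'n. segment_measure)"
  have vec[measurable]: "(\<lambda>X. \<chi> i. X i) \<in> ?P \<rightarrow>\<^sub>M (borel :: (real^'n) measure)"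
    by (intro measurable_vec_lambda) (auto intro: measurable_compose[OF measurable_component_singleton])
  have upd[measurable]: "(\<lambda>(z, t). vec_upd z I t) \<in> borel \<Otimes>\<^sub>M borel \<rightarrow>\<^sub>M (borel :: (real^'n) measure)"
    unfolding case_prod_unfold by measurable
  have fupd[measurable]: "(\<lambda>(X, y). X(I := y)) \<in> ?P \<Otimes>\<^sub>M segment_measure \<rightarrow>\<^sub>M ?P"
    by (rule measurable_PiM_update)
  have "cube_measure \<Otimes>\<^sub>M segment_measure =
      distr ?P borel (\<lambda>X. (\<chi> i. X i) :: real^'n) \<Otimes>\<^sub>M distr segment_measure borel (\<lambda>t. t)"
    by (simp add: unit_cube_eq_PiM distr_id2)
  also have "\<dots> = distr (?P \<Otimes>\<^sub>M segment_measure) (borel \<Otimes>\<^sub>M borel) (\<lambda>(X, t). (\<chi> i. X i, t))"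
    by (intro pair_measure_distr vec prob_space_imp_sigma_finite prob_space.prob_space_distr
        prob_space_segment) auto
  finally have "distr (cube_measure \<Otimes>\<^sub>M segment_measure) borel (\<lambda>(z, t). vec_upd z I t) =
      distr (?P \<Otimes>\<^sub>M segment_measure) borel ((\<lambda>(z, t). vec_upd z I t) \<circ> (\<lambda>(X, t). (\<chi> i. X i, t)))"
    by (simp add: distr_distr)
  also have "(\<lambda>(z, t). vec_upd z I t) \<circ> (\<lambda>(X, t). (\<chi> i. X i, t)) =
      (\<lambda>X. (\<chi> i. X i) :: real^'n) \<circ> (\<lambda>(X, y). X(I := y))"
    by (auto simp: fun_eq_iff vec_eq_iff)
  also have "distr (?P \<Otimes>\<^sub>M segment_measure) borel \<dots> =
      distr (distr (?P \<Otimes>\<^sub>M segment_measure) ?P (\<lambda>(X, y). X(I := y))) borel (\<lambda>X. \<chi> i. X i)"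
    by (rule distr_distr[symmetric]) measurable
  also have "\<dots> = cube_measure"
    using distr_PiM_resample[of "\<lambda>_::'n. segment_measure" I] prob_space_segment
    by (simp add: unit_cube_eq_PiM)
  finally show ?thesis .
qed

lemma integral_unit_cube_resample:
  fixes f :: "real^'n \<Rightarrow> real"
  assumes [measurable]: "f \<in> borel_measurable borel" and bd: "\<And>z. \<bar>f z\<bar> \<le> b"
  shows "(\<integral>z. f z \<partial>cube_measure) =
    (\<integral>z. \<integral>t. f (vec_upd z I t) \<partial>segment_measure \<partial>cube_measure)"
proof -
  interpret c: prob_space "cube_measure :: (real^'n) measure" by (rule prob_space_unit_cube)
  interpret u: prob_space segment_measure by (rule prob_space_segment)
  interpret p: pair_prob_space "cube_measure :: (real^'n) measure" segment_measure ..
  have upd[measurable]: "(\<lambda>(z, t). vec_upd z I t) \<in> borel \<Otimes>\<^sub>M borel \<rightarrow>\<^sub>M (borel :: (real^'n) measure)"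
    unfolding case_prod_unfold by measurable
  have "(\<integral>z. f z \<partial>cube_measure) =
      (\<integral>z. f z \<partial>distr (cube_measure \<Otimes>\<^sub>M segment_measure) borel (\<lambda>(z, t). vec_upd z I t))"
    by (simp add: unit_cube_resample)
  also have "\<dots> = (\<integral>(z, t). f (vec_upd z I t) \<partial>(cube_measure \<Otimes>\<^sub>M segment_measure))"
    by (subst integral_distr) (auto simp: case_prod_unfold)
  also have "\<dots> = (\<integral>z. \<integral>t. f (vec_upd z I t) \<partial>segment_measure \<partial>cube_measure)"
  proof (rule p.integral_fst[symmetric])
    have "(\<lambda>p. f (case p of (z, t) \<Rightarrow> vec_upd z I t)) \<in>
        borel_measurable (cube_measure \<Otimes>\<^sub>M segment_measure)" by measurable
    then show "integrable (cube_measure \<Otimes>\<^sub>M segment_measure) (\<lambda>(z, t). f (vec_upd z I t))"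
      by (intro p.integrable_const_bound[where B = b]) (auto simp: bd case_prod_unfold)
  qed
  finally show ?thesis .
qed

text \<open>
  The difference quotient \<open>t \<mapsto> (\<phi> (t + h) - \<phi> t) / h\<close> is the derivative of
  \<open>t \<mapsto> (A (t + h) - A t) / h\<close> for an antiderivative \<open>A\<close> of \<open>\<phi>\<close>, and by the mean value theorem the
  latter is close to \<open>\<phi>\<close> at both ends of the interval. Working with difference quotients
  avoids differentiating \<open>\<phi>\<close>.
\<close>

lemma unit_interval_diff_quotient:
  fixes \<phi> :: "real \<Rightarrow> real"
  assumes lip: "\<And>s t. \<bar>\<phi> s - \<phi> t\<bar> \<le> L * \<bar>s - t\<bar>" and h: "h \<noteq> 0" "\<bar>h\<bar> \<le> 1"
  shows "\<bar>(\<integral>t. (\<phi> (t + h) - \<phi> t) / h \<partial>segment_measure) - (\<phi> 1 - \<phi> (- 1)) / 2\<bar> \<le> L * \<bar>h\<bar>"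
proof -
  have L: "0 \<le> L" using lip[of 0 1] by simp
  have cont: "continuous_on UNIV \<phi>"
  proof (rule lipschitz_on_continuous_on)
    show "L-lipschitz_on UNIV \<phi>"
      by (rule lipschitz_onI) (use lip L in \<open>auto simp: dist_real_def\<close>)
  qed
  have [measurable]: "\<phi> \<in> borel_measurable borel" using cont by (rule borel_measurable_continuous_onI)
  have isCont: "isCont \<phi> t" for t using cont by (simp add: continuous_on_eq_continuous_at)
  obtain A where A: "\<And>x. x \<in> {-3..3} \<Longrightarrow> (A has_vector_derivative \<phi> x) (at x within {-3..3})"
    using antiderivative_continuous[of "-3" 3 \<phi>] cont continuous_on_subset by blast
  have dA: "(A has_real_derivative \<phi> x) (at x)" if "-3 < x" "x < 3" for x
  proof -
    have "at x within {-3..3} = at x" using that by (intro at_within_interior) auto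
    then show ?thesis using A[of x] that by (simp add: has_real_derivative_iff_has_vector_derivative)
  qed
  have half: "(1::ennreal) / 2 = ennreal (1 / 2)"
    using divide_ennreal[of 1 2] by simp
  have U: "segment_measure = density lborel (\<lambda>x. ennreal (indicator {-1..1} x / 2))"
    unfolding uniform_measure_def
    by (intro arg_cong[of _ _ "density lborel"]) (auto simp: fun_eq_iff indicator_def half)
  have "(\<integral>t. (\<phi> (t + h) - \<phi> t) / h \<partial>segment_measure) =
      (\<integral>t. ((\<phi> (t + h) - \<phi> t) / h / 2) * indicator {-1..1} t \<partial>lborel)"
    unfolding U by (subst integral_density) (auto simp: mult.commute)
  also have "\<dots> = (A (1 + h) - A 1) / h / 2 - (A (- 1 + h) - A (- 1)) / h / 2"
  proof (rule integral_FTC_Icc_real)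
    fix x :: real assume x: "- 1 \<le> x" "x \<le> 1"
    have "((\<lambda>x. A (x + h)) has_real_derivative \<phi> (x + h) * 1) (at x)"
      by (rule DERIV_chain2[OF dA]) (use x h in \<open>auto intro!: derivative_eq_intros\<close>)
    then have "((\<lambda>x. A (x + h)) has_real_derivative \<phi> (x + h)) (at x)" by simp
    then show "((\<lambda>x. (A (x + h) - A x) / h / 2) has_real_derivative (\<phi> (x + h) - \<phi> x) / h / 2) (at x)"
      by (intro DERIV_cdivide DERIV_diff) (use x in \<open>auto intro: dA\<close>)
    show "isCont (\<lambda>x. (\<phi> (x + h) - \<phi> x) / h / 2) x"
      using h by (intro continuous_intros isCont_o2[OF _ isCont] isCont) auto
  qed simp
  finally have int: "(\<integral>t. (\<phi> (t + h) - \<phi> t) / h \<partial>segment_measure) =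
      (A (1 + h) - A 1) / h / 2 - (A (- 1 + h) - A (- 1)) / h / 2" .
  have mean: "\<bar>(A (c + h) - A c) / h - \<phi> c\<bar> \<le> L * \<bar>h\<bar>" if c: "\<bar>c\<bar> = 1" for c
  proof -
    have "\<exists>\<xi>. \<bar>\<xi> - c\<bar> \<le> \<bar>h\<bar> \<and> A (c + h) - A c = h * \<phi> \<xi>"
    proof (cases "h > 0")
      case True
      have "\<exists>z>c. z < c + h \<and> A (c + h) - A c = (c + h - c) * \<phi> z"
        by (rule MVT2) (use True c h in \<open>auto intro!: dA\<close>)
      then obtain \<xi> where "c < \<xi>" "\<xi> < c + h" "A (c + h) - A c = (c + h - c) * \<phi> \<xi>"
        by blast
      then show ?thesis using True by (intro exI[of _ \<xi>]) auto
    next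
      case False
      have "\<exists>z>c + h. z < c \<and> A c - A (c + h) = (c - (c + h)) * \<phi> z"
        by (rule MVT2) (use False c h in \<open>auto intro!: dA\<close>)
      then obtain \<xi> where "c + h < \<xi>" "\<xi> < c" "A c - A (c + h) = (c - (c + h)) * \<phi> \<xi>"
        by blast
      then show ?thesis using False by (intro exI[of _ \<xi>]) auto
    qed
    then obtain \<xi> where \<xi>: "\<bar>\<xi> - c\<bar> \<le> \<bar>h\<bar>" "A (c + h) - A c = h * \<phi> \<xi>" by blast
    have "\<bar>\<phi> \<xi> - \<phi> c\<bar> \<le> L * \<bar>h\<bar>"
      using lip[of \<xi> c] mult_left_mono[OF \<xi>(1) L] by linarith
    then show ?thesis using \<xi>(2) h by simp
  qed
  have half_diff: "\<bar>a / 2 - b / 2 - (p - q) / 2\<bar> \<le> e" if "\<bar>a - p\<bar> \<le> e" "\<bar>b - q\<bar> \<le> e"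
    for a b p q e :: real
    using that by (auto simp: abs_le_iff field_simps)
  show ?thesis unfolding int by (rule half_diff[OF mean mean]) simp_all
qed

text \<open>
  For a differentiable \<open>F\<close> the slope along the chord in direction \<open>i\<close> through \<open>z\<close> is the mean of the
  partial derivative over the chord. By Jensen's inequality \<open>\<phi> i\<close> of the slope is at most the mean of
  \<open>\<phi> i\<close> of the partial derivative, and after resampling the coordinate \<open>i\<close> of \<open>z\<close> this is the
  expectation of \<open>\<phi> i\<close> of the partial derivative at \<open>z\<close>. Summing over \<open>i\<close> gives the gradient at one
  and the same point, where the assumption on the subgradients applies.

  As \<open>F\<close> is convex but possibly not differentiable, partial derivatives are replaced by forward difference
  quotients with step \<open>h\<close>. A component of a subgradient lies between the backward and the forward
  quotient, and the expected difference of the two is of order \<open>h\<close>, because both average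
  to the slope of the chord. All errors vanish as \<open>h\<close> tends to \<open>0\<close>.
\<close>

lemma unit_cube_chord_average:
  fixes F :: "real^'n \<Rightarrow> real" and \<phi> :: "'n \<Rightarrow> real \<Rightarrow> real"
  assumes lip: "\<And>x y. \<bar>F x - F y\<bar> \<le> L * norm (x - y)"
    and \<phi>_convex: "\<And>i. convex_on UNIV (\<phi> i)"
    and \<phi>_lip: "\<And>i s t. \<bar>s\<bar> \<le> L \<Longrightarrow> \<bar>t\<bar> \<le> L \<Longrightarrow> \<bar>\<phi> i s - \<phi> i t\<bar> \<le> \<Lambda> * \<bar>s - t\<bar>"
    and \<Lambda>: "0 \<le> \<Lambda>"
    and sub: "\<And>z. z \<in> cball_inf 0 1 \<Longrightarrow>
      \<exists>g. (\<forall>y. F z + g \<bullet> (y - z) \<le> F y) \<and> (\<Sum>i\<in>UNIV. \<phi> i (g $ i)) \<le> M"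
  shows "(\<integral>z. (\<Sum>i\<in>UNIV. \<phi> i ((F (vec_upd z i 1) - F (vec_upd z i (- 1))) / 2)) \<partial>cube_measure) \<le> M"
proof -
  interpret c: prob_space "cube_measure :: (real^'n) measure" by (rule prob_space_unit_cube)
  interpret u: prob_space segment_measure by (rule prob_space_segment)
  have c_prob: "c.prob UNIV = 1" using c.prob_space by simp
  define s where "s i z = (F (vec_upd z i 1) - F (vec_upd z i (- 1))) / 2" for i z
  define q where "q k i z = (F (z + k *\<^sub>R axis i 1) - F z) / k" for k i z
  define b where "b i = \<bar>\<phi> i 0\<bar> + \<Lambda> * L" for i
  obtain i0 :: 'n where True by blast
  have L: "0 \<le> L" using lip[of "axis i0 1" 0] by simp
  have "L-lipschitz_on UNIV F" by (rule lipschitz_onI) (use lip L in \<open>auto simp: dist_norm\<close>)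
  then have "continuous_on UNIV F" by (rule lipschitz_on_continuous_on)
  then have F[measurable]: "F \<in> borel_measurable borel" by (rule borel_measurable_continuous_onI)
  have \<phi>[measurable]: "\<phi> i \<in> borel_measurable borel" for i
    by (intro borel_measurable_continuous_onI convex_on_continuous \<phi>_convex) simp
  have upd_diff: "vec_upd z i a - vec_upd z i a' = (a - a') *\<^sub>R axis i 1" for z :: "real^'n" and i a a'
    by (simp add: vec_eq_iff axis_def)
  have upd_add: "vec_upd z i a + k *\<^sub>R axis i 1 = vec_upd z i (a + k)" for z :: "real^'n" and i a k
    by (simp add: vec_eq_iff axis_def)
  have q_meas[measurable]: "q k i \<in> borel_measurable borel" for k i
    unfolding q_def by measurable
  have s_meas[measurable]: "s i \<in> borel_measurable borel" for i
    unfolding s_def by measurable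
  have q_bd: "\<bar>q k i z\<bar> \<le> L" if "k \<noteq> 0" for k i z
    using lip[of "z + k *\<^sub>R axis i 1" z] that by (simp add: q_def divide_le_eq)
  have s_bd: "\<bar>s i z\<bar> \<le> L" for i z
    using lip[of "vec_upd z i 1" "vec_upd z i (- 1)"] by (simp add: s_def upd_diff)
  have \<phi>_bd: "\<bar>\<phi> i a\<bar> \<le> b i" if "\<bar>a\<bar> \<le> L" for i a
    using \<phi>_lip[of a 0 i] that L mult_left_mono[OF that \<Lambda>] by (simp add: b_def)
  have int_c: "integrable cube_measure f"
    if "f \<in> borel_measurable borel" "\<And>z. \<bar>f z\<bar> \<le> bnd" for f :: "real^'n \<Rightarrow> real" and bnd
    using that by (intro c.integrable_const_bound[where B = bnd]) auto
  have int_u: "integrable segment_measure f"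
    if "f \<in> borel_measurable borel" "\<And>z. \<bar>f z\<bar> \<le> bnd" for f :: "real \<Rightarrow> real" and bnd
    using that by (intro u.integrable_const_bound[where B = bnd]) auto
  \<comment> \<open>along a chord, the averaged difference quotient is the slope of the chord, up to \<open>L * \<bar>k\<bar>\<close>\<close>
  have chord: "\<bar>(\<integral>t. q k i (vec_upd z i t) \<partial>segment_measure) - s i z\<bar> \<le> L * \<bar>k\<bar>"
    if "k \<noteq> 0" "\<bar>k\<bar> \<le> 1" for k i z
    unfolding q_def s_def upd_add
    by (rule unit_interval_diff_quotient) (use that lip[of "vec_upd z i _" "vec_upd z i _"] in \<open>auto simp: upd_diff\<close>)
  \<comment> \<open>the three errors \<open>\<Lambda> * L * h\<close> per coordinate: one from the chord, two from comparing quotients\<close>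
  have approx: "(\<integral>z. (\<Sum>i\<in>UNIV. \<phi> i (s i z)) \<partial>cube_measure) \<le> M + real CARD('n) * (3 * \<Lambda> * L) * h"
    if h: "0 < h" "h \<le> 1" for h
  proof -
    have jensen: "\<phi> i (s i z) \<le> (\<integral>t. \<phi> i (q h i (vec_upd z i t)) \<partial>segment_measure) + \<Lambda> * L * h" for i z
    proof -
      let ?m = "\<integral>t. q h i (vec_upd z i t) \<partial>segment_measure"
      have int: "integrable segment_measure (\<lambda>t. q h i (vec_upd z i t))"
        by (rule int_u[of _ L]) (use h q_bd in auto)
      have "?m \<le> L" "- L \<le> ?m"
        using q_bd[of h i] h by (auto intro!: u.integral_le_const u.integral_ge_const int simp: abs_le_iff minus_le_iff)
      then have "\<bar>\<phi> i (s i z) - \<phi> i ?m\<bar> \<le> \<Lambda> * \<bar>s i z - ?m\<bar>"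
        using s_bd by (intro \<phi>_lip) auto
      also have "\<dots> \<le> \<Lambda> * (L * h)"
        using chord[of h i z] h \<Lambda> by (intro mult_left_mono) (auto simp: abs_minus_commute)
      finally have "\<phi> i (s i z) \<le> \<phi> i ?m + \<Lambda> * L * h" by (simp add: mult.assoc)
      moreover have "\<phi> i ?m \<le> (\<integral>t. \<phi> i (q h i (vec_upd z i t)) \<partial>segment_measure)"
        by (rule u.jensens_inequality[where I = UNIV])
          (use h in \<open>auto intro!: int int_u[of _ "b i"] \<phi>_bd q_bd \<phi>_convex\<close>)
      ultimately show ?thesis by simp
    qed
    have meas_avg: "(\<lambda>z. \<integral>t. f (vec_upd z i t) \<partial>segment_measure) \<in> borel_measurable borel"
      if [measurable]: "f \<in> borel_measurable borel" for f :: "real^'n \<Rightarrow> real" and i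
    proof (rule u.borel_measurable_lebesgue_integral)
      show "(\<lambda>(z, t). f (vec_upd z i t)) \<in> borel_measurable (borel \<Otimes>\<^sub>M segment_measure)"
        unfolding case_prod_unfold by measurable
    qed
    have avg_bd: "\<bar>\<integral>t. f (vec_upd z i t) \<partial>segment_measure\<bar> \<le> B"
      if [measurable]: "f \<in> borel_measurable borel" and "\<And>z. \<bar>f z\<bar> \<le> B" for f :: "real^'n \<Rightarrow> real" and i z B
      using that(2) unfolding abs_le_iff minus_le_iff[of _ B]
      by (intro conjI u.integral_le_const u.integral_ge_const int_u[of _ B])
        (auto simp: abs_le_iff minus_le_iff)
    have first: "(\<integral>z. \<phi> i (s i z) \<partial>cube_measure) \<le>
        (\<integral>z. \<phi> i (q h i z) \<partial>cube_measure) + \<Lambda> * L * h" for i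
    proof -
      have \<phi>q: "(\<lambda>z. \<phi> i (q h i z)) \<in> borel_measurable borel" "\<bar>\<phi> i (q h i z)\<bar> \<le> b i" for z
        using h by (auto intro!: \<phi>_bd q_bd)
      have avg: "integrable cube_measure (\<lambda>z. \<integral>t. \<phi> i (q h i (vec_upd z i t)) \<partial>segment_measure)"
        by (rule int_c[OF meas_avg[OF \<phi>q(1)] avg_bd[OF \<phi>q]])
      have "integrable cube_measure (\<lambda>z. \<phi> i (s i z))"
        by (rule int_c[of _ "b i"]) (auto intro!: \<phi>_bd s_bd)
      then have "(\<integral>z. \<phi> i (s i z) \<partial>cube_measure) \<le>
          (\<integral>z. (\<integral>t. \<phi> i (q h i (vec_upd z i t)) \<partial>segment_measure) + \<Lambda> * L * h \<partial>cube_measure)"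
        by (intro integral_mono jensen Bochner_Integration.integrable_add avg) simp_all
      also have "\<dots> = (\<integral>z. \<integral>t. \<phi> i (q h i (vec_upd z i t)) \<partial>segment_measure \<partial>cube_measure) + \<Lambda> * L * h"
        using avg by (subst Bochner_Integration.integral_add) (simp_all add: c_prob)
      also have "(\<integral>z. \<integral>t. \<phi> i (q h i (vec_upd z i t)) \<partial>segment_measure \<partial>cube_measure) =
          (\<integral>z. \<phi> i (q h i z) \<partial>cube_measure)"
        by (rule integral_unit_cube_resample[symmetric, where b = "b i"]) (use h in \<open>auto intro!: \<phi>_bd q_bd\<close>)
      finally show ?thesis .
    qed
    have resampled: "\<bar>(\<integral>z. q k i z \<partial>cube_measure) - (\<integral>z. s i z \<partial>cube_measure)\<bar> \<le> L * h"
      if k: "\<bar>k\<bar> = h" for k i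
    proof -
      have k0: "k \<noteq> 0" using k h by auto
      have "(\<integral>z. q k i z \<partial>cube_measure) =
          (\<integral>z. \<integral>t. q k i (vec_upd z i t) \<partial>segment_measure \<partial>cube_measure)"
        by (rule integral_unit_cube_resample[where b = L]) (use k0 in \<open>auto intro!: q_bd\<close>)
      then have "(\<integral>z. q k i z \<partial>cube_measure) - (\<integral>z. s i z \<partial>cube_measure) =
          (\<integral>z. (\<integral>t. q k i (vec_upd z i t) \<partial>segment_measure) - s i z \<partial>cube_measure)"
        using k0 by (subst Bochner_Integration.integral_diff)
          (auto intro!: int_c[of _ L] meas_avg avg_bd q_bd s_bd)
      moreover have "\<bar>\<dots>\<bar> \<le> L * h"
      proof -
        have bd: "\<bar>(\<integral>t. q k i (vec_upd z i t) \<partial>segment_measure) - s i z\<bar> \<le> L * h" for z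
          using chord[of k i z] k k0 h by simp
        have "integrable cube_measure (\<lambda>z. (\<integral>t. q k i (vec_upd z i t) \<partial>segment_measure) - s i z)"
          using bd by (intro int_c[of _ "L * h"] borel_measurable_diff meas_avg) auto
        then show ?thesis
          using bd unfolding abs_le_iff minus_le_iff[of _ "L * h"]
          by (intro conjI c.integral_le_const c.integral_ge_const) (auto simp: abs_le_iff minus_le_iff)
      qed
      ultimately show ?thesis by simp
    qed
    have int_q: "integrable cube_measure (q k i)" if "\<bar>k\<bar> = h" for k i
      using that h by (intro int_c[of _ L] q_bd) auto
    have int_\<phi>q: "integrable cube_measure (\<lambda>z. \<phi> i (q h i z))" for i
      using h by (intro int_c[of _ "b i"] \<phi>_bd q_bd) auto
    have pointwise: "(\<Sum>i\<in>UNIV. \<phi> i (q h i z)) \<le> M + (\<Sum>i\<in>UNIV. \<Lambda> * (q h i z - q (- h) i z))"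
      if z: "z \<in> cball_inf 0 1" for z
    proof -
      obtain g where g: "\<And>y. F z + g \<bullet> (y - z) \<le> F y" and gM: "(\<Sum>i\<in>UNIV. \<phi> i (g $ i)) \<le> M"
        using sub[OF z] by blast
      have "\<phi> i (q h i z) \<le> \<phi> i (g $ i) + \<Lambda> * (q h i z - q (- h) i z)" for i
      proof -
        have up: "g $ i \<le> q h i z"
          using g[of "z + h *\<^sub>R axis i 1"] h by (simp add: q_def inner_axis field_simps)
        have low: "q (- h) i z \<le> g $ i"
          using g[of "z + (- h) *\<^sub>R axis i 1"] h by (simp add: q_def inner_axis field_simps)
        have "\<bar>g $ i\<bar> \<le> L" using up low q_bd[of h i z] q_bd[of "- h" i z] h by auto
        then have "\<bar>\<phi> i (q h i z) - \<phi> i (g $ i)\<bar> \<le> \<Lambda> * \<bar>q h i z - g $ i\<bar>"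
          using q_bd h by (intro \<phi>_lip) auto
        also have "\<dots> \<le> \<Lambda> * (q h i z - q (- h) i z)"
          using up low \<Lambda> by (intro mult_left_mono) auto
        finally show ?thesis by linarith
      qed
      then have "(\<Sum>i\<in>UNIV. \<phi> i (q h i z)) \<le> (\<Sum>i\<in>UNIV. \<phi> i (g $ i) + \<Lambda> * (q h i z - q (- h) i z))"
        by (rule sum_mono)
      then show ?thesis using gM by (simp add: sum.distrib)
    qed
    have "(\<integral>z. (\<Sum>i\<in>UNIV. \<phi> i (s i z)) \<partial>cube_measure) =
        (\<Sum>i\<in>UNIV. \<integral>z. \<phi> i (s i z) \<partial>cube_measure)"
      by (rule Bochner_Integration.integral_sum) (auto intro!: int_c \<phi>_bd s_bd)
    also have "\<dots> \<le> (\<Sum>i\<in>UNIV. (\<integral>z. \<phi> i (q h i z) \<partial>cube_measure) + \<Lambda> * L * h)"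
      by (intro sum_mono first)
    also have "\<dots> = (\<integral>z. (\<Sum>i\<in>UNIV. \<phi> i (q h i z)) \<partial>cube_measure) + real CARD('n) * (\<Lambda> * L * h)"
      by (subst Bochner_Integration.integral_sum) (auto intro: int_\<phi>q simp: sum.distrib)
    also have "(\<integral>z. (\<Sum>i\<in>UNIV. \<phi> i (q h i z)) \<partial>cube_measure) \<le>
        (\<integral>z. M + (\<Sum>i\<in>UNIV. \<Lambda> * (q h i z - q (- h) i z)) \<partial>cube_measure)"
      using AE_unit_cube h
      by (intro integral_mono_AE Bochner_Integration.integrable_add Bochner_Integration.integrable_sum
          integrable_mult_right Bochner_Integration.integrable_diff int_\<phi>q int_q)
        (auto elim!: eventually_mono intro: pointwise)
    also have "\<dots> = M + (\<Sum>i\<in>UNIV. \<Lambda> * ((\<integral>z. q h i z \<partial>cube_measure) - (\<integral>z. q (- h) i z \<partial>cube_measure)))"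
      using h int_q by (simp add: Bochner_Integration.integral_add Bochner_Integration.integral_sum
          Bochner_Integration.integral_diff c_prob)
    also have "\<dots> \<le> M + (\<Sum>i\<in>(UNIV::'n set). \<Lambda> * (2 * (L * h)))"
    proof (intro add_left_mono sum_mono mult_left_mono \<Lambda>)
      fix i
      show "(\<integral>z. q h i z \<partial>cube_measure) - (\<integral>z. q (- h) i z \<partial>cube_measure) \<le> 2 * (L * h)"
        using resampled[of h i] resampled[of "- h" i] h by linarith
    qed
    finally show ?thesis by (simp add: algebra_simps)
  qed
  have "(\<integral>z. (\<Sum>i\<in>UNIV. \<phi> i (s i z)) \<partial>cube_measure) \<le> M"
  proof (rule field_le_epsilon)
    fix e :: real assume e: "0 < e"
    define K where "K = real CARD('n) * (3 * \<Lambda> * L)"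
    have K: "0 \<le> K" using \<Lambda> L by (simp add: K_def)
    define h where "h = min 1 (e / (K + 1))"
    have h: "0 < h" "h \<le> 1" "h \<le> e / (K + 1)" using e K by (auto simp: h_def)
    have "K * h \<le> K * (e / (K + 1))" using h K by (intro mult_left_mono) auto
    also have "\<dots> \<le> e" using e K by (simp add: field_simps)
    finally show "(\<integral>z. (\<Sum>i\<in>UNIV. \<phi> i (s i z)) \<partial>cube_measure) \<le> M + e"
      using approx[OF h(1,2)] by (simp add: K_def)
  qed
  then show ?thesis by (simp add: s_def)
qed

section \<open>Slopes of the gauge in a small cube\<close>

text \<open>
  The accuracy \<open>\<epsilon>\<close> and the two radii \<open>\<nu>\<^sub>1\<close> and \<open>\<nu>\<^sub>2\<close> in the definition of \<open>one_d_opt\<close>; the point below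
  is \<open>z\<close>, for \<open>Z\<close> with one coordinate set to \<open>1\<close> or \<open>-1\<close> an end point of the chord.
\<close>

definition opt_eps :: "real \<Rightarrow> real \<Rightarrow> real \<Rightarrow> real \<Rightarrow> real" where
  "opt_eps r R d \<delta> = r\<^sup>2 * \<delta> ^ 3 / (10 ^ 3 * d powr (7 / 2) * R\<^sup>2)"

definition opt_radius1 :: "real \<Rightarrow> real \<Rightarrow> real \<Rightarrow> real" where
  "opt_radius1 r d \<delta> = r * \<delta> / (10 * d)"

definition opt_radius2 :: "real \<Rightarrow> real \<Rightarrow> real \<Rightarrow> real \<Rightarrow> real" where
  "opt_radius2 r R d \<delta> = sqrt (opt_eps r R d \<delta> * opt_radius1 r d \<delta> * r / sqrt d)"

definition opt_point :: "real \<Rightarrow> real \<Rightarrow> real \<Rightarrow> real^'n \<Rightarrow> real^'n \<Rightarrow> real^'n \<Rightarrow> real^'n" where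
  "opt_point r R \<delta> w U Z = w + opt_radius1 r (real CARD('n)) \<delta> *\<^sub>R U + opt_radius2 r R (real CARD('n)) \<delta> *\<^sub>R Z"

definition opt_slope ::
    "real \<Rightarrow> real \<Rightarrow> (real^'n \<Rightarrow> real \<Rightarrow> bool) \<Rightarrow> real^'n \<Rightarrow> real \<Rightarrow> 'n \<Rightarrow> real^'n \<Rightarrow> real^'n \<Rightarrow> real" where
  "opt_slope r R mem w \<delta> I U Z =
    (gau r R mem (opt_point r R \<delta> w U (vec_upd Z I 1)) (opt_eps r R (real CARD('n)) \<delta>) -
     gau r R mem (opt_point r R \<delta> w U (vec_upd Z I (- 1))) (opt_eps r R (real CARD('n)) \<delta>)) /
    (2 * opt_radius2 r R (real CARD('n)) \<delta>)"

lemma one_d_opt_eq_slope: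
  fixes w :: "real^'n"
  shows "one_d_opt r R mem w \<delta> (I, U, Z) =
    (gau r R mem w \<delta>, (real CARD('n) * opt_slope r R mem w \<delta> I U Z) *\<^sub>R axis I 1)"
proof -
  define d where "d = real CARD('n)"
  define \<nu>\<^sub>2 where "\<nu>\<^sub>2 = opt_radius2 r R d \<delta>"
  define u where "u = w + opt_radius1 r d \<delta> *\<^sub>R U"
  have upd: "(\<chi> i. if i = I then u $ i - \<nu>\<^sub>2 else (u + \<nu>\<^sub>2 *\<^sub>R Z) $ i) = opt_point r R \<delta> w U (vec_upd Z I (- 1))"
    "(\<chi> i. if i = I then u $ i + \<nu>\<^sub>2 else (u + \<nu>\<^sub>2 *\<^sub>R Z) $ i) = opt_point r R \<delta> w U (vec_upd Z I 1)"
    by (simp_all add: vec_eq_iff opt_point_def u_def \<nu>\<^sub>2_def d_def)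
  show ?thesis
    unfolding one_d_opt_def Let_def prod.case opt_slope_def
      opt_radius1_def[symmetric] opt_eps_def[symmetric] opt_radius2_def[symmetric]
      d_def[symmetric] \<nu>\<^sub>2_def[symmetric] u_def[symmetric] upd by simp
qed

lemma norm_unit_cube: assumes "U \<in> cball_inf (0::real^'n) 1" shows "norm U \<le> sqrt (real CARD('n))"
proof -
  have "(norm U)\<^sup>2 = (\<Sum>i\<in>UNIV. (U $ i)\<^sup>2)"
    by (simp add: norm_vec_def L2_set_def sum_nonneg)
  also have "\<dots> \<le> (\<Sum>i\<in>(UNIV::'n set). 1)"
    using assms by (intro sum_mono) (auto simp: mem_cball_inf abs_square_le_1)
  finally show ?thesis by (simp add: real_le_rsqrt)
qed

lemma vec_upd_unit_cube:
  assumes "Z \<in> cball_inf (0::real^'n) 1" "\<bar>t\<bar> \<le> 1"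
  shows "vec_upd Z I t \<in> cball_inf 0 1"
  using assms by (auto simp: mem_cball_inf)

text \<open>
  In terms of \<open>q = \<surd>d\<close> all fractional powers disappear; in particular the second radius is
  \<open>r\<^sup>2 \<delta>\<^sup>2 / (100 q ^ 5 R)\<close>. The penultimate claim is the error of a slope that is caused by an
  error \<open>opt_eps\<close> in the values of the gauge; the last one bounds the distance of the points of the cube
  from the query point.
\<close>

lemma opt_constants:
  assumes pos: "0 < r" "r \<le> R" "0 < \<delta>" "\<delta> < 1 / 3" "1 \<le> d"
  shows "0 < opt_eps r R d \<delta>" "opt_eps r R d \<delta> < 1" "0 < opt_radius1 r d \<delta>" "0 < opt_radius2 r R d \<delta>"
    "opt_eps r R d \<delta> / (2 * opt_radius2 r R d \<delta>) = \<delta> / (20 * d * R)"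
    "sqrt d * (opt_radius1 r d \<delta> + opt_radius2 r R d \<delta>) \<le> r * (31 / 300 * \<delta>)"
proof -
  define q where "q = sqrt d"
  have q: "1 \<le> q" "d = q\<^sup>2" using pos by (simp_all add: q_def)
  have "q ^ 7 = q powr real 7" using q(1) by (intro powr_realpow[symmetric]) simp
  also have "\<dots> = d powr (7 / 2)"
  proof -
    have "q = d powr (1 / 2)" using pos by (simp add: q_def powr_half_sqrt)
    then show ?thesis by (simp add: powr_powr)
  qed
  finally have eps: "opt_eps r R d \<delta> = r\<^sup>2 * \<delta> ^ 3 / (1000 * q ^ 7 * R\<^sup>2)"
    by (simp add: opt_eps_def)
  have rad1: "opt_radius1 r d \<delta> = r * \<delta> / (10 * q\<^sup>2)" by (simp add: opt_radius1_def q)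
  have "opt_eps r R d \<delta> * opt_radius1 r d \<delta> * r / sqrt d = (r\<^sup>2 * \<delta>\<^sup>2 / (100 * q ^ 5 * R))\<^sup>2"
    using pos q(1) unfolding eps rad1 q_def[symmetric]
    by (simp add: field_simps power_numeral_reduce)
  then have rad2: "opt_radius2 r R d \<delta> = r\<^sup>2 * \<delta>\<^sup>2 / (100 * q ^ 5 * R)"
    using pos q(1) by (simp add: opt_radius2_def)
  show "0 < opt_eps r R d \<delta>" "0 < opt_radius1 r d \<delta>" "0 < opt_radius2 r R d \<delta>"
    using pos q(1) by (simp_all add: eps rad1 rad2)
  have "opt_eps r R d \<delta> = (r / R)\<^sup>2 * (\<delta> ^ 3 * (1 / (1000 * q ^ 7)))"
    unfolding eps by (simp add: power_divide)
  also have "\<dots> \<le> 1 * (\<delta> ^ 3 * (1 / (1000 * q ^ 7)))"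
    using pos q(1) by (intro mult_right_mono) (auto simp: power_le_one)
  also have "\<dots> \<le> 1 * (\<delta> ^ 3 * 1)"
  proof (intro mult_left_mono)
    have "1 \<le> q ^ 7" using q(1) by (rule one_le_power)
    then show "1 / (1000 * q ^ 7) \<le> 1" by (subst divide_le_eq_1_pos) linarith+
  qed (use pos in auto)
  also have "\<dots> < 1" using pos by (simp add: power_less_one_iff)
  finally show "opt_eps r R d \<delta> < 1" .
  show "opt_eps r R d \<delta> / (2 * opt_radius2 r R d \<delta>) = \<delta> / (20 * d * R)"
    using pos q(1) unfolding eps rad2 by (simp add: q(2) field_simps power_numeral_reduce)
  have "sqrt d * opt_radius1 r d \<delta> = r * \<delta> / 10 * (1 / q)"
    using q(1) unfolding rad1 q_def[symmetric] by (simp add: field_simps power2_eq_square)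
  also have "\<dots> \<le> r * \<delta> / 10 * 1"
    using q(1) pos by (intro mult_left_mono) auto
  finally have "sqrt d * opt_radius1 r d \<delta> \<le> r * \<delta> / 10" by simp
  moreover have "sqrt d * opt_radius2 r R d \<delta> \<le> r * \<delta> / 300"
  proof -
    have "sqrt d * opt_radius2 r R d \<delta> = (r * \<delta> / 100) * ((r / R) * (\<delta> * (1 / q ^ 4)))"
      using q(1) pos unfolding rad2 q_def[symmetric] by (simp add: field_simps power_numeral_reduce)
    also have "\<dots> \<le> (r * \<delta> / 100) * (1 * (1 / 3 * 1))"
      using q(1) pos by (intro mult_left_mono mult_mono) (auto simp: divide_le_eq one_le_power)
    finally show ?thesis by simp
  qed
  ultimately show "sqrt d * (opt_radius1 r d \<delta> + opt_radius2 r R d \<delta>) \<le> r * (31 / 300 * \<delta>)"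
    by (simp add: algebra_simps)
qed

context convex_body
begin

context
  fixes mem :: "real^'n \<Rightarrow> real \<Rightarrow> bool" and w :: "real^'n" and \<delta> d :: real and U :: "real^'n"
  assumes mem: "membership_oracle C mem"
    and mem_meas: "\<And>\<epsilon>. \<epsilon> > 0 \<Longrightarrow> {x. mem x \<epsilon>} \<in> sets borel"
    and w: "norm w \<le> R" and \<delta>: "0 < \<delta>" "\<delta> < 1 / 3" and gau1: "1 \<le> gau r R mem w \<delta>"
    and U: "U \<in> cball_inf 0 1"
    and d: "d = real CARD('n)"
begin

lemma d_ge_1: "1 \<le> d" using d by (simp add: Suc_leI)

lemmas radii = opt_constants[OF r_pos r_le_R \<delta> d_ge_1]

lemma gauge_w_accurate: "body_gauge w \<le> gau r R mem w \<delta>" "gau r R mem w \<delta> \<le> body_gauge w + \<delta>"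
  using gau_accuracy[of \<delta> w mem] mem w \<delta> gau1 R_pos by auto

abbreviation point :: "real^'n \<Rightarrow> real^'n" where
  "point Z \<equiv> opt_point r R \<delta> w U Z"

lemma opt_point_near:
  assumes "Z \<in> cball_inf 0 1"
  shows "norm (point Z - w) \<le> r * (31 / 300 * \<delta>)"
proof -
  have "norm (point Z - w) \<le>
      norm (opt_radius1 r d \<delta> *\<^sub>R U) + norm (opt_radius2 r R d \<delta> *\<^sub>R Z)"
    unfolding opt_point_def d[symmetric] using norm_triangle_ineq[of "opt_radius1 r d \<delta> *\<^sub>R U" "opt_radius2 r R d \<delta> *\<^sub>R Z"]
    by (simp add: add.assoc)
  also have "\<dots> \<le> opt_radius1 r d \<delta> * sqrt d + opt_radius2 r R d \<delta> * sqrt d"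
    using norm_unit_cube[OF U] norm_unit_cube[OF assms] radii(3,4) unfolding d[symmetric]
    by (auto intro!: add_mono mult_left_mono)
  also have "\<dots> \<le> r * (31 / 300 * \<delta>)"
    using radii(6) by (simp add: algebra_simps)
  finally show ?thesis .
qed

lemma gauge_opt_point_near:
  assumes "Z \<in> cball_inf 0 1"
  shows "\<bar>body_gauge (point Z) - body_gauge w\<bar> \<le> 31 / 300 * \<delta>"
proof -
  have "norm (point Z - w) / r \<le> 31 / 300 * \<delta>"
    using opt_point_near[OF assms] r_pos by (simp add: field_simps)
  then show ?thesis using gauge_lipschitz order_trans by blast
qed

text \<open>
  Since the estimate of the gauge at \<open>w\<close> is at least \<open>1\<close>, the gauge is at least \<open>2/3\<close> there and
  above \<open>3/5\<close> in the whole cube. This excludes the default value \<open>0\<close> of \<open>gau\<close>, which would spoil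
  the slopes.
\<close>

lemma gau_opt_point:
  assumes Z: "Z \<in> cball_inf 0 1"
  defines "p \<equiv> point Z" and "\<epsilon> \<equiv> opt_eps r R d \<delta>"
  shows "body_gauge p \<le> gau r R mem p \<epsilon> \<and> gau r R mem p \<epsilon> \<le> body_gauge p + \<epsilon>"
proof -
  have "r * (31 / 300 * \<delta>) \<le> R * (1 / 5)"
    using r_pos r_le_R \<delta> by (intro mult_mono) auto
  then have "norm p \<le> 6 * R / 5"
    using opt_point_near[OF Z] w norm_triangle_ineq2[of p w] unfolding p_def by linarith
  moreover have "3 / 5 \<le> body_gauge p"
    using gauge_opt_point_near[OF Z] gauge_w_accurate gau1 \<delta> unfolding p_def by linarith
  ultimately show ?thesis
    using gau_accuracy[of \<epsilon> p mem] radii(1,2) mem unfolding \<epsilon>_def by fastforce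
qed

definition exact_slope :: "'n \<Rightarrow> real^'n \<Rightarrow> real" where
  "exact_slope I Z = (body_gauge (point (vec_upd Z I 1)) -
     body_gauge (point (vec_upd Z I (- 1)))) / (2 * opt_radius2 r R d \<delta>)"

abbreviation slope :: "'n \<Rightarrow> real^'n \<Rightarrow> real" where
  "slope I Z \<equiv> opt_slope r R mem w \<delta> I U Z"

lemma opt_slope_error:
  assumes Z: "Z \<in> cball_inf 0 1"
  shows "\<bar>slope I Z - exact_slope I Z\<bar> \<le> \<delta> / (20 * d * R)"
proof -
  have e: "\<bar>(a' - a) / n - (b' - b) / n\<bar> \<le> e / n"
    if "b' \<le> a'" "a' \<le> b' + e" "b \<le> a" "a \<le> b + e" "0 < n" for a a' b b' e n :: real
  proof -
    have "\<bar>(a' - a) / n - (b' - b) / n\<bar> = \<bar>(a' - a) - (b' - b)\<bar> / n"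
      using that by (simp add: diff_divide_distrib[symmetric])
    also have "\<dots> \<le> e / n" using that by (intro divide_right_mono) linarith+
    finally show ?thesis .
  qed
  show ?thesis
    unfolding radii(5)[symmetric] opt_slope_def exact_slope_def d[symmetric]
    using gau_opt_point[OF vec_upd_unit_cube[OF Z, of 1 I]] gau_opt_point[OF vec_upd_unit_cube[OF Z, of "- 1" I]]
      radii(4)
    by (intro e) auto
qed

lemma exact_slope_bound: "\<bar>exact_slope I Z\<bar> \<le> 1 / r"
proof -
  have "point (vec_upd Z I 1) - point (vec_upd Z I (- 1)) =
      (2 * opt_radius2 r R d \<delta>) *\<^sub>R axis I 1"
    by (simp add: opt_point_def d vec_eq_iff axis_def)
  then show ?thesis
    using gauge_lipschitz[of "point (vec_upd Z I 1)" "point (vec_upd Z I (- 1))"] radii(4)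
    by (simp add: exact_slope_def abs_divide divide_le_eq mult.commute)
qed

lemma opt_slope_bound:
  assumes Z: "Z \<in> cball_inf 0 1"
  shows "\<bar>slope I Z\<bar> \<le> 1 / r + \<delta> / (20 * d * R)"
  using opt_slope_error[OF Z, of I] exact_slope_bound[of I Z] by linarith

text \<open>
  The instance of \<open>unit_cube_chord_average\<close> for the gauge, after rescaling the cube around the
  point determined by \<open>w\<close> and \<open>U\<close> to the unit cube. The random point \<open>Z\<close> alone provides the
  averaging, so \<open>U\<close> can be any point of its cube.
\<close>

lemma exact_slope_average:
  assumes convex: "\<And>i. convex_on UNIV (\<phi> i)"
    and lip: "\<And>i s t. \<bar>s\<bar> \<le> 1 / r \<Longrightarrow> \<bar>t\<bar> \<le> 1 / r \<Longrightarrow> \<bar>\<phi> i s - \<phi> i t\<bar> \<le> \<Lambda> * \<bar>s - t\<bar>"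
    and \<Lambda>: "0 \<le> \<Lambda>"
    and sub: "\<And>Z g. Z \<in> cball_inf 0 1 \<Longrightarrow> norm g \<le> 1 / r \<Longrightarrow>
      (\<And>v. body_gauge (point Z) + g \<bullet> (v - point Z) \<le> body_gauge v) \<Longrightarrow>
      (\<Sum>i\<in>UNIV. \<phi> i (g $ i)) \<le> M"
  shows "(\<integral>Z. (\<Sum>i\<in>UNIV. \<phi> i (exact_slope i Z)) \<partial>cube_measure) \<le> M"
proof -
  define n where "n = opt_radius2 r R d \<delta>"
  have n: "0 < n" using radii(4) by (simp add: n_def)
  define F where "F Z = body_gauge (point Z)" for Z
  \<comment> \<open>half the difference of \<open>F\<close> over a chord is \<open>n\<close> times the slope of the gauge\<close>
  define \<psi> where "\<psi> i a = \<phi> i (a / n)" for i a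
  have pt_diff: "point y - point z = n *\<^sub>R (y - z)" for y z
    by (simp add: opt_point_def n_def d algebra_simps)
  have "(\<integral>Z. (\<Sum>i\<in>UNIV. \<psi> i ((F (vec_upd Z i 1) - F (vec_upd Z i (- 1))) / 2)) \<partial>cube_measure) \<le> M"
  proof (rule unit_cube_chord_average[where L = "n / r" and \<Lambda> = "\<Lambda> / n"])
    show "\<bar>F x - F y\<bar> \<le> n / r * norm (x - y)" for x y
      using gauge_lipschitz[of "point x" "point y"] n
      by (simp add: F_def pt_diff)
    show "convex_on UNIV (\<psi> i)" for i
    proof (rule convex_onI)
      fix t x y :: real assume "0 < t" "t < 1"
      then show "\<psi> i ((1 - t) *\<^sub>R x + t *\<^sub>R y) \<le> (1 - t) * \<psi> i x + t * \<psi> i y"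
        using convex_onD[OF convex[of i], of t "x / n" "y / n"] by (simp add: \<psi>_def add_divide_distrib)
    qed simp
    show "\<bar>\<psi> i s - \<psi> i t\<bar> \<le> \<Lambda> / n * \<bar>s - t\<bar>" if "\<bar>s\<bar> \<le> n / r" "\<bar>t\<bar> \<le> n / r" for i s t
    proof -
      have "\<bar>s / n\<bar> \<le> 1 / r" "\<bar>t / n\<bar> \<le> 1 / r"
        using that n r_pos by (simp_all add: abs_divide field_simps)
      from lip[OF this] show ?thesis
        using n by (simp add: \<psi>_def abs_divide diff_divide_distrib[symmetric])
    qed
    show "0 \<le> \<Lambda> / n" using \<Lambda> n by simp
    fix Z :: "real^'n" assume Z: "Z \<in> cball_inf 0 1"
    obtain s where s: "norm s \<le> 1 / r"
      "\<And>v. body_gauge (point Z) + s \<bullet> (v - point Z) \<le> body_gauge v"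
      using gauge_subgradient by blast
    show "\<exists>g. (\<forall>y. F Z + g \<bullet> (y - Z) \<le> F y) \<and> (\<Sum>i\<in>UNIV. \<psi> i (g $ i)) \<le> M"
    proof (intro exI[of _ "n *\<^sub>R s"] conjI allI)
      show "F Z + (n *\<^sub>R s) \<bullet> (y - Z) \<le> F y" for y
        using s(2)[of "point y"] by (simp add: F_def pt_diff)
      show "(\<Sum>i\<in>UNIV. \<psi> i ((n *\<^sub>R s) $ i)) \<le> M"
        using sub[OF Z s] n by (simp add: \<psi>_def)
    qed
  qed
  then show ?thesis by (simp add: \<psi>_def F_def exact_slope_def n_def field_simps)
qed

lemma exact_slope_square_average:
  "(\<integral>Z. (\<Sum>i\<in>UNIV. (exact_slope i Z)\<^sup>2) \<partial>cube_measure) \<le> (1 / r)\<^sup>2"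
proof (rule exact_slope_average[where \<Lambda> = "2 / r"])
  show "convex_on UNIV (\<lambda>a::real. a\<^sup>2)" by (rule convex_power2)
  show "\<bar>s\<^sup>2 - t\<^sup>2\<bar> \<le> 2 / r * \<bar>s - t\<bar>" if "\<bar>s\<bar> \<le> 1 / r" "\<bar>t\<bar> \<le> 1 / r" for s t :: real
  proof -
    have "\<bar>s\<^sup>2 - t\<^sup>2\<bar> = \<bar>s + t\<bar> * \<bar>s - t\<bar>"
      by (simp add: abs_mult[symmetric] power2_eq_square algebra_simps)
    also have "\<dots> \<le> 2 / r * \<bar>s - t\<bar>" using that by (intro mult_right_mono) auto
    finally show ?thesis .
  qed
  show "0 \<le> 2 / r" using r_pos by simp
  fix g :: "real^'n" assume g: "norm g \<le> 1 / r"
  have "(\<Sum>i\<in>UNIV. (g $ i)\<^sup>2) = (norm g)\<^sup>2" by (simp add: norm_vec_def L2_set_def sum_nonneg)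
  also have "\<dots> \<le> (1 / r)\<^sup>2" using g by (intro power_mono) auto
  finally show "(\<Sum>i\<in>UNIV. (g $ i)\<^sup>2) \<le> (1 / r)\<^sup>2" .
qed

text \<open>
  A subgradient of the gauge at a point \<open>p\<close> of the cube bounds the change of the gauge from \<open>p\<close> to
  \<open>x\<close>. Passing from \<open>p\<close> to \<open>w\<close> costs twice the distance of \<open>p\<close> and \<open>w\<close> divided by \<open>r\<close>: once in the
  inner product and once in the value of the gauge.
\<close>

lemma exact_slope_linear_average:
  assumes x: "x \<in> C"
  shows "(\<integral>Z. (\<Sum>i\<in>UNIV. exact_slope i Z * (x - w) $ i) \<partial>cube_measure) \<le>
    1 - body_gauge w + 62 / 300 * \<delta>"
proof (rule exact_slope_average[where \<Lambda> = "norm (x - w)"])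
  show "convex_on UNIV (\<lambda>a::real. a * (x - w) $ i)" for i
    by (rule convex_onI) (auto simp: algebra_simps)
  show "\<bar>s * (x - w) $ i - t * (x - w) $ i\<bar> \<le> norm (x - w) * \<bar>s - t\<bar>" for i s t
  proof -
    have "\<bar>s * (x - w) $ i - t * (x - w) $ i\<bar> = \<bar>(x - w) $ i\<bar> * \<bar>s - t\<bar>"
      by (simp add: abs_mult[symmetric] algebra_simps)
    also have "\<dots> \<le> norm (x - w) * \<bar>s - t\<bar>" by (intro mult_right_mono component_le_norm_cart) auto
    finally show ?thesis .
  qed
  show "0 \<le> norm (x - w)" by simp
  fix Z g :: "real^'n" assume Z: "Z \<in> cball_inf 0 1" and g: "norm g \<le> 1 / r"
    and sub: "\<And>v. body_gauge (point Z) + g \<bullet> (v - point Z) \<le> body_gauge v"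
  let ?p = "point Z"
  have "g \<bullet> (?p - w) \<le> (1 / r) * (r * (31 / 300 * \<delta>))"
    using norm_cauchy_schwarz[of g "?p - w"] mult_mono[OF g opt_point_near[OF Z]] r_pos by auto
  then have "g \<bullet> (?p - w) \<le> 31 / 300 * \<delta>" using r_pos by simp
  moreover have "(\<Sum>i\<in>UNIV. g $ i * (x - w) $ i) = g \<bullet> (x - w)"
    by (simp add: inner_vec_def)
  moreover have "g \<bullet> (x - w) = g \<bullet> (x - ?p) + g \<bullet> (?p - w)"
    by (simp add: inner_diff_right)
  moreover have "body_gauge ?p + g \<bullet> (x - ?p) \<le> 1"
    using sub[of x] x gauge_le_1_iff[of x] by linarith
  ultimately show "(\<Sum>i\<in>UNIV. g $ i * (x - w) $ i) \<le> 1 - body_gauge w + 62 / 300 * \<delta>"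
    using gauge_opt_point_near[OF Z] by linarith
qed

lemma measurable_exact_slope[measurable]: "exact_slope i \<in> borel_measurable borel"
proof -
  have "(1 / r)-lipschitz_on UNIV body_gauge"
    by (rule lipschitz_onI) (use gauge_lipschitz r_pos in \<open>auto simp: dist_norm\<close>)
  then have [measurable]: "body_gauge \<in> borel_measurable borel"
    by (intro borel_measurable_continuous_onI lipschitz_on_continuous_on)
  show ?thesis unfolding exact_slope_def opt_point_def by measurable
qed

lemma measurable_opt_slope_Z[measurable]: "slope i \<in> borel_measurable borel"
proof -
  have [measurable]: "(\<lambda>w. gau r R mem w (opt_eps r R d \<delta>)) \<in> borel_measurable borel"
    by (rule measurable_gau[OF mem_meas radii(1) r_pos R_pos])
  show ?thesis unfolding opt_slope_def opt_point_def d[symmetric] by measurable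
qed

lemma integrable_cubeI:
  fixes f :: "real^'n \<Rightarrow> real"
  assumes "f \<in> borel_measurable borel" "\<And>Z. Z \<in> cball_inf 0 1 \<Longrightarrow> \<bar>f Z\<bar> \<le> b"
  shows "integrable cube_measure f"
proof -
  interpret c: prob_space "cube_measure :: (real^'n) measure" by (rule prob_space_unit_cube)
  show ?thesis
    using assms AE_unit_cube by (intro c.integrable_const_bound[where B = b]) (auto elim!: eventually_mono)
qed

lemma opt_slope_square_average:
  "(\<integral>Z. (\<Sum>i\<in>UNIV. (slope i Z)\<^sup>2) \<partial>cube_measure) \<le> (1 / r + \<delta> / (20 * R))\<^sup>2"
proof -
  interpret c: prob_space "cube_measure :: (real^'n) measure" by (rule prob_space_unit_cube)
  have c_prob: "c.prob UNIV = 1" using c.prob_space by simp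
  define \<eta> where "\<eta> = \<delta> / (20 * d * R)"
  have \<eta>: "0 \<le> \<eta>" using \<delta> R_pos d_ge_1 by (simp add: \<eta>_def)
  have d\<eta>: "d * \<eta> = \<delta> / (20 * R)" using d_ge_1 by (simp add: \<eta>_def)
  have sq: "(slope i Z)\<^sup>2 \<le> (exact_slope i Z)\<^sup>2 + (2 / r * \<eta> + \<eta>\<^sup>2)"
    if Z: "Z \<in> cball_inf 0 1" for i Z
  proof -
    let ?s = "exact_slope i Z" and ?e = "slope i Z - exact_slope i Z"
    have e: "\<bar>?e\<bar> \<le> \<eta>" using opt_slope_error[OF Z] by (simp add: \<eta>_def)
    have "(slope i Z)\<^sup>2 = ?s\<^sup>2 + (2 * (?s * ?e) + ?e\<^sup>2)"
      by (simp add: power2_eq_square algebra_simps)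
    also have "?s * ?e \<le> \<bar>?s\<bar> * \<bar>?e\<bar>" by (simp add: abs_mult[symmetric])
    also have "\<bar>?s\<bar> * \<bar>?e\<bar> \<le> (1 / r) * \<eta>"
      using exact_slope_bound e r_pos by (intro mult_mono) auto
    also have "?e\<^sup>2 \<le> \<eta>\<^sup>2" using e \<eta> by (simp add: abs_le_square_iff[symmetric])
    finally show ?thesis by simp
  qed
  have int: "integrable cube_measure (\<lambda>Z. \<Sum>i\<in>UNIV. (exact_slope i Z)\<^sup>2)"
    by (intro Bochner_Integration.integrable_sum integrable_cubeI[where b = "(1 / r)\<^sup>2"])
      (use exact_slope_bound r_pos in \<open>auto simp: abs_le_square_iff[symmetric]\<close>)
  have int': "integrable cube_measure (\<lambda>Z. \<Sum>i\<in>UNIV. (slope i Z)\<^sup>2)"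
  proof (intro Bochner_Integration.integrable_sum integrable_cubeI[where b = "(1 / r + \<eta>)\<^sup>2"])
    show "\<bar>(slope i Z)\<^sup>2\<bar> \<le> (1 / r + \<eta>)\<^sup>2" if "Z \<in> cball_inf 0 1" for i Z
      using opt_slope_bound[OF that, of i] \<eta> r_pos by (simp add: \<eta>_def[symmetric] abs_le_square_iff[symmetric])
  qed simp
  have "(\<integral>Z. (\<Sum>i\<in>UNIV. (slope i Z)\<^sup>2) \<partial>cube_measure) \<le>
      (\<integral>Z. (\<Sum>i\<in>UNIV. (exact_slope i Z)\<^sup>2) + d * (2 / r * \<eta> + \<eta>\<^sup>2) \<partial>cube_measure)"
  proof (intro integral_mono_AE int' Bochner_Integration.integrable_add int)
    show "AE Z in cube_measure. (\<Sum>i\<in>UNIV. (slope i Z)\<^sup>2) \<le>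
        (\<Sum>i\<in>UNIV. (exact_slope i Z)\<^sup>2) + d * (2 / r * \<eta> + \<eta>\<^sup>2)"
      using AE_unit_cube
    proof eventually_elim
      case (elim Z)
      have "(\<Sum>i\<in>UNIV. (slope i Z)\<^sup>2) \<le>
          (\<Sum>i\<in>UNIV. (exact_slope i Z)\<^sup>2 + (2 / r * \<eta> + \<eta>\<^sup>2))"
        by (intro sum_mono sq elim)
      then show ?case by (simp add: sum.distrib d)
    qed
  qed simp
  also have "\<dots> \<le> (1 / r)\<^sup>2 + d * (2 / r * \<eta> + \<eta>\<^sup>2)"
    using int exact_slope_square_average by (simp add: c_prob)
  also have "\<dots> = (1 / r)\<^sup>2 + 2 / r * (d * \<eta>) + (d * \<eta>) * \<eta>"
    by (simp add: algebra_simps power2_eq_square)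
  also have "\<dots> \<le> (1 / r)\<^sup>2 + 2 / r * (d * \<eta>) + (d * \<eta>) * (d * \<eta>)"
    using \<eta> d_ge_1 mult_right_mono[of 1 d \<eta>] by (intro add_left_mono mult_left_mono) auto
  also have "\<dots> = (1 / r + d * \<eta>)\<^sup>2" by (simp add: power2_eq_square algebra_simps)
  finally show ?thesis by (simp add: d\<eta>)
qed

lemma opt_slope_linear_average:
  assumes x: "x \<in> C"
  shows "(\<integral>Z. (\<Sum>i\<in>UNIV. slope i Z * (x - w) $ i) \<partial>cube_measure) \<le>
    1 - gau r R mem w \<delta> + 2 * \<delta>"
proof -
  interpret c: prob_space "cube_measure :: (real^'n) measure" by (rule prob_space_unit_cube)
  have c_prob: "c.prob UNIV = 1" using c.prob_space by simp
  define \<eta> where "\<eta> = \<delta> / (20 * d * R)"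
  have \<eta>: "0 \<le> \<eta>" using \<delta> R_pos d_ge_1 by (simp add: \<eta>_def)
  have comp: "\<bar>(x - w) $ i\<bar> \<le> 2 * R" for i
  proof -
    have "norm x \<le> R" using x sub_ball by auto
    then show ?thesis using component_le_norm_cart[of "x - w" i] norm_triangle_ineq4[of x w] w by linarith
  qed
  have lin: "slope i Z * (x - w) $ i \<le> exact_slope i Z * (x - w) $ i + \<eta> * (2 * R)"
    if Z: "Z \<in> cball_inf 0 1" for i Z
  proof -
    have "(slope i Z - exact_slope i Z) * (x - w) $ i \<le>
        \<bar>slope i Z - exact_slope i Z\<bar> * \<bar>(x - w) $ i\<bar>"
      unfolding abs_mult[symmetric] by simp
    also have "\<dots> \<le> \<eta> * (2 * R)"
      using opt_slope_error[OF Z] comp \<eta> by (intro mult_mono) (auto simp: \<eta>_def)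
    finally show ?thesis by (simp add: algebra_simps)
  qed
  have int: "integrable cube_measure (\<lambda>Z. \<Sum>i\<in>UNIV. exact_slope i Z * (x - w) $ i)"
    by (intro Bochner_Integration.integrable_sum integrable_mult_left integrable_cubeI[where b = "1 / r"])
      (use exact_slope_bound in auto)
  have int': "integrable cube_measure (\<lambda>Z. \<Sum>i\<in>UNIV. slope i Z * (x - w) $ i)"
    by (intro Bochner_Integration.integrable_sum integrable_mult_left
        integrable_cubeI[where b = "1 / r + \<delta> / (20 * d * R)"])
      (use opt_slope_bound in auto)
  have "(\<integral>Z. (\<Sum>i\<in>UNIV. slope i Z * (x - w) $ i) \<partial>cube_measure) \<le>
      (\<integral>Z. (\<Sum>i\<in>UNIV. exact_slope i Z * (x - w) $ i) + d * (\<eta> * (2 * R)) \<partial>cube_measure)"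
  proof (intro integral_mono_AE int' Bochner_Integration.integrable_add int)
    show "AE Z in cube_measure. (\<Sum>i\<in>UNIV. slope i Z * (x - w) $ i) \<le>
        (\<Sum>i\<in>UNIV. exact_slope i Z * (x - w) $ i) + d * (\<eta> * (2 * R))"
      using AE_unit_cube
    proof eventually_elim
      case (elim Z)
      have "(\<Sum>i\<in>UNIV. slope i Z * (x - w) $ i) \<le>
          (\<Sum>i\<in>UNIV. exact_slope i Z * (x - w) $ i + \<eta> * (2 * R))"
        by (intro sum_mono lin elim)
      then show ?case by (simp add: sum.distrib d)
    qed
  qed simp
  also have "\<dots> = (\<integral>Z. (\<Sum>i\<in>UNIV. exact_slope i Z * (x - w) $ i) \<partial>cube_measure) + \<delta> / 10"
    using int R_pos d_ge_1 by (simp add: c_prob \<eta>_def)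
  also have "\<dots> \<le> 1 - gau r R mem w \<delta> + 2 * \<delta>"
    using exact_slope_linear_average[OF x] gauge_w_accurate \<delta> by linarith
  finally show ?thesis .
qed

end

end

section \<open>Moments of the stochastic subgradient\<close>

lemma sets_draw_measure[measurable_cong]:
  "sets (draw_measure :: 'n::finite draw measure) = sets (count_space UNIV \<Otimes>\<^sub>M (borel \<Otimes>\<^sub>M borel))"
  unfolding draw_measure_def
  by (intro sets_pair_measure_cong sets_uniform_count_measure_count_space) simp_all

lemma prob_space_pairI:
  assumes "prob_space M" "prob_space N"
  shows "prob_space (M \<Otimes>\<^sub>M N)"
proof -
  interpret M: prob_space M by fact
  interpret N: prob_space N by fact
  interpret pair_prob_space M N ..
  show ?thesis by (rule P.prob_space_axioms)
qed

lemma pair_prob_spaceI: "prob_space M \<Longrightarrow> prob_space N \<Longrightarrow> pair_prob_space M N"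
  by (simp add: pair_prob_space_def pair_sigma_finite_def prob_space_imp_sigma_finite)

lemma prob_space_draw: "prob_space (draw_measure :: 'n::finite draw measure)"
  unfolding draw_measure_def
  by (intro prob_space_pairI prob_space_unit_cube prob_space_uniform_count_measure) auto

lemma AE_draw:
  "AE y in (draw_measure :: 'n::finite draw measure). fst (snd y) \<in> cball_inf 0 1 \<and> snd (snd y) \<in> cball_inf 0 1"
proof -
  let ?C = "cube_measure :: (real^'n) measure" and ?I = "uniform_count_measure (UNIV :: 'n set)"
  let ?C2 = "?C \<Otimes>\<^sub>M ?C"
  interpret c: prob_space ?C by (rule prob_space_unit_cube)
  interpret p: pair_prob_space ?C ?C
    by (intro pair_prob_spaceI prob_space_unit_cube)
  interpret q: pair_prob_space ?I ?C2
    by (intro pair_prob_spaceI prob_space_pairI prob_space_unit_cube prob_space_uniform_count_measure) auto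
  have cube: "{q \<in> space ?C2. fst q \<in> cball_inf 0 1 \<and> snd q \<in> cball_inf 0 1} \<in> sets ?C2"
    by measurable
  have "AE q in ?C2. fst q \<in> cball_inf 0 1 \<and> snd q \<in> cball_inf 0 1"
  proof (rule p.AE_pair_measure)
    show "AE U in ?C. AE Z in ?C.
        fst (U, Z) \<in> cball_inf 0 1 \<and> snd (U, Z) \<in> cball_inf (0::real^'n) 1"
      using AE_unit_cube
    proof eventually_elim
      case (elim U)
      show ?case using AE_unit_cube by eventually_elim (simp add: elim)
    qed
  qed (rule cube)
  moreover have "{y \<in> space (?I \<Otimes>\<^sub>M ?C2).
      fst (snd y) \<in> cball_inf 0 1 \<and> snd (snd y) \<in> cball_inf 0 1} \<in>
    sets (?I \<Otimes>\<^sub>M ?C2)"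
    by measurable
  ultimately show ?thesis
    unfolding draw_measure_def by (intro q.AE_pair_measure) simp_all
qed

text \<open>
  Averaging over the coordinate \<open>I\<close> turns a function of one slope into a normalized sum over all
  slopes, which is the form of the averages over \<open>Z\<close> above.
\<close>

lemma integral_draw_le:
  fixes f :: "'n::finite draw \<Rightarrow> real"
  assumes int: "integrable draw_measure f"
    and bd: "\<And>U. U \<in> cball_inf 0 1 \<Longrightarrow>
      (\<integral>Z. (\<Sum>I\<in>UNIV. f (I, U, Z)) / real CARD('n) \<partial>cube_measure) \<le> M"
  shows "(\<integral>y. f y \<partial>draw_measure) \<le> M"
proof -
  let ?C = "cube_measure :: (real^'n) measure" and ?I = "uniform_count_measure (UNIV :: 'n set)"
  let ?C2 = "?C \<Otimes>\<^sub>M ?C"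
  interpret c: prob_space ?C by (rule prob_space_unit_cube)
  interpret p: pair_prob_space ?C ?C
    by (intro pair_prob_spaceI prob_space_unit_cube)
  interpret q: pair_prob_space ?I ?C2
    by (intro pair_prob_spaceI prob_space_pairI prob_space_unit_cube prob_space_uniform_count_measure) auto
  have int1: "integrable (?I \<Otimes>\<^sub>M ?C2) (\<lambda>(I, p). f (I, p))"
    using int by (simp add: draw_measure_def)
  have avg: "(\<integral>I. f (I, p) \<partial>uniform_count_measure UNIV) = (\<Sum>I\<in>UNIV. f (I, p)) / real CARD('n)" for p
    by (simp add: integral_uniform_count_measure)
  have int2: "integrable ?C2
      (\<lambda>(U, Z). (\<Sum>I\<in>UNIV. f (I, U, Z)) / real CARD('n))"
    using q.integrable_snd[OF int1] unfolding avg by (simp add: case_prod_unfold)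
  have "(\<integral>y. f y \<partial>draw_measure) =
      (\<integral>p. (\<Sum>I\<in>UNIV. f (I, p)) / real CARD('n) \<partial>?C2)"
    using q.integral_snd[OF int1] unfolding avg by (simp add: draw_measure_def)
  also have "\<dots> =
      (\<integral>U. \<integral>Z. (\<Sum>I\<in>UNIV. f (I, U, Z)) / real CARD('n) \<partial>?C \<partial>?C)"
    using p.integral_fst[OF int2] by (simp add: case_prod_unfold)
  also have "\<dots> \<le> M"
  proof (rule c.integral_le_const)
    show "integrable ?C (\<lambda>U. \<integral>Z. (\<Sum>I\<in>UNIV. f (I, U, Z)) / real CARD('n) \<partial>?C)"
      using p.integrable_fst[OF int2] by simp
    show "AE U in ?C. (\<integral>Z. (\<Sum>I\<in>UNIV. f (I, U, Z)) / real CARD('n) \<partial>?C) \<le> M"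
      using AE_unit_cube by eventually_elim (rule bd)
  qed
  finally show ?thesis .
qed

text \<open>
  Joint measurability in the query point and the draw is required, since the query point of a round
  depends on the earlier draws.
\<close>

lemma measurable_one_d_opt:
  fixes mem :: "real^'n \<Rightarrow> real \<Rightarrow> bool"
  assumes mem: "\<And>\<epsilon>. \<epsilon> > 0 \<Longrightarrow> {x. mem x \<epsilon>} \<in> sets borel"
    and pos: "0 < r" "r \<le> R" "0 < \<delta>" "\<delta> < 1 / 3"
  shows "(\<lambda>p. snd (one_d_opt r R mem (fst p) \<delta> (snd p))) \<in> borel \<Otimes>\<^sub>M draw_measure \<rightarrow>\<^sub>M borel"
proof -
  have d: "1 \<le> real CARD('n)" by (simp add: Suc_leI)
  note c = opt_constants[OF pos d]
  have "0 < R" using pos by simp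
  have [measurable]: "(\<lambda>w. gau r R mem w (opt_eps r R (real CARD('n)) \<delta>)) \<in> borel_measurable borel"
    by (rule measurable_gau[OF mem c(1) pos(1) \<open>0 < R\<close>])
  have "(\<lambda>p. (real CARD('n) * opt_slope r R mem (fst p) \<delta> I (fst (snd (snd p))) (snd (snd (snd p)))) *\<^sub>R axis I (1::real))
    \<in> borel \<Otimes>\<^sub>M draw_measure \<rightarrow>\<^sub>M borel" for I :: 'n
  proof -
    show ?thesis unfolding opt_slope_def opt_point_def by measurable
  qed
  moreover have "(\<lambda>p. fst (snd p)) \<in> (borel :: (real^'n) measure) \<Otimes>\<^sub>M (draw_measure :: 'n draw measure) \<rightarrow>\<^sub>M count_space UNIV"
    by measurable
  ultimately have "(\<lambda>p. (real CARD('n) * opt_slope r R mem (fst p) \<delta> (fst (snd p)) (fst (snd (snd p))) (snd (snd (snd p)))) *\<^sub>R axis (fst (snd p)) (1::real))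
    \<in> borel \<Otimes>\<^sub>M draw_measure \<rightarrow>\<^sub>M borel"
    by (rule measurable_compose_countable)
  moreover have "snd (one_d_opt r R mem w \<delta> y) =
      (real CARD('n) * opt_slope r R mem w \<delta> (fst y) (fst (snd y)) (snd (snd y))) *\<^sub>R axis (fst y) 1" for w y
    using one_d_opt_eq_slope[of r R mem w \<delta> "fst y" "fst (snd y)" "snd (snd y)"] by simp
  ultimately show ?thesis by simp
qed

lemma fst_one_d_opt: "fst (one_d_opt r R mem w \<delta> y) = gau r R mem w \<delta>"
  using one_d_opt_eq_slope[of r R mem w \<delta> "fst y" "fst (snd y)" "snd (snd y)"] by simp

context convex_body
begin

context
  fixes mem :: "real^'n \<Rightarrow> real \<Rightarrow> bool" and w :: "real^'n" and \<delta> d :: real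
  assumes mem: "membership_oracle C mem"
    and mem_meas: "\<And>\<epsilon>. \<epsilon> > 0 \<Longrightarrow> {x. mem x \<epsilon>} \<in> sets borel"
    and w: "norm w \<le> R" and \<delta>: "0 < \<delta>" "\<delta> < 1 / 3" and gau1: "1 \<le> gau r R mem w \<delta>"
    and d: "d = real CARD('n)"
begin

abbreviation estimator :: "'n draw \<Rightarrow> real^'n" where
  "estimator y \<equiv> snd (one_d_opt r R mem w \<delta> y)"

lemma estimator_eq: "estimator (I, U, Z) = (d * opt_slope r R mem w \<delta> I U Z) *\<^sub>R axis I 1"
  by (simp add: one_d_opt_eq_slope d)

lemma d_ge_one: "1 \<le> d" using d by (simp add: Suc_leI)

lemma estimator_measurable[measurable]: "estimator \<in> borel_measurable draw_measure"
proof -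
  have "(\<lambda>y. (w, y)) \<in> draw_measure \<rightarrow>\<^sub>M borel \<Otimes>\<^sub>M draw_measure" by measurable
  from measurable_compose[OF this measurable_one_d_opt[OF mem_meas r_pos r_le_R \<delta>]] show ?thesis by simp
qed

lemma AE_norm_estimator_le: "AE y in draw_measure. norm (estimator y) \<le> d * (1 / r + \<delta> / (20 * R))"
  using AE_draw
proof eventually_elim
  case (elim y)
  obtain I U Z where y: "y = (I, U, Z)" by (cases y)
  have "\<delta> / (20 * d * R) \<le> \<delta> / (20 * R)"
    using d_ge_one \<delta> R_pos by (intro divide_left_mono) auto
  then have "\<bar>opt_slope r R mem w \<delta> I U Z\<bar> \<le> 1 / r + \<delta> / (20 * R)"
    using opt_slope_bound[OF mem mem_meas w \<delta> gau1 _ d, of U Z I] elim y by simp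
  then have "d * \<bar>opt_slope r R mem w \<delta> I U Z\<bar> \<le> d * (1 / r + \<delta> / (20 * R))"
    using d_ge_one by (intro mult_left_mono) auto
  then show ?case using d_ge_one by (simp add: y estimator_eq abs_mult)
qed

lemma integrable_estimatorI:
  assumes "f \<in> borel_measurable draw_measure" "\<And>y. \<bar>f y\<bar> \<le> b (norm (estimator y))" "mono b"
  shows "integrable draw_measure (f :: 'n draw \<Rightarrow> real)"
proof -
  interpret prob_space "draw_measure :: 'n draw measure" by (rule prob_space_draw)
  show ?thesis
  proof (rule integrable_const_bound[where B = "b (d * (1 / r + \<delta> / (20 * R)))"])
    show "AE y in draw_measure. norm (f y) \<le> b (d * (1 / r + \<delta> / (20 * R)))"
      using AE_norm_estimator_le
    proof eventually_elim
      case (elim y)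
      then show ?case using assms(2)[of y] monoD[OF assms(3) elim] by simp
    qed
  qed (rule assms)
qed

text \<open>
  Only the coordinate \<open>I\<close> of the estimator is nonzero, with square \<open>d\<^sup>2\<close> times that of the slope; averaging
  over \<open>I\<close> removes one factor \<open>d\<close>.
\<close>

lemma estimator_second_moment:
  "integrable draw_measure (\<lambda>y. (norm (estimator y))\<^sup>2)"
  "(\<integral>y. (norm (estimator y))\<^sup>2 \<partial>draw_measure) \<le> d * (1 / r + \<delta> / (20 * R))\<^sup>2"
proof -
  show int: "integrable draw_measure (\<lambda>y. (norm (estimator y))\<^sup>2)"
  proof (rule integrable_estimatorI[where b = "\<lambda>a. (max 0 a)\<^sup>2"])
    show "mono (\<lambda>a::real. (max 0 a)\<^sup>2)" by (intro monoI power_mono) auto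
  qed auto
  show "(\<integral>y. (norm (estimator y))\<^sup>2 \<partial>draw_measure) \<le> d * (1 / r + \<delta> / (20 * R))\<^sup>2"
  proof (rule integral_draw_le[OF int])
    fix U :: "real^'n" assume U: "U \<in> cball_inf 0 1"
    have "(norm (estimator (I, U, Z)))\<^sup>2 = d * (d * (opt_slope r R mem w \<delta> I U Z)\<^sup>2)" for I Z
      by (simp add: estimator_eq power_mult_distrib power2_eq_square[of d])
    then have "(\<Sum>I\<in>UNIV. (norm (estimator (I, U, Z)))\<^sup>2) / real CARD('n) =
        d * (\<Sum>I\<in>UNIV. (opt_slope r R mem w \<delta> I U Z)\<^sup>2)" for Z
      using d_ge_one unfolding d[symmetric] by (simp add: sum_distrib_left[symmetric])
    then show "(\<integral>Z. (\<Sum>I\<in>UNIV. (norm (estimator (I, U, Z)))\<^sup>2) / real CARD('n) \<partial>cube_measure) \<le>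
        d * (1 / r + \<delta> / (20 * R))\<^sup>2"
      using opt_slope_square_average[OF mem mem_meas w \<delta> gau1 U d] d_ge_one by simp
  qed
qed

lemma estimator_bias:
  assumes x: "x \<in> C"
  shows "integrable draw_measure (\<lambda>y. estimator y \<bullet> (x - w))"
    and "(\<integral>y. estimator y \<bullet> (x - w) \<partial>draw_measure) \<le> 1 - gau r R mem w \<delta> + 2 * \<delta>"
proof -
  show int: "integrable draw_measure (\<lambda>y. estimator y \<bullet> (x - w))"
  proof (rule integrable_estimatorI[where b = "\<lambda>a. a * norm (x - w)"])
    show "mono (\<lambda>a. a * norm (x - w))" by (intro monoI mult_right_mono) auto
  qed (auto intro: Cauchy_Schwarz_ineq2)
  show "(\<integral>y. estimator y \<bullet> (x - w) \<partial>draw_measure) \<le> 1 - gau r R mem w \<delta> + 2 * \<delta>"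
  proof (rule integral_draw_le[OF int])
    fix U :: "real^'n" assume U: "U \<in> cball_inf 0 1"
    have "(\<Sum>I\<in>UNIV. estimator (I, U, Z) \<bullet> (x - w)) / real CARD('n) =
        (\<Sum>I\<in>UNIV. opt_slope r R mem w \<delta> I U Z * (x - w) $ I)" for Z
      using d_ge_one unfolding estimator_eq d[symmetric]
      by (simp add: inner_axis' sum_distrib_left[symmetric] mult.assoc)
    then show "(\<integral>Z. (\<Sum>I\<in>UNIV. estimator (I, U, Z) \<bullet> (x - w)) / real CARD('n) \<partial>cube_measure) \<le>
        1 - gau r R mem w \<delta> + 2 * \<delta>"
      using opt_slope_linear_average[OF mem mem_meas w \<delta> gau1 U d x] by simp
  qed
qed

end

end

section \<open>Regret of FTRL-proximal\<close>

lemma ftrl_proximal_cong: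
  assumes "\<And>s. 1 \<le> s \<Longrightarrow> s < t \<Longrightarrow> v s = v' s"
  shows "ftrl_proximal D v t = ftrl_proximal D v' t"
  using assms
proof (induction t rule: less_induct)
  case (less t)
  show ?case
  proof (cases t)
    case (Suc t')
    have v: "v s = v' s" if "s \<in> {1..t'}" for s using that less.prems Suc by auto
    have eta: "ftrl_eta D v s = ftrl_eta D v' s" if "s \<le> t'" for s
    proof -
      have "(\<Sum>i=1..s. (norm (v i))\<^sup>2) = (\<Sum>i=1..s. (norm (v' i))\<^sup>2)"
        by (rule sum.cong) (use that v in auto)
      then show ?thesis by (simp add: ftrl_eta_def)
    qed
    have \<sigma>: "ftrl_sigma D v s = ftrl_sigma D v' s" if "s \<in> {1..t'}" for s
    proof -
      have "s \<le> t'" "s - 1 \<le> t'" using that by auto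
      then show ?thesis unfolding ftrl_sigma_def by (simp only: eta)
    qed
    have w: "ftrl_proximal D v s = ftrl_proximal D v' s" if "s \<in> {1..t'}" for s
      using that Suc less.prems by (intro less.IH) auto
    have sums: "(\<Sum>s=1..t'. v s) = (\<Sum>s=1..t'. v' s)"
      "(\<Sum>s=1..t'. ftrl_sigma D v s) = (\<Sum>s=1..t'. ftrl_sigma D v' s)"
      "(\<Sum>s=1..t'. ftrl_sigma D v s *\<^sub>R ftrl_proximal D v s) =
       (\<Sum>s=1..t'. ftrl_sigma D v' s *\<^sub>R ftrl_proximal D v' s)"
      by (intro sum.cong refl; simp only: v \<sigma> w)+
    show ?thesis unfolding Suc ftrl_proximal.simps Let_def sums ..
  qed simp
qed

lemma norm_ftrl_proximal_le: assumes "0 \<le> D" shows "norm (ftrl_proximal D v t) \<le> D"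
proof (cases t)
  case (Suc t')
  have "closest_point (cball 0 D) y \<in> cball 0 D" for y :: 'a
    using assms by (intro closest_point_in_set) auto
  then show ?thesis using assms unfolding Suc ftrl_proximal.simps Let_def
    by (auto simp: dist_norm)
qed (use assms in simp)

lemma inverse_ftrl_eta:
  "1 / ftrl_eta D v t = sqrt (\<Sum>s=1..t. (norm (v s))\<^sup>2) / (sqrt 2 * D)"
  by (simp add: ftrl_eta_def)

lemma ftrl_sigma_nonneg: assumes "0 < D" shows "0 \<le> ftrl_sigma D v t"
proof -
  have "(\<Sum>s=1..t - 1. (norm (v s))\<^sup>2) \<le> (\<Sum>s=1..t. (norm (v s))\<^sup>2)"
    by (intro sum_mono2) auto
  then show ?thesis
    unfolding ftrl_sigma_def inverse_ftrl_eta using assms by (simp add: divide_right_mono)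
qed

lemma sum_ftrl_sigma: "(\<Sum>s=1..t. ftrl_sigma D v s) = 1 / ftrl_eta D v t"
proof (induction t)
  case (Suc t)
  then show ?case by (simp add: ftrl_sigma_def)
qed (simp add: ftrl_eta_def)

text \<open>
  The projection of \<open>b / S\<close> minimizes the quadratic \<open>y \<mapsto> S/2 \<parallel>y\<parallel>\<^sup>2 - b \<bullet> y\<close> over the ball, and
  strong convexity provides the additional square.
\<close>

lemma ball_projection_quadratic:
  fixes b x :: "'a::euclidean_space"
  assumes "0 < S" and x: "norm x \<le> D"
  defines "p \<equiv> closest_point (cball 0 D) (b /\<^sub>R S)"
  shows "S / 2 * (norm p)\<^sup>2 - b \<bullet> p + S / 2 * (norm (x - p))\<^sup>2 \<le> S / 2 * (norm x)\<^sup>2 - b \<bullet> x"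
proof -
  have "((b /\<^sub>R S) - p) \<bullet> (x - p) \<le> 0"
    unfolding p_def using x by (intro closest_point_dot) auto
  then have "S * (((b /\<^sub>R S) - p) \<bullet> (x - p)) \<le> 0"
    using \<open>0 < S\<close> by (simp add: mult_nonneg_nonpos)
  then have "(b - S *\<^sub>R p) \<bullet> (x - p) \<le> 0"
  proof -
    have "b - S *\<^sub>R p = S *\<^sub>R ((b /\<^sub>R S) - p)"
      using \<open>0 < S\<close> by (simp add: scaleR_diff_right)
    then show ?thesis using \<open>S * (((b /\<^sub>R S) - p) \<bullet> (x - p)) \<le> 0\<close> by simp
  qed
  then show ?thesis
    unfolding power2_norm_eq_inner
    by (simp add: inner_diff_left inner_diff_right inner_commute[of x p] algebra_simps)
qed

text \<open>
  Telescoping, since \<open>a / \<surd>(A + a) \<le> 2 \<surd>(A + a) - 2 \<surd>A\<close>. Terms with a vanishing denominator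
  have a vanishing numerator.
\<close>

lemma sum_div_sqrt_le:
  fixes a :: "nat \<Rightarrow> real"
  assumes "\<And>t. 0 \<le> a t"
  shows "(\<Sum>t=1..T. a t / sqrt (\<Sum>s=1..t. a s)) \<le> 2 * sqrt (\<Sum>s=1..T. a s)"
proof (induction T)
  case (Suc T)
  define A where "A = (\<Sum>s=1..T. a s)"
  have A: "0 \<le> A" using assms by (simp add: A_def sum_nonneg)
  have "a (Suc T) / sqrt (A + a (Suc T)) \<le> 2 * sqrt (A + a (Suc T)) - 2 * sqrt A"
  proof (cases "A + a (Suc T) = 0")
    case False
    then have pos: "0 < sqrt (A + a (Suc T))" using A assms[of "Suc T"] by simp
    let ?q = "sqrt (A + a (Suc T))"
    have "a (Suc T) = ?q\<^sup>2 - (sqrt A)\<^sup>2" using A assms[of "Suc T"] by simp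
    moreover have "0 \<le> (?q - sqrt A)\<^sup>2" by simp
    ultimately have "a (Suc T) \<le> (2 * ?q - 2 * sqrt A) * ?q"
      by (simp add: power2_eq_square algebra_simps)
    then show ?thesis using pos by (simp add: divide_le_eq)
  next
    case True
    then show ?thesis using A assms[of "Suc T"] by (simp add: add_nonneg_eq_0_iff)
  qed
  then show ?case using Suc by (simp add: A_def)
qed simp

text \<open>
  The potential \<open>\<Phi> t\<close> is the sum of the linear losses and the proximal terms, and the output is its
  minimizer. As the proximal term of round \<open>t\<close> vanishes at \<open>w t\<close>, each round increases the minimum of the
  potential by at least \<open>v t \<bullet> w t - \<parallel>v t\<parallel>\<^sup>2 / (2 S t)\<close>, where \<open>S t\<close> is the
  modulus of strong convexity. Comparing with \<open>\<Phi> T x\<close> yields two terms,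
  \<open>2 D\<^sup>2 S T\<close> and the sum of the errors, and the step sizes make both at most \<open>\<surd>2 D\<close> times the root.
\<close>

lemma ftrl_proximal_regret:
  fixes v :: "nat \<Rightarrow> 'a::euclidean_space"
  assumes D: "0 < D" and x: "norm x \<le> D"
  defines "w \<equiv> ftrl_proximal D v"
  shows "(\<Sum>t=1..T. v t \<bullet> (w t - x)) \<le> 2 * sqrt 2 * D * sqrt (\<Sum>t=1..T. (norm (v t))\<^sup>2)"
proof -
  define \<sigma> where "\<sigma> = ftrl_sigma D v"
  define S where "S t = (\<Sum>s=1..t. \<sigma> s)" for t
  define V where "V t = (\<Sum>s=1..t. (norm (v s))\<^sup>2)" for t
  define \<Phi> where "\<Phi> t y = (\<Sum>s=1..t. v s \<bullet> y + \<sigma> s / 2 * (norm (y - w s))\<^sup>2)" for t y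
  have S_eq: "S t = sqrt (V t) / (sqrt 2 * D)" for t
    unfolding S_def V_def \<sigma>_def sum_ftrl_sigma inverse_ftrl_eta ..
  have \<sigma>: "0 \<le> \<sigma> t" for t unfolding \<sigma>_def by (rule ftrl_sigma_nonneg[OF D])
  have S: "0 \<le> S t" for t unfolding S_def by (intro sum_nonneg \<sigma>)
  have w_le: "norm (w t) \<le> D" for t unfolding w_def by (rule norm_ftrl_proximal_le) (use D in simp)
  have \<Phi>_eq: "\<Phi> t y = S t / 2 * (norm y)\<^sup>2 - (- (\<Sum>s=1..t. v s) + (\<Sum>s=1..t. \<sigma> s *\<^sub>R w s)) \<bullet> y +
      (\<Sum>s=1..t. \<sigma> s / 2 * (norm (w s))\<^sup>2)" for t y
  proof -
    have summand: "v s \<bullet> y + \<sigma> s / 2 * (norm (y - w s))\<^sup>2 =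
        \<sigma> s / 2 * (norm y)\<^sup>2 - (- v s + \<sigma> s *\<^sub>R w s) \<bullet> y + \<sigma> s / 2 * (norm (w s))\<^sup>2" for s
    proof -
      have nrm: "(norm (y - w s))\<^sup>2 = (norm y)\<^sup>2 - 2 * (w s \<bullet> y) + (norm (w s))\<^sup>2"
        by (simp add: power2_norm_eq_inner inner_diff_left inner_diff_right inner_commute[of y "w s"])
      show ?thesis unfolding nrm by (simp add: inner_diff_left field_simps)
    qed
    have "(\<Sum>s=1..t. - v s + \<sigma> s *\<^sub>R w s) = - (\<Sum>s=1..t. v s) + (\<Sum>s=1..t. \<sigma> s *\<^sub>R w s)"
      by (simp only: sum.distrib sum_negf)
    moreover have "\<Phi> t y = (\<Sum>s=1..t. \<sigma> s) / 2 * (norm y)\<^sup>2 - (\<Sum>s=1..t. - v s + \<sigma> s *\<^sub>R w s) \<bullet> y +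
        (\<Sum>s=1..t. \<sigma> s / 2 * (norm (w s))\<^sup>2)"
      unfolding \<Phi>_def summand
      by (simp only: inner_sum_left)
        (simp only: sum.distrib sum_subtractf sum_divide_distrib sum_distrib_right)
    ultimately show ?thesis by (simp only: S_def)
  qed
  \<comment> \<open>if \<open>S t = 0\<close>, all inputs so far vanish and so does the potential\<close>
  have strong: "\<Phi> t (w (Suc t)) + S t / 2 * (norm (y - w (Suc t)))\<^sup>2 \<le> \<Phi> t y" if y: "norm y \<le> D" for t y
  proof (cases "S t = 0")
    case True
    then have "V t = 0" using D by (simp add: S_eq)
    then have "v s = 0" if "s \<in> {1..t}" for s
      using that by (simp add: V_def sum_nonneg_eq_0_iff)
    moreover have "\<sigma> s = 0" if "s \<in> {1..t}" for s
      using that True \<sigma> by (simp add: S_def sum_nonneg_eq_0_iff)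
    ultimately show ?thesis using True by (simp add: \<Phi>_def)
  next
    case False
    then have pos: "0 < S t" using S[of t] by simp
    have wS: "w (Suc t) = closest_point (cball 0 D) ((- (\<Sum>s=1..t. v s) + (\<Sum>s=1..t. \<sigma> s *\<^sub>R w s)) /\<^sub>R S t)"
      using False unfolding w_def ftrl_proximal.simps Let_def S_def \<sigma>_def by simp
    show ?thesis
      using ball_projection_quadratic[OF pos y, of "- (\<Sum>s=1..t. v s) + (\<Sum>s=1..t. \<sigma> s *\<^sub>R w s)"]
      unfolding \<Phi>_eq wS[symmetric] by linarith
  qed
  have step: "(\<Sum>s=1..t. v s \<bullet> w s) \<le> \<Phi> t (w (Suc t)) + (\<Sum>s=1..t. (norm (v s))\<^sup>2 / (2 * S s))" for t
  proof (induction t)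
    case (Suc t)
    let ?p = "w (Suc (Suc t))" and ?q = "w (Suc t)"
    have "\<Phi> (Suc t) ?p = \<Phi> t ?p + v (Suc t) \<bullet> ?p + \<sigma> (Suc t) / 2 * (norm (?p - ?q))\<^sup>2"
      by (simp add: \<Phi>_def)
    moreover have "\<Phi> t ?q + S t / 2 * (norm (?p - ?q))\<^sup>2 \<le> \<Phi> t ?p"
      by (rule strong[OF w_le])
    moreover have "S t / 2 * (norm (?p - ?q))\<^sup>2 + \<sigma> (Suc t) / 2 * (norm (?p - ?q))\<^sup>2 =
        S (Suc t) / 2 * (norm (?p - ?q))\<^sup>2"
      by (simp add: S_def algebra_simps add_divide_distrib)
    moreover have "- (v (Suc t) \<bullet> (?p - ?q)) \<le>
        S (Suc t) / 2 * (norm (?p - ?q))\<^sup>2 + (norm (v (Suc t)))\<^sup>2 / (2 * S (Suc t))"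
    proof (cases "S (Suc t) = 0")
      case True
      then have "V (Suc t) = 0" using D by (simp add: S_eq)
      then have "v (Suc t) = 0" by (simp add: V_def sum_nonneg_eq_0_iff add_nonneg_eq_0_iff sum_nonneg)
      then show ?thesis using True by simp
    next
      case False
      then have pos: "0 < S (Suc t)" using S[of "Suc t"] by simp
      define a b c where "a = norm (v (Suc t))" and "b = norm (?p - ?q)" and "c = S (Suc t)"
      have "- (v (Suc t) \<bullet> (?p - ?q)) \<le> a * b"
        using Cauchy_Schwarz_ineq2[of "v (Suc t)" "?p - ?q"] by (simp add: a_def b_def)
      also have "\<dots> \<le> c / 2 * b\<^sup>2 + a\<^sup>2 / (2 * c)"
      proof -
        have "0 \<le> (c * b - a)\<^sup>2 / (2 * c)" using pos by (simp add: c_def)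
        also have "\<dots> = c / 2 * b\<^sup>2 + a\<^sup>2 / (2 * c) - a * b"
          using pos by (simp add: c_def power2_eq_square field_simps)
        finally show ?thesis by simp
      qed
      finally show ?thesis by (simp add: a_def b_def c_def)
    qed
    moreover have "v (Suc t) \<bullet> (?p - ?q) = v (Suc t) \<bullet> ?p - v (Suc t) \<bullet> ?q"
      by (simp add: inner_diff_right)
    ultimately show ?case using Suc by simp
  qed (simp add: \<Phi>_def)
  have "(\<Sum>t=1..T. v t \<bullet> (w t - x)) = (\<Sum>t=1..T. v t \<bullet> w t) - (\<Sum>t=1..T. v t \<bullet> x)"
    by (simp add: inner_diff_right sum_subtractf)
  also have "\<dots> \<le> \<Phi> T x + (\<Sum>s=1..T. (norm (v s))\<^sup>2 / (2 * S s)) - (\<Sum>t=1..T. v t \<bullet> x)"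
  proof -
    have "0 \<le> S T / 2 * (norm (x - w (Suc T)))\<^sup>2" using S by simp
    then show ?thesis using step[of T] strong[OF x, of T] by linarith
  qed
  also have "\<dots> = (\<Sum>s=1..T. \<sigma> s / 2 * (norm (x - w s))\<^sup>2) + (\<Sum>s=1..T. (norm (v s))\<^sup>2 / (2 * S s))"
    by (simp add: \<Phi>_def sum.distrib)
  also have "\<dots> \<le> S T / 2 * (2 * D)\<^sup>2 + sqrt 2 * D * sqrt (V T)"
  proof (rule add_mono)
    have "(norm (x - w s))\<^sup>2 \<le> (2 * D)\<^sup>2" for s
      using norm_triangle_ineq4[of x "w s"] x w_le[of s] by (intro power_mono) auto
    then have "(\<Sum>s=1..T. \<sigma> s / 2 * (norm (x - w s))\<^sup>2) \<le> (\<Sum>s=1..T. \<sigma> s / 2 * (2 * D)\<^sup>2)"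
      using \<sigma> by (intro sum_mono mult_left_mono) auto
    then show "(\<Sum>s=1..T. \<sigma> s / 2 * (norm (x - w s))\<^sup>2) \<le> S T / 2 * (2 * D)\<^sup>2"
      by (simp add: S_def sum_distrib_right sum_divide_distrib)
    have "(\<Sum>s=1..T. (norm (v s))\<^sup>2 / (2 * S s)) = (sqrt 2 * D) / 2 * (\<Sum>s=1..T. (norm (v s))\<^sup>2 / sqrt (V s))"
      using D by (simp add: S_eq sum_distrib_left field_simps)
    also have "\<dots> \<le> (sqrt 2 * D) / 2 * (2 * sqrt (V T))"
      unfolding V_def using D by (intro mult_left_mono sum_div_sqrt_le) auto
    finally show "(\<Sum>s=1..T. (norm (v s))\<^sup>2 / (2 * S s)) \<le> sqrt 2 * D * sqrt (V T)" by simp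
  qed
  also have "S T / 2 * (2 * D)\<^sup>2 = sqrt 2 * D * sqrt (V T)"
  proof -
    have "S T / 2 * (2 * D)\<^sup>2 = D * sqrt (V T) * (2 / sqrt 2)"
      unfolding S_eq using D by (simp add: power2_eq_square)
    also have "2 / sqrt 2 = sqrt 2" by (simp add: real_div_sqrt)
    finally show ?thesis by simp
  qed
  finally show ?thesis unfolding V_def by linarith
qed

section \<open>Exponential moments and concentration\<close>

text \<open>
  The function \<open>k y = exp (-y) (1 + y + y\<^sup>2)\<close> has derivative \<open>exp (-y) y (1 - y)\<close>. It is therefore at
  least \<open>k 0 = 1\<close> up to \<open>y = 1\<close> and decreases afterwards, so that only its value at \<open>3/2\<close> has to be
  checked. The usual range \<open>x \<le> 1\<close> would be too small for the optimal scale in \<open>tuning_constants\<close>.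
\<close>

lemma exp_le_quadratic:
  fixes x :: real
  assumes "x \<le> 3 / 2"
  shows "exp x \<le> 1 + x + x\<^sup>2"
proof -
  define k where "k y = exp (- y) * (1 + y + y\<^sup>2)" for y :: real
  have dk: "(k has_real_derivative exp (- y) * (y * (1 - y))) (at y)" for y
    unfolding k_def by (auto intro!: derivative_eq_intros simp: algebra_simps power2_eq_square)
  have k0: "k 0 = 1" by (simp add: k_def)
  have "1 \<le> k x"
  proof -
    consider "x \<le> 0" | "0 \<le> x" "x \<le> 1" | "1 \<le> x" by linarith
    then show ?thesis
    proof cases
      case 1
      have "k 0 \<le> k x"
        by (rule DERIV_nonpos_imp_nonincreasing[OF 1]) (use dk in \<open>auto intro!: exI simp: mult_nonneg_nonpos mult_nonpos_nonneg\<close>)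
      then show ?thesis by (simp add: k0)
    next
      case 2
      have "k 0 \<le> k x"
        by (rule DERIV_nonneg_imp_nondecreasing[OF 2(1)]) (use dk 2 in \<open>auto intro!: exI\<close>)
      then show ?thesis by (simp add: k0)
    next
      case 3
      have "k (3 / 2) \<le> k x"
      proof (rule DERIV_nonpos_imp_nonincreasing[OF assms])
        fix y assume "x \<le> y"
        then have "exp (- y) * (y * (1 - y)) \<le> 0"
          using 3 by (intro mult_nonneg_nonpos) auto
        then show "\<exists>z. (k has_real_derivative z) (at y) \<and> z \<le> 0" using dk by blast
      qed
      moreover have "exp (3 / 2 :: real) \<le> 19 / 4"
      proof (rule power2_le_imp_le)
        have "(exp (3 / 2 :: real))\<^sup>2 = exp 1 ^ 3"
          by (simp add: exp_of_nat_mult[symmetric] exp_double[symmetric])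
        also have "\<dots> \<le> (272 / 100) ^ 3" using e_less_272 by (intro power_mono) auto
        also have "\<dots> \<le> (19 / 4)\<^sup>2" by (simp add: power2_eq_square power3_eq_cube)
        finally show "(exp (3 / 2 :: real))\<^sup>2 \<le> (19 / 4)\<^sup>2" .
      qed simp
      then have "1 \<le> k (3 / 2)" by (simp add: k_def exp_minus field_simps power2_eq_square)
      ultimately show ?thesis by simp
    qed
  qed
  then have "exp x * 1 \<le> exp x * k x" by (intro mult_left_mono) auto
  also have "exp x * k x = 1 + x + x\<^sup>2" by (simp add: k_def exp_minus)
  finally show ?thesis by simp
qed

text \<open>
  The random variable in the exponent is the sum of a multiple of \<open>Y = \<parallel>g + S\<parallel>\<^sup>2\<close> and of \<open>A = S \<bullet> v\<close>.
  Both have second moments far below the squares of their maxima, because \<open>\<parallel>S\<parallel>\<^sup>2\<close> has expectation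
  at most \<open>B\<^sup>2 d K\<^sup>2\<close> but may reach \<open>B\<^sup>2 d\<^sup>2 K\<^sup>2\<close>: the expectation of \<open>Y\<close> is at most \<open>m\<close>, that of \<open>Y\<^sup>2\<close> at most
  \<open>d m\<^sup>2\<close>, and that of \<open>A\<^sup>2\<close> at most \<open>R\<^sup>2 m\<close>. The claim follows by taking expectations in
  \<open>exp_le_quadratic\<close>.
\<close>

lemma exponential_moment_bound:
  fixes S :: "'a \<Rightarrow> 'b::euclidean_space" and R B K d c \<beta> e :: real
  assumes "prob_space M" and [measurable]: "S \<in> borel_measurable M"
    and S_bd: "AE y in M. norm (S y) \<le> B * d * K"
    and S_sq: "(\<integral>y. (norm (S y))\<^sup>2 \<partial>M) \<le> B\<^sup>2 * d * K\<^sup>2"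
    and S_v: "(\<integral>y. S y \<bullet> v \<partial>M) \<le> e"
    and v: "norm v \<le> 2 * R" and g: "norm g \<le> B"
    and pos: "0 < B" "1 \<le> d" "1 \<le> K" "0 < R" "0 < c" "0 \<le> \<beta>"
    and m: "m = 4 * B\<^sup>2 * d * K\<^sup>2"
    and small: "\<beta> * (sqrt 2 * R * (d * m) / c + 2 * B * R * d * K) \<le> 3 / 2"
  shows "(\<integral>\<^sup>+y. ennreal (exp (\<beta> * (sqrt 2 * R * (norm (g + S y))\<^sup>2 / c + S y \<bullet> v))) \<partial>M) \<le>
    ennreal (exp (\<beta> * (sqrt 2 * R * m / c + e) + \<beta>\<^sup>2 * (R\<^sup>2 * m * (4 * d * m / c\<^sup>2 + 2))))"
proof -
  let ?X = "\<beta> * (sqrt 2 * R * m / c + e) + \<beta>\<^sup>2 * (R\<^sup>2 * m * (4 * d * m / c\<^sup>2 + 2))"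
  interpret prob_space M by fact
  define Y where "Y y = (norm (g + S y))\<^sup>2" for y
  define A where "A y = S y \<bullet> v" for y
  define P where "P y = sqrt 2 * R * Y y / c + A y" for y
  \<comment> \<open>a majorant of \<open>exp (\<beta> P)\<close> that is linear in \<open>Y\<close>, \<open>A\<close> and \<open>\<parallel>S\<parallel>\<^sup>2\<close>\<close>
  define H where "H y = 1 + \<beta> * P y + \<beta>\<^sup>2 * (4 * R\<^sup>2 * d * m / c\<^sup>2 * Y y + 8 * R\<^sup>2 * (norm (S y))\<^sup>2)" for y
  have [measurable]: "Y \<in> borel_measurable M" "A \<in> borel_measurable M" "P \<in> borel_measurable M"
    unfolding P_def Y_def A_def by measurable
  have Y_le: "Y y \<le> 2 * B\<^sup>2 + 2 * (norm (S y))\<^sup>2" for y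
  proof -
    have "Y y \<le> (norm g + norm (S y))\<^sup>2"
      unfolding Y_def by (intro power_mono norm_triangle_ineq) auto
    also have "\<dots> \<le> 2 * (norm g)\<^sup>2 + 2 * (norm (S y))\<^sup>2"
      using zero_le_power2[of "norm g - norm (S y)"] by (simp add: power2_eq_square algebra_simps)
    also have "(norm g)\<^sup>2 \<le> B\<^sup>2" using g by (intro power_mono) auto
    finally show ?thesis by simp
  qed
  have Y_nn: "0 \<le> Y y" for y by (simp add: Y_def)
  have A_le: "\<bar>A y\<bar> \<le> 2 * R * norm (S y)" for y
  proof -
    have "\<bar>A y\<bar> \<le> norm (S y) * norm v" unfolding A_def by (rule Cauchy_Schwarz_ineq2)
    also have "\<dots> \<le> norm (S y) * (2 * R)" using v by (intro mult_left_mono) auto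
    finally show ?thesis by (simp add: mult.commute)
  qed
  have dK: "1 \<le> d * K" "1 \<le> d * K\<^sup>2" "d \<le> d * d"
    using pos mult_mono[of 1 d 1 K] mult_mono[of 1 d 1 "K\<^sup>2"] mult_left_mono[of 1 d d] by (auto simp: one_le_power)
  have dm: "d * m = 4 * (B * d * K)\<^sup>2" by (simp add: m power2_eq_square)
  have BdK: "B\<^sup>2 \<le> (B * d * K)\<^sup>2"
    using pos dK(1) mult_left_mono[of 1 "d * K" B] by (intro power_mono) (auto simp: mult.assoc)
  have Bm: "2 * B\<^sup>2 + 2 * (B\<^sup>2 * d * K\<^sup>2) \<le> m"
    using dK(2) mult_left_mono[of 1 "d * K\<^sup>2" "B\<^sup>2"] by (simp add: m algebra_simps)
  have m_pos: "0 < m" using pos by (simp add: m)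
  have Y_bd: "AE y in M. Y y \<le> d * m"
    using S_bd
  proof eventually_elim
    case (elim y)
    have "(norm (S y))\<^sup>2 \<le> (B * d * K)\<^sup>2" using elim by (intro power_mono) auto
    then show ?case using Y_le[of y] BdK dm by linarith
  qed
  have A_bd: "AE y in M. \<bar>A y\<bar> \<le> 2 * B * R * d * K"
    using S_bd
  proof eventually_elim
    case (elim y)
    then have "2 * R * norm (S y) \<le> 2 * R * (B * d * K)" using pos by (intro mult_left_mono) auto
    then show ?case using A_le[of y] by (simp add: mult_ac)
  qed
  have int_Y: "integrable M Y"
    using Y_bd Y_nn by (intro integrable_const_bound[where B = "d * m"]) auto
  have int_A: "integrable M A"
    using A_bd by (intro integrable_const_bound[where B = "2 * B * R * d * K"]) auto
  have int_S: "integrable M (\<lambda>y. (norm (S y))\<^sup>2)"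
  proof (rule integrable_const_bound[where B = "(B * d * K)\<^sup>2"])
    show "AE y in M. norm ((norm (S y))\<^sup>2) \<le> (B * d * K)\<^sup>2"
      using S_bd by eventually_elim (auto intro!: power_mono)
  qed simp
  have int_H: "integrable M H"
    unfolding H_def P_def using int_Y int_A int_S by simp
  have EY: "(\<integral>y. Y y \<partial>M) \<le> m"
  proof -
    have "(\<integral>y. Y y \<partial>M) \<le> (\<integral>y. 2 * B\<^sup>2 + 2 * (norm (S y))\<^sup>2 \<partial>M)"
      using int_Y int_S by (intro integral_mono Y_le) auto
    also have "\<dots> = 2 * B\<^sup>2 + 2 * (\<integral>y. (norm (S y))\<^sup>2 \<partial>M)"
      using int_S by (simp add: prob_space)
    also have "\<dots> \<le> m" using S_sq Bm by simp
    finally show ?thesis .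
  qed
  have pointwise: "AE y in M. exp (\<beta> * P y) \<le> H y"
    using Y_bd A_bd
  proof eventually_elim
    case (elim y)
    have "sqrt 2 * R * Y y / c \<le> sqrt 2 * R * (d * m) / c"
      using elim pos by (intro divide_right_mono mult_left_mono) auto
    then have "\<beta> * P y \<le> \<beta> * (sqrt 2 * R * (d * m) / c + 2 * B * R * d * K)"
      unfolding P_def using elim pos by (intro mult_left_mono) auto
    then have "exp (\<beta> * P y) \<le> 1 + \<beta> * P y + (\<beta> * P y)\<^sup>2"
      using small by (intro exp_le_quadratic) linarith
    moreover have "(P y)\<^sup>2 \<le> 4 * R\<^sup>2 * d * m / c\<^sup>2 * Y y + 8 * R\<^sup>2 * (norm (S y))\<^sup>2"
    proof -
      define q where "q = sqrt 2 * R * Y y / c"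
      have P: "P y = q + A y" by (simp add: P_def q_def)
      have "(P y)\<^sup>2 \<le> 2 * q\<^sup>2 + 2 * (A y)\<^sup>2"
        unfolding P using zero_le_power2[of "q - A y"] by (simp add: power2_eq_square algebra_simps)
      also have "q\<^sup>2 = 2 * R\<^sup>2 / c\<^sup>2 * (Y y * Y y)"
        by (simp add: q_def power_mult_distrib power_divide power2_eq_square[of "Y y"])
      also have "2 * R\<^sup>2 / c\<^sup>2 * (Y y * Y y) \<le> 2 * R\<^sup>2 / c\<^sup>2 * (d * m * Y y)"
        using elim Y_nn by (intro mult_left_mono mult_right_mono) auto
      also have "(A y)\<^sup>2 \<le> (2 * R * norm (S y))\<^sup>2"
        using A_le[of y] by (simp add: abs_le_square_iff[symmetric])
      finally show ?thesis by (simp add: power_mult_distrib mult_ac)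
    qed
    then have "\<beta>\<^sup>2 * (P y)\<^sup>2 \<le> \<beta>\<^sup>2 * (4 * R\<^sup>2 * d * m / c\<^sup>2 * Y y + 8 * R\<^sup>2 * (norm (S y))\<^sup>2)"
      by (intro mult_left_mono) auto
    ultimately show ?case unfolding H_def power_mult_distrib by linarith
  qed
  have "(\<integral>y. H y \<partial>M) = 1 + \<beta> * (sqrt 2 * R / c * (\<integral>y. Y y \<partial>M) + (\<integral>y. A y \<partial>M)) +
      \<beta>\<^sup>2 * (4 * R\<^sup>2 * d * m / c\<^sup>2 * (\<integral>y. Y y \<partial>M) + 8 * R\<^sup>2 * (\<integral>y. (norm (S y))\<^sup>2 \<partial>M))"
    unfolding H_def P_def using int_Y int_A int_S by (simp add: prob_space)
  also have "\<dots> \<le> 1 + \<beta> * (sqrt 2 * R / c * m + e) +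
      \<beta>\<^sup>2 * (4 * R\<^sup>2 * d * m / c\<^sup>2 * m + 8 * R\<^sup>2 * (B\<^sup>2 * d * K\<^sup>2))"
    using pos m_pos EY S_sq S_v
    by (intro add_mono mult_left_mono order_refl) (auto simp: A_def)
  also have "\<dots> = 1 + ?X"
    by (simp add: m algebra_simps)
  also have "\<dots> \<le> exp ?X"
    by (rule exp_ge_add_one_self)
  finally have EH: "(\<integral>y. H y \<partial>M) \<le> exp ?X" .
  have "(\<integral>\<^sup>+y. ennreal (exp (\<beta> * P y)) \<partial>M) \<le> (\<integral>\<^sup>+y. ennreal (H y) \<partial>M)"
    using pointwise by (intro nn_integral_mono_AE) (auto elim!: eventually_mono intro: ennreal_leI)
  also have "\<dots> = ennreal (\<integral>y. H y \<partial>M)"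
  proof (rule nn_integral_eq_integral[OF int_H])
    show "AE y in M. 0 \<le> H y"
      using pointwise by eventually_elim (meson exp_ge_zero order_trans)
  qed
  also have "\<dots> \<le> ennreal (exp ?X)"
    using EH by (rule ennreal_leI)
  finally show ?thesis unfolding P_def Y_def A_def .
qed

lemma nn_integral_PiM_resample:
  fixes M :: "'i \<Rightarrow> 'a measure"
  assumes M: "\<And>i. prob_space (M i)" and [measurable]: "f \<in> borel_measurable (PiM UNIV M)"
  shows "(\<integral>\<^sup>+X. f X \<partial>PiM UNIV M) = (\<integral>\<^sup>+X. \<integral>\<^sup>+y. f (X(j := y)) \<partial>M j \<partial>PiM UNIV M)"
proof -
  interpret Mj: sigma_finite_measure "M j" using M by (rule prob_space_imp_sigma_finite)
  have [measurable]: "(\<lambda>(X, y). X(j := y)) \<in> PiM UNIV M \<Otimes>\<^sub>M M j \<rightarrow>\<^sub>M PiM UNIV M"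
    by (rule measurable_PiM_update)
  have "(\<integral>\<^sup>+X. f X \<partial>PiM UNIV M) =
      (\<integral>\<^sup>+X. f X \<partial>distr (PiM UNIV M \<Otimes>\<^sub>M M j) (PiM UNIV M) (\<lambda>(X, y). X(j := y)))"
    unfolding distr_PiM_resample[of M j, OF M] ..
  also have "\<dots> = (\<integral>\<^sup>+p. f (case p of (X, y) \<Rightarrow> X(j := y)) \<partial>(PiM UNIV M \<Otimes>\<^sub>M M j))"
    by (rule nn_integral_distr) measurable
  also have "\<dots> = (\<integral>\<^sup>+X. \<integral>\<^sup>+y. f (X(j := y)) \<partial>M j \<partial>PiM UNIV M)"
  proof -
    have "(\<lambda>p. f (case p of (X, y) \<Rightarrow> X(j := y))) \<in> borel_measurable (PiM UNIV M \<Otimes>\<^sub>M M j)"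
      by measurable
    from Mj.nn_integral_fst[OF this] show ?thesis by simp
  qed
  finally show ?thesis .
qed

text \<open>
  Resampling the draw of the last round leaves the earlier summands unchanged, so that the moment
  bound given the past applies to the last factor of the exponential.
\<close>

lemma exponential_supermartingale:
  fixes W :: "nat \<Rightarrow> 's \<times> (nat \<Rightarrow> 'a) \<Rightarrow> real"
  assumes N: "prob_space N" and D: "prob_space D"
    and W[measurable]: "\<And>t. 1 \<le> t \<Longrightarrow> W t \<in> borel_measurable (N \<Otimes>\<^sub>M PiM UNIV (\<lambda>_. D))"
    and adapted: "\<And>t \<theta> \<xi> \<xi>'. (\<And>s. s \<le> t \<Longrightarrow> \<xi> s = \<xi>' s) \<Longrightarrow> W t (\<theta>, \<xi>) = W t (\<theta>, \<xi>')"
    and moment: "\<And>t \<theta> \<xi>. \<theta> \<in> space N \<Longrightarrow> 1 \<le> t \<Longrightarrow> (\<integral>\<^sup>+y. ennreal (exp (W t (\<theta>, \<xi>(t := y)))) \<partial>D) \<le> 1"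
  shows "(\<integral>\<^sup>+\<omega>. ennreal (exp (\<Sum>t=1..T. W t \<omega>)) \<partial>(N \<Otimes>\<^sub>M PiM UNIV (\<lambda>_. D))) \<le> 1"
proof (induction T)
  case 0
  interpret prob_space "N \<Otimes>\<^sub>M PiM UNIV (\<lambda>_::nat. D)"
    by (intro prob_space_pairI N prob_space_PiM D)
  show ?case by (simp add: emeasure_space_1)
next
  case (Suc T)
  let ?P = "PiM UNIV (\<lambda>_::nat. D)"
  interpret P: prob_space ?P by (intro prob_space_PiM D)
  have sum_meas[measurable]: "(\<lambda>\<omega>. \<Sum>t=1..n. W t \<omega>) \<in> borel_measurable (N \<Otimes>\<^sub>M ?P)" for n
    by (intro borel_measurable_sum W) simp
  have sec: "(\<lambda>\<xi>. ennreal (exp (\<Sum>t=1..n. W t (\<theta>, \<xi>)))) \<in> borel_measurable ?P" if "\<theta> \<in> space N" for \<theta> n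
    using measurable_compose[OF measurable_Pair1'[OF that] sum_meas[of n]] by measurable
  have "(\<integral>\<^sup>+\<omega>. ennreal (exp (\<Sum>t=1..Suc T. W t \<omega>)) \<partial>(N \<Otimes>\<^sub>M ?P)) =
      (\<integral>\<^sup>+\<theta>. \<integral>\<^sup>+\<xi>. ennreal (exp (\<Sum>t=1..Suc T. W t (\<theta>, \<xi>))) \<partial>?P \<partial>N)"
    by (subst P.nn_integral_fst[symmetric]) simp_all
  also have "\<dots> \<le> (\<integral>\<^sup>+\<theta>. \<integral>\<^sup>+\<xi>. ennreal (exp (\<Sum>t=1..T. W t (\<theta>, \<xi>))) \<partial>?P \<partial>N)"
  proof (rule nn_integral_mono)
    fix \<theta> assume \<theta>: "\<theta> \<in> space N"
    have "(\<integral>\<^sup>+\<xi>. ennreal (exp (\<Sum>t=1..Suc T. W t (\<theta>, \<xi>))) \<partial>?P) =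
        (\<integral>\<^sup>+\<xi>. \<integral>\<^sup>+y. ennreal (exp (\<Sum>t=1..Suc T. W t (\<theta>, \<xi>(Suc T := y)))) \<partial>D \<partial>?P)"
      by (rule nn_integral_PiM_resample[OF D sec[OF \<theta>]])
    also have "\<dots> \<le> (\<integral>\<^sup>+\<xi>. ennreal (exp (\<Sum>t=1..T. W t (\<theta>, \<xi>))) \<partial>?P)"
    proof (rule nn_integral_mono)
      fix \<xi> assume \<xi>: "\<xi> \<in> space ?P"
      have past: "(\<Sum>t=1..T. W t (\<theta>, \<xi>(Suc T := y))) = (\<Sum>t=1..T. W t (\<theta>, \<xi>))" for y
        by (intro sum.cong refl adapted) auto
      have meas: "(\<lambda>y. W (Suc T) (\<theta>, \<xi>(Suc T := y))) \<in> borel_measurable D"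
      proof -
        have "(\<lambda>y. \<xi>(Suc T := y)) \<in> D \<rightarrow>\<^sub>M ?P"
          using \<xi> by (intro measurable_PiM_single') (auto simp: space_PiM PiE_iff)
        then have "(\<lambda>y. (\<theta>, \<xi>(Suc T := y))) \<in> D \<rightarrow>\<^sub>M N \<Otimes>\<^sub>M ?P"
          using \<theta> by simp
        from measurable_compose[OF this W[of "Suc T"]] show ?thesis by simp
      qed
      have "(\<integral>\<^sup>+y. ennreal (exp (\<Sum>t=1..Suc T. W t (\<theta>, \<xi>(Suc T := y)))) \<partial>D) =
          (\<integral>\<^sup>+y. ennreal (exp (\<Sum>t=1..T. W t (\<theta>, \<xi>))) * ennreal (exp (W (Suc T) (\<theta>, \<xi>(Suc T := y)))) \<partial>D)"
        using past by (simp add: exp_add ennreal_mult')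
      also have "\<dots> = ennreal (exp (\<Sum>t=1..T. W t (\<theta>, \<xi>))) * (\<integral>\<^sup>+y. ennreal (exp (W (Suc T) (\<theta>, \<xi>(Suc T := y)))) \<partial>D)"
        using meas by (intro nn_integral_cmult) simp
      also have "\<dots> \<le> ennreal (exp (\<Sum>t=1..T. W t (\<theta>, \<xi>))) * 1"
        using \<theta> by (intro mult_left_mono moment) auto
      finally show "(\<integral>\<^sup>+y. ennreal (exp (\<Sum>t=1..Suc T. W t (\<theta>, \<xi>(Suc T := y)))) \<partial>D) \<le>
          ennreal (exp (\<Sum>t=1..T. W t (\<theta>, \<xi>)))" by simp
    qed
    finally show "(\<integral>\<^sup>+\<xi>. ennreal (exp (\<Sum>t=1..Suc T. W t (\<theta>, \<xi>))) \<partial>?P) \<le>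
        (\<integral>\<^sup>+\<xi>. ennreal (exp (\<Sum>t=1..T. W t (\<theta>, \<xi>))) \<partial>?P)" .
  qed
  also have "\<dots> = (\<integral>\<^sup>+\<omega>. ennreal (exp (\<Sum>t=1..T. W t \<omega>)) \<partial>(N \<Otimes>\<^sub>M ?P))"
    by (subst P.nn_integral_fst[symmetric]) simp_all
  finally show ?case using Suc.IH by simp
qed

lemma (in prob_space) exponential_markov:
  fixes f :: "'a \<Rightarrow> real"
  assumes [measurable]: "f \<in> borel_measurable M" and le: "(\<integral>\<^sup>+\<omega>. ennreal (exp (f \<omega>)) \<partial>M) \<le> 1"
  shows "1 - exp (- L) \<le> prob {\<omega> \<in> space M. f \<omega> \<le> L}"
proof -
  let ?A = "{\<omega> \<in> space M. 1 \<le> ennreal (exp (- L)) * ennreal (exp (f \<omega>))}"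
  have "emeasure M ?A \<le> ennreal (exp (- L)) * (\<integral>\<^sup>+\<omega>. ennreal (exp (f \<omega>)) * indicator (space M) \<omega> \<partial>M)"
    by (rule nn_integral_Markov_inequality) auto
  also have "(\<integral>\<^sup>+\<omega>. ennreal (exp (f \<omega>)) * indicator (space M) \<omega> \<partial>M) = (\<integral>\<^sup>+\<omega>. ennreal (exp (f \<omega>)) \<partial>M)"
    by (intro nn_integral_cong) simp
  also have "ennreal (exp (- L)) * \<dots> \<le> ennreal (exp (- L)) * 1"
    by (intro mult_left_mono le) simp
  finally have A: "prob ?A \<le> exp (- L)"
    by (simp add: emeasure_eq_measure)
  have "{\<omega> \<in> space M. L < f \<omega>} \<subseteq> ?A"
  proof safe
    fix \<omega> assume "L < f \<omega>"
    then have "1 \<le> exp (- L) * exp (f \<omega>)" by (simp add: exp_add[symmetric])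
    then show "1 \<le> ennreal (exp (- L)) * ennreal (exp (f \<omega>))"
      by (simp add: ennreal_mult'[symmetric] ennreal_ge_1)
  qed
  then have "prob {\<omega> \<in> space M. L < f \<omega>} \<le> exp (- L)"
    using finite_measure_mono[of "{\<omega> \<in> space M. L < f \<omega>}" ?A] A by simp
  moreover have "{\<omega> \<in> space M. f \<omega> \<le> L} = space M - {\<omega> \<in> space M. L < f \<omega>}" by auto
  moreover have "prob (space M - {\<omega> \<in> space M. L < f \<omega>}) = 1 - prob {\<omega> \<in> space M. L < f \<omega>}"
    by (rule prob_compl) simp
  ultimately show ?thesis by simp
qed

text \<open>
  The scale \<open>l\<close> minimizes \<open>l (4 d + 2 T) + L / l\<close>. From \<open>d L \<le> T\<close> follow \<open>l \<surd>d \<le> 3/4\<close> and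
  \<open>l \<surd>2 d / \<surd>T \<le> 3/4\<close>, and also that the minimum \<open>2 \<surd>(L (2 T + 4 d))\<close> is at most \<open>2 \<surd>(T (2 L + 4))\<close>.
\<close>

lemma tuning_constants:
  fixes T d L :: real
  assumes "0 < L" "1 \<le> d" "d * L \<le> T" "0 < T"
  defines "l \<equiv> sqrt (L / (2 * T + 4 * d))"
  shows "0 < l" and "l * (sqrt 2 * d / sqrt T + sqrt d) \<le> 3 / 2"
    and "2 * sqrt 2 * sqrt T + l * (4 * d + 2 * T) + L / l \<le> 4 * sqrt (T * (3 + 2 * L))"
proof -
  note pos = assms(1-4)
  define q where "q = 2 * T + 4 * d"
  have q: "0 < q" using pos by (simp add: q_def)
  have l: "l = sqrt (L / q)" unfolding l_def q_def ..
  show l_pos: "0 < l" using pos q by (simp add: l)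
  have lsq: "l\<^sup>2 = L / q" using pos q by (simp add: l)
  have "(l * sqrt d)\<^sup>2 \<le> (3 / 4)\<^sup>2"
  proof -
    have "(l * sqrt d)\<^sup>2 = d * L / q" using pos by (simp add: power_mult_distrib lsq)
    also have "\<dots> \<le> 1 / 2" using pos q by (simp add: q_def divide_le_eq)
    also have "1 / 2 \<le> (3 / 4 :: real)\<^sup>2" by (simp add: power2_eq_square)
    finally show ?thesis .
  qed
  then have "l * sqrt d \<le> 3 / 4" by (rule power2_le_imp_le) simp
  moreover have "(l * (sqrt 2 * d / sqrt T))\<^sup>2 \<le> (3 / 4)\<^sup>2"
  proof -
    have "(l * (sqrt 2 * d / sqrt T))\<^sup>2 = l\<^sup>2 * (2 * d\<^sup>2 / T)"
      using pos by (simp add: power_mult_distrib power_divide)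
    also have "\<dots> = (d * L) * (2 * d / (T * q))"
      unfolding lsq by (simp add: power2_eq_square mult_ac)
    also have "\<dots> \<le> T * (2 * d / (T * q))"
      using pos q by (intro mult_right_mono) auto
    also have "\<dots> \<le> 1 / 2" using pos q by (simp add: q_def divide_le_eq)
    also have "1 / 2 \<le> (3 / 4 :: real)\<^sup>2" by (simp add: power2_eq_square)
    finally show ?thesis .
  qed
  then have "l * (sqrt 2 * d / sqrt T) \<le> 3 / 4" by (rule power2_le_imp_le) simp
  ultimately show "l * (sqrt 2 * d / sqrt T + sqrt d) \<le> 3 / 2"
    unfolding distrib_left by linarith
  have lq: "l * q = sqrt (L * q)" "L / l = sqrt (L * q)"
    using pos q by (auto simp: l real_sqrt_mult real_sqrt_divide real_div_sqrt field_simps)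
  have "L * q \<le> T * (2 * L + 4)" using pos by (simp add: q_def algebra_simps)
  then have "sqrt (L * q) \<le> sqrt T * sqrt (2 * L + 4)"
    unfolding real_sqrt_mult[symmetric] by simp
  moreover have "2 * sqrt 2 + 2 * sqrt (2 * L + 4) \<le> 4 * sqrt (3 + 2 * L)"
  proof (rule power2_le_imp_le)
    have "(2 * sqrt 2 + 2 * sqrt (2 * L + 4))\<^sup>2 \<le> 2 * ((2 * sqrt 2)\<^sup>2 + (2 * sqrt (2 * L + 4))\<^sup>2)"
      using zero_le_power2[of "2 * sqrt 2 - 2 * sqrt (2 * L + 4)"] by (simp add: power2_eq_square algebra_simps)
    also have "\<dots> = 48 + 16 * L" using pos by (simp add: power_mult_distrib)
    also have "\<dots> \<le> (4 * sqrt (3 + 2 * L))\<^sup>2" using pos by (simp add: power_mult_distrib)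
    finally show "(2 * sqrt 2 + 2 * sqrt (2 * L + 4))\<^sup>2 \<le> (4 * sqrt (3 + 2 * L))\<^sup>2" .
  qed (use pos in simp)
  then have "sqrt T * (2 * sqrt 2 + 2 * sqrt (2 * L + 4)) \<le> sqrt T * (4 * sqrt (3 + 2 * L))"
    using pos by (intro mult_left_mono) auto
  then have "sqrt T * (2 * sqrt 2) + 2 * (sqrt T * sqrt (2 * L + 4)) \<le> 4 * sqrt (T * (3 + 2 * L))"
    unfolding real_sqrt_mult[of T] distrib_left[of "sqrt T"] by simp
  moreover have "4 * d + 2 * T = q" by (simp add: q_def)
  ultimately show "2 * sqrt 2 * sqrt T + l * (4 * d + 2 * T) + L / l \<le> 4 * sqrt (T * (3 + 2 * L))"
    using lq by (simp add: mult.commute)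
qed

lemma sum_inverse_sqrt_le: "(\<Sum>t=1..T. real t powr (- 1 / 2)) \<le> 2 * sqrt (real T)"
proof -
  have "(\<Sum>t=1..T. 1 / sqrt (\<Sum>s=1..t. 1)) \<le> 2 * sqrt (\<Sum>s=1..T. 1 :: real)"
    by (rule sum_div_sqrt_le) simp
  moreover have "real t powr (- 1 / 2) = 1 / sqrt (real t)" for t
    using powr_minus_divide[of "real t" "1 / 2"] by (simp add: powr_half_sqrt)
  ultimately show ?thesis by simp
qed

section \<open>A single round\<close>

context convex_body
begin

lemma retracted_point_in_C:
  assumes "membership_oracle C mem" "0 < \<delta>" "\<delta> < 1 / 3" "norm w \<le> R"
  shows "(if 1 \<le> gau r R mem w \<delta> then w /\<^sub>R gau r R mem w \<delta> else w) \<in> C"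
proof -
  have acc: "gau r R mem w \<delta> = 0 \<and> body_gauge w < 3 / 5 \<or> body_gauge w \<le> gau r R mem w \<delta>"
    using gau_accuracy[of \<delta> w mem] assms R_pos by auto
  show ?thesis
  proof (cases "1 \<le> gau r R mem w \<delta>")
    case True
    then show ?thesis using acc by (auto intro: scaled_in_C)
  next
    case False
    then have "body_gauge w \<le> 1" using acc by linarith
    then show ?thesis using False by (simp add: gauge_le_1_iff)
  qed
qed

text \<open>
  If the retraction is active and hurts, that is \<open>1 \<le> \<gamma>\<close> and \<open>g \<bullet> w < 0\<close>, then with \<open>q = - (g \<bullet> p)\<close> it costs
  \<open>g \<bullet> (p - w) = q (\<gamma> - 1)\<close>. The surrogate subgradient contains \<open>q\<close> times the estimator, whose
  expected inner product with \<open>x - w\<close> is at most \<open>1 - \<gamma> + 2 \<delta>\<close>; so on average it pays for this cost up to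
  \<open>2 q \<delta> \<le> 2 B R \<delta>\<close>, which is the term subtracted in the exponent. In the other cases the surrogate is
  \<open>g\<close> itself and the retraction costs nothing.
\<close>

lemma round_exponential_moment:
  fixes mem :: "real^'n \<Rightarrow> real \<Rightarrow> bool"
  assumes mem: "membership_oracle C mem"
    and mem_meas: "\<And>\<epsilon>. \<epsilon> > 0 \<Longrightarrow> {x. mem x \<epsilon>} \<in> sets borel"
    and \<delta>: "0 < \<delta>" "\<delta> < 1 / 3" and w: "norm w \<le> R" and x: "x \<in> C"
    and g: "norm g \<le> B" and B: "0 < B" and K: "R / r + \<delta> / 20 \<le> K"
    and c: "0 < c" and \<beta>: "0 \<le> \<beta>" and d: "d = real CARD('n)"
    and m: "m = 4 * B\<^sup>2 * d * K\<^sup>2"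
    and small: "\<beta> * (sqrt 2 * R * (d * m) / c + 2 * B * R * d * K) \<le> 3 / 2"
  defines "\<gamma> \<equiv> gau r R mem w \<delta>"
  defines "p \<equiv> (if 1 \<le> \<gamma> then w /\<^sub>R \<gamma> else w)"
  defines "G y \<equiv> g - (if g \<bullet> w < 0 then (g \<bullet> p) *\<^sub>R (if 1 \<le> \<gamma> then snd (one_d_opt r R mem w \<delta> y) else 0) else 0)"
  shows "(\<integral>\<^sup>+y. ennreal (exp (\<beta> * (sqrt 2 * R * (norm (G y))\<^sup>2 / c + g \<bullet> (p - x) - G y \<bullet> (w - x) - 2 * B * R * \<delta>))) \<partial>draw_measure)
    \<le> ennreal (exp (\<beta> * (sqrt 2 * R * m / c) + \<beta>\<^sup>2 * (R\<^sup>2 * m * (4 * d * m / c\<^sup>2 + 2))))"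
proof -
  let ?X = "\<beta> * (sqrt 2 * R * m / c) + \<beta>\<^sup>2 * (R\<^sup>2 * m * (4 * d * m / c\<^sup>2 + 2))"
  define q where "q = (if g \<bullet> w < 0 \<and> 1 \<le> \<gamma> then - (g \<bullet> p) else 0)"
  define S where "S y = (if q = 0 then 0 else q *\<^sub>R snd (one_d_opt r R mem w \<delta> y))" for y
  define D where "D = g \<bullet> (p - w)"
  define e where "e = (if q = 0 then 0 else q * (1 - \<gamma> + 2 * \<delta>))"
  have d1: "1 \<le> d" using d by (simp add: Suc_leI)
  have "1 \<le> R / r" using r_pos r_le_R by simp
  then have K1: "1 \<le> K" using K \<delta> by linarith
  have G_eq: "G y = g + S y" for y
    by (auto simp: G_def S_def q_def)
  have p_C: "p \<in> C"
    unfolding p_def \<gamma>_def by (rule retracted_point_in_C[OF mem \<delta> w])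
  then have p_le: "norm p \<le> R" using sub_ball by auto
  have x_le: "norm x \<le> R" using x sub_ball by auto
  have q_le: "q \<le> B * R"
  proof -
    have "- (g \<bullet> p) \<le> norm g * norm p" using Cauchy_Schwarz_ineq2[of g p] by linarith
    also have "\<dots> \<le> B * R" using g p_le B by (intro mult_mono) auto
    finally show ?thesis using B R_pos by (simp add: q_def)
  qed
  have q_nn: "0 \<le> q"
    by (auto simp: q_def p_def intro: mult_nonneg_nonpos)
  have drift: "D + e \<le> 2 * B * R * \<delta>"
  proof (cases "q = 0")
    case True
    have "D \<le> 0"
    proof (cases "1 \<le> \<gamma>")
      case \<gamma>: True
      then have gp: "g \<bullet> p = inverse \<gamma> * (g \<bullet> w)" by (simp add: p_def)
      have "0 \<le> g \<bullet> w"
      proof (rule ccontr)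
        assume "\<not> 0 \<le> g \<bullet> w"
        then show False using True \<gamma> gp by (auto simp: q_def)
      qed
      then have "inverse \<gamma> * (g \<bullet> w) \<le> 1 * (g \<bullet> w)"
        using \<gamma> by (intro mult_right_mono) (auto simp: inverse_eq_divide)
      then show ?thesis using \<gamma> by (simp add: D_def p_def inner_diff_right)
    qed (simp add: D_def p_def)
    moreover have "0 \<le> 2 * B * R * \<delta>" using B R_pos \<delta> by simp
    ultimately show ?thesis using True by (simp add: e_def)
  next
    case False
    then have \<gamma>: "1 \<le> \<gamma>" and q: "q = - (g \<bullet> p)" by (auto simp: q_def split: if_splits)
    have "D = q * (\<gamma> - 1)"
      using \<gamma> by (simp add: D_def q p_def inner_diff_right field_simps)
    then have "D + e = 2 * \<delta> * q" using False by (simp add: e_def algebra_simps)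
    also have "\<dots> \<le> 2 * \<delta> * (B * R)" using q_le \<delta> by (intro mult_left_mono) auto
    finally show ?thesis by (simp add: mult_ac)
  qed
  have rK: "1 / r + \<delta> / (20 * R) \<le> K / R"
  proof -
    have "1 / r + \<delta> / (20 * R) = (R / r + \<delta> / 20) / R"
      using R_pos by (simp add: add_divide_distrib)
    also have "\<dots> \<le> K / R" using K R_pos by (intro divide_right_mono) auto
    finally show ?thesis .
  qed
  have rK0: "0 \<le> 1 / r + \<delta> / (20 * R)" using r_pos R_pos \<delta> by simp
  have S_props: "S \<in> borel_measurable draw_measure \<and> (AE y in draw_measure. norm (S y) \<le> B * d * K) \<and>
    (\<integral>y. (norm (S y))\<^sup>2 \<partial>draw_measure) \<le> B\<^sup>2 * d * K\<^sup>2 \<and> (\<integral>y. S y \<bullet> (x - w) \<partial>draw_measure) \<le> e"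
  proof (cases "q = 0")
    case True
    then have "S = (\<lambda>y. 0)" by (simp add: S_def fun_eq_iff)
    then show ?thesis using True B d1 K1 by (simp add: e_def)
  next
    case False
    then have \<gamma>: "1 \<le> gau r R mem w \<delta>" by (auto simp: q_def \<gamma>_def split: if_splits)
    note ctx = mem mem_meas w \<delta> \<gamma> d
    have S: "S = (\<lambda>y. q *\<^sub>R snd (one_d_opt r R mem w \<delta> y))" using False by (simp add: S_def fun_eq_iff)
    have qR: "q * (1 / r + \<delta> / (20 * R)) \<le> B * K"
    proof -
      have "q * (1 / r + \<delta> / (20 * R)) \<le> (B * R) * (K / R)"
        using q_le q_nn rK rK0 B R_pos by (intro mult_mono) auto
      then show ?thesis using R_pos by simp
    qed
    have [measurable]: "(\<lambda>y. snd (one_d_opt r R mem w \<delta> y)) \<in> borel_measurable draw_measure"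
      by (rule estimator_measurable[OF ctx])
    have AE_le: "AE y in draw_measure. norm (snd (one_d_opt r R mem w \<delta> y)) \<le> d * (1 / r + \<delta> / (20 * R))"
      by (rule AE_norm_estimator_le[OF ctx])
    have "S \<in> borel_measurable draw_measure" unfolding S by measurable
    moreover have "AE y in draw_measure. norm (S y) \<le> B * d * K"
      using AE_le
    proof eventually_elim
      case (elim y)
      have "norm (S y) \<le> q * (d * (1 / r + \<delta> / (20 * R)))"
        using elim q_nn by (simp add: S mult_left_mono)
      also have "\<dots> = d * (q * (1 / r + \<delta> / (20 * R)))" by (simp add: algebra_simps)
      also have "\<dots> \<le> d * (B * K)" using qR d1 by (intro mult_left_mono) auto
      finally show ?case by (simp add: mult_ac)
    qed
    moreover have "(\<integral>y. (norm (S y))\<^sup>2 \<partial>draw_measure) \<le> B\<^sup>2 * d * K\<^sup>2"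
    proof -
      have "(\<integral>y. (norm (S y))\<^sup>2 \<partial>draw_measure) = q\<^sup>2 * (\<integral>y. (norm (snd (one_d_opt r R mem w \<delta> y)))\<^sup>2 \<partial>draw_measure)"
        unfolding S by (simp add: power_mult_distrib)
      also have "\<dots> \<le> q\<^sup>2 * (d * (1 / r + \<delta> / (20 * R))\<^sup>2)"
        by (intro mult_left_mono estimator_second_moment(2)[OF ctx]) auto
      also have "\<dots> = d * (q * (1 / r + \<delta> / (20 * R)))\<^sup>2" by (simp only: power_mult_distrib mult_ac)
      also have "\<dots> \<le> d * (B * K)\<^sup>2"
        using qR q_nn rK0 d1 by (intro mult_left_mono power_mono) auto
      finally show ?thesis by (simp add: power_mult_distrib mult_ac)
    qed
    moreover have "(\<integral>y. S y \<bullet> (x - w) \<partial>draw_measure) \<le> e"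
    proof -
      have "(\<integral>y. S y \<bullet> (x - w) \<partial>draw_measure) = q * (\<integral>y. snd (one_d_opt r R mem w \<delta> y) \<bullet> (x - w) \<partial>draw_measure)"
        unfolding S by simp
      also have "\<dots> \<le> q * (1 - \<gamma> + 2 * \<delta>)"
        unfolding \<gamma>_def using q_nn by (intro mult_left_mono estimator_bias(2)[OF ctx x])
      finally show ?thesis using False by (simp add: e_def)
    qed
    ultimately show ?thesis by blast
  qed
  then have S_meas[measurable]: "S \<in> borel_measurable draw_measure" by blast
  have xw: "norm (x - w) \<le> 2 * R" using norm_triangle_ineq4[of x w] x_le w by linarith
  have eq: "\<beta> * (sqrt 2 * R * (norm (G y))\<^sup>2 / c + g \<bullet> (p - x) - G y \<bullet> (w - x) - 2 * B * R * \<delta>) =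
      \<beta> * (sqrt 2 * R * (norm (g + S y))\<^sup>2 / c + S y \<bullet> (x - w)) + \<beta> * (D - 2 * B * R * \<delta>)" for y
    unfolding G_eq D_def by (simp add: inner_diff_right inner_add_left algebra_simps)
  have "(\<integral>\<^sup>+y. ennreal (exp (\<beta> * (sqrt 2 * R * (norm (G y))\<^sup>2 / c + g \<bullet> (p - x) - G y \<bullet> (w - x) - 2 * B * R * \<delta>))) \<partial>draw_measure)
    = (\<integral>\<^sup>+y. ennreal (exp (\<beta> * (sqrt 2 * R * (norm (g + S y))\<^sup>2 / c + S y \<bullet> (x - w)))) \<partial>draw_measure) *
      ennreal (exp (\<beta> * (D - 2 * B * R * \<delta>)))"
    unfolding eq exp_add by (subst nn_integral_multc[symmetric]) (simp_all add: ennreal_mult')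
  also have "\<dots> \<le> ennreal (exp (\<beta> * (sqrt 2 * R * m / c + e) + \<beta>\<^sup>2 * (R\<^sup>2 * m * (4 * d * m / c\<^sup>2 + 2)))) *
      ennreal (exp (\<beta> * (D - 2 * B * R * \<delta>)))"
    using S_props
    by (intro mult_right_mono exponential_moment_bound[OF prob_space_draw S_meas _ _ _ xw g B d1 K1 R_pos c \<beta> m small]) auto
  also have "\<dots> = ennreal (exp (?X +
      \<beta> * (D + e - 2 * B * R * \<delta>)))"
    by (subst ennreal_mult'[symmetric]) (simp_all add: exp_add[symmetric] algebra_simps)
  also have "\<dots> \<le> ennreal (exp ?X)"
  proof -
    have "\<beta> * (D + e - 2 * B * R * \<delta>) \<le> 0" using drift \<beta> by (intro mult_nonneg_nonpos) auto
    then show ?thesis by (intro ennreal_leI) simp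
  qed
  finally show ?thesis .
qed

end

section \<open>Unrolling the wrapper\<close>

lemma wrapper_cong_draws:
  assumes "\<And>s. s \<le> t \<Longrightarrow> \<xi> s = \<xi>' s"
  shows "wrapper A orc \<delta> adv sg \<xi> t = wrapper A orc \<delta> adv sg \<xi>' t"
  using assms
proof (induction t rule: less_induct)
  case (less t)
  have past: "(\<lambda>s. if s \<in> {1..<t} then wrapper A orc \<delta> adv sg \<xi> s else undefined) =
      (\<lambda>s. if s \<in> {1..<t} then wrapper A orc \<delta> adv sg \<xi>' s else undefined)"
    using less.IH less.prems by (auto simp: fun_eq_iff)
  show ?case
    using less.prems[of t] by (subst (1 2) wrapper.simps) (simp only: past order_refl)
qed

text \<open>
  The wrapper passes to its subroutine and to the adversary only the rounds played so far. Since
  FTRL-proximal ignores the later entries of its argument, the recursion can be stated with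
  the full sequence of rounds.
\<close>

lemma wrapper_ftrl:
  fixes \<xi> :: "nat \<Rightarrow> 'b" and orc :: "real^'n \<Rightarrow> real \<Rightarrow> 'b \<Rightarrow> real \<times> (real^'n)"
    and D :: real and \<delta> :: "nat \<Rightarrow> real" and adv sg
  defines "run \<equiv> wrapper (ftrl_proximal D) orc \<delta> adv sg \<xi>"
  defines "w t \<equiv> ftrl_proximal D (\<lambda>s. surrogate (run s)) t"
  defines "\<gamma> t \<equiv> fst (orc (w t) (\<delta> t) (\<xi> t))"
  shows wrapper_ftrl_played: "played (run t) = (if 1 \<le> \<gamma> t then w t /\<^sub>R \<gamma> t else w t)"
    and wrapper_ftrl_subgrad: "subgrad (run t) = sg t (adv t (\<lambda>s\<in>{1..t}. played (run s))) (played (run t))"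
    and wrapper_ftrl_surrogate: "surrogate (run t) = subgrad (run t) -
      (if subgrad (run t) \<bullet> w t < 0
       then (subgrad (run t) \<bullet> played (run t)) *\<^sub>R (if 1 \<le> \<gamma> t then snd (orc (w t) (\<delta> t) (\<xi> t)) else 0) else 0)"
proof -
  define past where "past = (\<lambda>s. if s \<in> {1..<t} then run s else undefined)"
  have w: "ftrl_proximal D (\<lambda>s\<in>{1..<t}. surrogate (past s)) t = w t"
    unfolding w_def by (rule ftrl_proximal_cong) (simp add: past_def)
  have run: "run t =
    (let (\<gamma>', s) = orc (w t) (\<delta> t) (\<xi> t);
         \<nu> = (if \<gamma>' \<ge> 1 then s else 0);
         x = (if \<gamma>' \<ge> 1 then w t /\<^sub>R \<gamma>' else w t);
         loss = adv t (\<lambda>s\<in>{1..t}. if s < t then played (past s) else x);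
         g = sg t loss x;
         g' = g - (if g \<bullet> w t < 0 then (g \<bullet> x) *\<^sub>R \<nu> else 0)
     in \<lparr>played = x, subgrad = g, surrogate = g'\<rparr>)"
    unfolding run_def by (subst wrapper.simps) (simp only: Let_def run_def[symmetric] past_def[symmetric] w)
  show pl: "played (run t) = (if 1 \<le> \<gamma> t then w t /\<^sub>R \<gamma> t else w t)"
    unfolding run by (simp add: Let_def case_prod_unfold \<gamma>_def)
  have hist: "(\<lambda>s\<in>{1..t}. if s < t then played (past s) else (if 1 \<le> \<gamma> t then w t /\<^sub>R \<gamma> t else w t)) =
      (\<lambda>s\<in>{1..t}. played (run s))"
    unfolding pl[symmetric] by (auto simp: past_def restrict_def fun_eq_iff)
  show "subgrad (run t) = sg t (adv t (\<lambda>s\<in>{1..t}. played (run s))) (played (run t))"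
    unfolding hist[symmetric] pl \<gamma>_def by (simp add: run Let_def case_prod_unfold)
  show "surrogate (run t) = subgrad (run t) -
      (if subgrad (run t) \<bullet> w t < 0
       then (subgrad (run t) \<bullet> played (run t)) *\<^sub>R (if 1 \<le> \<gamma> t then snd (orc (w t) (\<delta> t) (\<xi> t)) else 0) else 0)"
    unfolding run by (simp add: Let_def case_prod_unfold \<gamma>_def)
qed

lemma measurable_ftrl_proximal:
  fixes v :: "'w \<Rightarrow> nat \<Rightarrow> 'a::euclidean_space"
  assumes "0 \<le> D" and "\<And>s. 1 \<le> s \<Longrightarrow> s < t \<Longrightarrow> (\<lambda>\<omega>. v \<omega> s) \<in> borel_measurable M"
  shows "(\<lambda>\<omega>. ftrl_proximal D (v \<omega>) t) \<in> borel_measurable M"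
  using assms(2)
proof (induction t rule: less_induct)
  case (less t)
  show ?case
  proof (cases t)
    case (Suc t')
    have v[measurable]: "(\<lambda>\<omega>. v \<omega> s) \<in> borel_measurable M" if "s \<in> {1..t'}" for s
      using that Suc by (intro less.prems) auto
    have w[measurable]: "(\<lambda>\<omega>. ftrl_proximal D (v \<omega>) s) \<in> borel_measurable M" if "s \<in> {1..t'}" for s
      using that Suc by (intro less.IH less.prems) auto
    have eta[measurable]: "(\<lambda>\<omega>. ftrl_eta D (v \<omega>) s) \<in> borel_measurable M" if "s \<le> t'" for s
      unfolding ftrl_eta_def using that
      by (intro borel_measurable_divide borel_measurable_const borel_measurable_sqrt borel_measurable_sum
          borel_measurable_power borel_measurable_norm v) auto
    have sig[measurable]: "(\<lambda>\<omega>. ftrl_sigma D (v \<omega>) s) \<in> borel_measurable M" if "s \<in> {1..t'}" for s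
    proof -
      have "s \<le> t'" "s - 1 \<le> t'" using that by auto
      then show ?thesis unfolding ftrl_sigma_def
        by (intro borel_measurable_diff borel_measurable_divide borel_measurable_const eta)
    qed
    have "continuous_on UNIV (closest_point (cball 0 D :: 'a set))"
      using assms(1) by (intro continuous_on_closest_point) auto
    then have [measurable]: "closest_point (cball 0 D :: 'a set) \<in> borel_measurable borel"
      by (rule borel_measurable_continuous_onI)
    have [measurable]: "(\<lambda>\<omega>. \<Sum>s=1..t'. v \<omega> s) \<in> borel_measurable M"
      "(\<lambda>\<omega>. \<Sum>s=1..t'. ftrl_sigma D (v \<omega>) s) \<in> borel_measurable M"
      "(\<lambda>\<omega>. \<Sum>s=1..t'. ftrl_sigma D (v \<omega>) s *\<^sub>R ftrl_proximal D (v \<omega>) s) \<in> borel_measurable M"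
      by (intro borel_measurable_sum borel_measurable_scaleR v w sig; assumption)+
    show ?thesis unfolding Suc ftrl_proximal.simps Let_def by measurable
  qed simp
qed

section \<open>The regret of the game\<close>

text \<open>
  The seed \<open>\<theta>\<close> of the adversary is kept as a parameter of \<open>adv\<close>: conditionally on it the losses are a
  fixed function of the played points.
\<close>

locale projection_free_game = convex_body C r R for C :: "(real^'n) set" and r R :: real +
  fixes E :: "(real^'n) set" and B \<delta> :: real
    and mem :: "real^'n \<Rightarrow> real \<Rightarrow> bool"
    and N :: "'s measure"
    and adv :: "'s \<Rightarrow> nat \<Rightarrow> (nat \<Rightarrow> real^'n) \<Rightarrow> real^'n \<Rightarrow> real"
    and sg :: "nat \<Rightarrow> (real^'n \<Rightarrow> real) \<Rightarrow> real^'n \<Rightarrow> real^'n"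
  assumes \<delta>: "0 < \<delta>" "\<delta> < 1 / 3" and B: "0 < B"
    and mem: "membership_oracle C mem"
    and mem_meas: "\<And>\<epsilon>. \<epsilon> > 0 \<Longrightarrow> {x. mem x \<epsilon>} \<in> sets borel"
    and N: "prob_space N"
    and adversary: "\<And>\<theta> t h. \<lbrakk>\<theta> \<in> space N; t \<ge> 1; h \<in> {1..t} \<rightarrow>\<^sub>E C\<rbrakk> \<Longrightarrow>
      subgradients_bounded C E B (adv \<theta> t h) \<and>
      sg t (adv \<theta> t h) (h t) \<in> subdifferential E (adv \<theta> t h) (h t)"
    and sg_meas: "\<And>t. t \<ge> 1 \<Longrightarrow> (\<lambda>(\<theta>, h). sg t (adv \<theta> t h) (h t)) \<in>
      borel_measurable (N \<Otimes>\<^sub>M (\<Pi>\<^sub>M s\<in>{1..t}. restrict_space borel C))"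
begin

definition tol :: "nat \<Rightarrow> real" where
  "tol t = \<delta> * real t powr (- 1 / 2)"

definition play :: "'s \<times> (nat \<Rightarrow> 'n draw) \<Rightarrow> nat \<Rightarrow> 'n round" where
  "play \<omega> = wrapper (ftrl_proximal R) (one_d_opt r R mem) tol (adv (fst \<omega>)) sg (snd \<omega>)"

definition iterate :: "'s \<times> (nat \<Rightarrow> 'n draw) \<Rightarrow> nat \<Rightarrow> real^'n" where
  "iterate \<omega> t = ftrl_proximal R (\<lambda>s. surrogate (play \<omega> s)) t"

abbreviation "gauge_estimate \<omega> t \<equiv> gau r R mem (iterate \<omega> t) (tol t)"

lemma tol_bounds:
  assumes "1 \<le> t"
  shows "0 < tol t" "tol t \<le> \<delta>" "tol t < 1 / 3"
proof -
  have "real t powr (- 1 / 2) \<le> 1" using assms powr_mono2'[of "- 1 / 2" 1 "real t"] by simp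
  then show *: "tol t \<le> \<delta>" using \<delta> by (simp add: tol_def)
  show "0 < tol t" using assms \<delta> by (simp add: tol_def)
  show "tol t < 1 / 3" using * \<delta> by simp
qed

lemma norm_iterate_le: "norm (iterate \<omega> t) \<le> R"
  unfolding iterate_def by (rule norm_ftrl_proximal_le) (use R_pos in simp)

lemma played_eq: "played (play \<omega> t) =
  (if 1 \<le> gauge_estimate \<omega> t then iterate \<omega> t /\<^sub>R gauge_estimate \<omega> t else iterate \<omega> t)"
  unfolding play_def iterate_def by (subst wrapper_ftrl_played) (simp only: fst_one_d_opt)

lemma subgrad_eq:
  assumes "1 \<le> t"
  shows "subgrad (play \<omega> t) = (\<lambda>(\<theta>, h). sg t (adv \<theta> t h) (h t)) (fst \<omega>, \<lambda>s\<in>{1..t}. played (play \<omega> s))"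
  using assms unfolding play_def by (subst wrapper_ftrl_subgrad) simp_all

lemma surrogate_eq: "surrogate (play \<omega> t) = subgrad (play \<omega> t) -
  (if subgrad (play \<omega> t) \<bullet> iterate \<omega> t < 0
   then (subgrad (play \<omega> t) \<bullet> played (play \<omega> t)) *\<^sub>R
     (if 1 \<le> gauge_estimate \<omega> t then snd (one_d_opt r R mem (iterate \<omega> t) (tol t) (snd \<omega> t)) else 0) else 0)"
  unfolding play_def iterate_def by (subst wrapper_ftrl_surrogate) (simp only: fst_one_d_opt)

lemma played_in_C: "1 \<le> t \<Longrightarrow> played (play \<omega> t) \<in> C"
  unfolding played_eq by (intro retracted_point_in_C[OF mem] tol_bounds norm_iterate_le)

lemma history_in_C: "(\<lambda>s\<in>{1..t}. played (play \<omega> s)) \<in> {1..t} \<rightarrow>\<^sub>E C"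
  using played_in_C by auto

lemma norm_subgrad_le:
  assumes "fst \<omega> \<in> space N" "1 \<le> t"
  shows "norm (subgrad (play \<omega> t)) \<le> B"
proof -
  let ?h = "\<lambda>s\<in>{1..t}. played (play \<omega> s)"
  have "subgradients_bounded C E B (adv (fst \<omega>) t ?h)"
    "sg t (adv (fst \<omega>) t ?h) (?h t) \<in> subdifferential E (adv (fst \<omega>) t ?h) (?h t)"
    using adversary[OF assms history_in_C] by blast+
  moreover have "?h t \<in> C" using played_in_C[OF assms(2)] assms(2) by simp
  ultimately show ?thesis
    unfolding subgrad_eq[OF assms(2)] subgradients_bounded_def by auto
qed

abbreviation game :: "('s \<times> (nat \<Rightarrow> 'n draw)) measure" where
  "game \<equiv> N \<Otimes>\<^sub>M (\<Pi>\<^sub>M t\<in>UNIV. draw_measure)"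

text \<open>
  The iterate is a function of the earlier surrogates, the subgradient one of all points played, and the
  surrogate one of both, so measurability is proved by one simultaneous induction.
\<close>

lemma play_measurable:
  assumes "1 \<le> t"
  shows "(\<lambda>\<omega>. iterate \<omega> t) \<in> borel_measurable game \<and> (\<lambda>\<omega>. played (play \<omega> t)) \<in> borel_measurable game \<and>
    (\<lambda>\<omega>. subgrad (play \<omega> t)) \<in> borel_measurable game \<and> (\<lambda>\<omega>. surrogate (play \<omega> t)) \<in> borel_measurable game"
  using assms
proof (induction t rule: less_induct)
  case (less t)
  note tol = tol_bounds[OF less.prems]
  have iter[measurable]: "(\<lambda>\<omega>. iterate \<omega> t) \<in> borel_measurable game"
    unfolding iterate_def by (rule measurable_ftrl_proximal) (use R_pos less.IH in auto)
  have [measurable]: "(\<lambda>w. gau r R mem w (tol t)) \<in> borel_measurable borel"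
    by (rule measurable_gau[OF mem_meas tol(1) r_pos R_pos])
  have pl[measurable]: "(\<lambda>\<omega>. played (play \<omega> t)) \<in> borel_measurable game"
    unfolding played_eq by measurable
  have "(\<lambda>\<omega>. (fst \<omega>, \<lambda>s\<in>{1..t}. played (play \<omega> s))) \<in>
      game \<rightarrow>\<^sub>M N \<Otimes>\<^sub>M (\<Pi>\<^sub>M s\<in>{1..t}. restrict_space borel C)"
  proof (intro measurable_Pair measurable_fst measurable_restrict measurable_restrict_space2)
    fix s assume s: "s \<in> {1..t}"
    show "(\<lambda>\<omega>. played (play \<omega> s)) \<in> space game \<rightarrow> C" using s played_in_C by auto
    show "(\<lambda>\<omega>. played (play \<omega> s)) \<in> borel_measurable game"
      using s pl less.IH[of s] by (cases "s = t") auto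
  qed
  from measurable_compose[OF this sg_meas[OF less.prems]]
  have sub[measurable]: "(\<lambda>\<omega>. subgrad (play \<omega> t)) \<in> borel_measurable game"
    unfolding subgrad_eq[OF less.prems] .
  have "(\<lambda>\<omega>. snd \<omega> t) \<in> game \<rightarrow>\<^sub>M draw_measure"
    by (rule measurable_compose[OF measurable_snd measurable_component_singleton]) simp
  then have "(\<lambda>\<omega>. (iterate \<omega> t, snd \<omega> t)) \<in> game \<rightarrow>\<^sub>M borel \<Otimes>\<^sub>M draw_measure"
    using iter by (intro measurable_Pair)
  from measurable_compose[OF this measurable_one_d_opt[OF mem_meas r_pos r_le_R tol(1,3)]]
  have [measurable]: "(\<lambda>\<omega>. snd (one_d_opt r R mem (iterate \<omega> t) (tol t) (snd \<omega> t))) \<in> borel_measurable game"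
    by simp
  have "(\<lambda>\<omega>. surrogate (play \<omega> t)) \<in> borel_measurable game"
    unfolding surrogate_eq by measurable
  then show ?case using iter pl sub by blast
qed

lemmas play_measurable_parts =
  play_measurable[THEN conjunct1]
  play_measurable[THEN conjunct2, THEN conjunct1]
  play_measurable[THEN conjunct2, THEN conjunct2, THEN conjunct1]
  play_measurable[THEN conjunct2, THEN conjunct2, THEN conjunct2]

lemma play_cong_draws:
  assumes "\<And>s. s \<le> t \<Longrightarrow> \<xi> s = \<xi>' s"
  shows "play (\<theta>, \<xi>) t = play (\<theta>, \<xi>') t"
  unfolding play_def fst_conv snd_conv by (rule wrapper_cong_draws) (rule assms)

text \<open>
  The query point, the played point and the observed subgradient of round \<open>t\<close> do not depend on the draw of
  that round; this is the reason why the moment bound of a single round holds given the past.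
\<close>

lemma iterate_cong_draws:
  assumes "\<And>s. s < t \<Longrightarrow> \<xi> s = \<xi>' s"
  shows "iterate (\<theta>, \<xi>) t = iterate (\<theta>, \<xi>') t"
  unfolding iterate_def
  by (rule ftrl_proximal_cong) (use assms in \<open>auto intro!: arg_cong[of _ _ surrogate] play_cong_draws\<close>)

lemma played_cong_draws:
  assumes "\<And>s. s < t \<Longrightarrow> \<xi> s = \<xi>' s"
  shows "played (play (\<theta>, \<xi>) t) = played (play (\<theta>, \<xi>') t)"
  unfolding played_eq using iterate_cong_draws[of t \<xi> \<xi>' \<theta>] assms by simp

lemma subgrad_cong_draws:
  assumes "1 \<le> t" "\<And>s. s < t \<Longrightarrow> \<xi> s = \<xi>' s"
  shows "subgrad (play (\<theta>, \<xi>) t) = subgrad (play (\<theta>, \<xi>') t)"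
proof -
  have "(\<lambda>s\<in>{1..t}. played (play (\<theta>, \<xi>) s)) = (\<lambda>s\<in>{1..t}. played (play (\<theta>, \<xi>') s))"
    by (intro restrict_ext played_cong_draws) (use assms in auto)
  then show ?thesis unfolding subgrad_eq[OF assms(1)] by simp
qed

abbreviation regret :: "'s \<times> (nat \<Rightarrow> 'n draw) \<Rightarrow> nat \<Rightarrow> real^'n \<Rightarrow> real" where
  "regret \<omega> T x \<equiv> \<Sum>t=1..T. subgrad (play \<omega> t) \<bullet> (played (play \<omega> t) - x)"

text \<open>
  With \<open>V\<close> the sum of the squared norms of the surrogates, the regret of FTRL-proximal is at most
  \<open>2 \<surd>2 R \<surd>V \<le> \<surd>2 R (c + V / c)\<close>, where \<open>c = \<surd>(m T)\<close> is the root of the bound on the expectation of \<open>V\<close>.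
  The share \<open>\<surd>2 R V / c\<close> is distributed over the rounds: it is the first term of \<open>q\<close>, whose exponential
  moment is bounded by \<open>round_exponential_moment\<close>. The biases \<open>2 B R \<delta> / \<surd>t\<close> of the rounds add up
  to at most \<open>4 B R \<delta> \<surd>T\<close>.
\<close>

lemma regret_bound:
  assumes \<rho>: "0 < \<rho>" "\<rho> < 1" and d: "d = real CARD('n)" and T: "d * ln (1 / \<rho>) \<le> real T" and x: "x \<in> C"
  defines "K \<equiv> R / r + \<delta>"
  shows "1 - \<rho> \<le> measure game {\<omega> \<in> space game.
    regret \<omega> T x
      \<le> 8 * R * B * K * sqrt (d * real T * (3 + 2 * ln (1 / \<rho>))) + 4 * B * R * \<delta> * sqrt (real T)}"
proof -
  interpret G: prob_space game
    by (intro prob_space_pairI N prob_space_PiM prob_space_draw)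
  define L where "L = ln (1 / \<rho>)"
  have L: "0 < L" using \<rho> by (simp add: L_def)
  have d1: "1 \<le> d" using d by (simp add: Suc_leI)
  have T_pos: "0 < real T" using T d1 L mult_pos_pos[of d L] unfolding L_def by linarith
  have K1: "1 \<le> K" using r_pos r_le_R \<delta> by (simp add: K_def add_increasing2)
  \<comment> \<open>\<open>m\<close> bounds the second moment of a surrogate subgradient, and \<open>n\<close> is its root\<close>
  define m where "m = 4 * B\<^sup>2 * d * K\<^sup>2"
  define n where "n = 2 * B * K * sqrt d"
  have n: "0 < n" "n\<^sup>2 = m" using B K1 d1 by (simp_all add: n_def m_def power_mult_distrib)
  have nm: "m = n * n" using n(2) by (simp add: power2_eq_square)
  define c where "c = n * sqrt (real T)"
  have c: "0 < c" "c\<^sup>2 = m * real T" using n T_pos by (simp_all add: c_def power_mult_distrib)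
  define l where "l = sqrt (L / (2 * real T + 4 * d))"
  note tuned = tuning_constants[OF L d1 _ T_pos, folded l_def]
  have dL: "d * L \<le> real T" using T by (simp add: L_def)
  \<comment> \<open>the scale of the supermartingale, in the unit \<open>R n\<close> of the regret of one round\<close>
  define \<beta> where "\<beta> = l / (R * n)"
  have \<beta>: "0 < \<beta>" using tuned(1)[OF dL] R_pos n by (simp add: \<beta>_def)
  have small: "\<beta> * (sqrt 2 * R * (d * m) / c + 2 * B * R * d * K) \<le> 3 / 2"
  proof -
    have "n * sqrt d = 2 * B * K * d"
      using d1 by (simp add: n_def mult.assoc)
    then have S_part: "2 * B * R * d * K = R * n * sqrt d" by (simp add: mult_ac)
    have Y_part: "sqrt 2 * R * (d * m) / c = R * n * (sqrt 2 * d / sqrt (real T))"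
      using n T_pos by (simp add: c_def nm)
    have "\<beta> * (sqrt 2 * R * (d * m) / c + 2 * B * R * d * K) =
        \<beta> * (R * n) * (sqrt 2 * d / sqrt (real T) + sqrt d)"
      unfolding S_part Y_part by (simp only: distrib_left mult.assoc)
    also have "\<beta> * (R * n) = l" using n R_pos by (simp add: \<beta>_def)
    finally show ?thesis using tuned(2)[OF dL] by simp
  qed
  define k where "k = \<beta> * (sqrt 2 * R * m / c) + \<beta>\<^sup>2 * (R\<^sup>2 * m * (4 * d * m / c\<^sup>2 + 2))"
  define q where "q t \<omega> = sqrt 2 * R * (norm (surrogate (play \<omega> t)))\<^sup>2 / c +
      subgrad (play \<omega> t) \<bullet> (played (play \<omega> t) - x) - surrogate (play \<omega> t) \<bullet> (iterate \<omega> t - x) -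
      2 * B * R * tol t" for t \<omega>
  define W where "W t \<omega> = \<beta> * q t \<omega> - k" for t \<omega>
  have W_meas: "W t \<in> borel_measurable game" if "1 \<le> t" for t
    unfolding W_def q_def using play_measurable_parts[OF that] by measurable
  have moment: "(\<integral>\<^sup>+\<omega>. ennreal (exp (\<Sum>t=1..T. W t \<omega>)) \<partial>game) \<le> 1"
  proof (rule exponential_supermartingale[OF N prob_space_draw W_meas])
    fix t and \<theta> and \<xi> \<xi>' :: "nat \<Rightarrow> 'n draw"
    assume "\<And>s. s \<le> t \<Longrightarrow> \<xi> s = \<xi>' s"
    then show "W t (\<theta>, \<xi>) = W t (\<theta>, \<xi>')"
      using play_cong_draws[of t \<xi> \<xi>' \<theta>] iterate_cong_draws[of t \<xi> \<xi>' \<theta>] by (simp add: W_def q_def)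
  next
    fix t :: nat and \<theta> and \<xi> :: "nat \<Rightarrow> 'n draw"
    assume \<theta>: "\<theta> \<in> space N" and t: "1 \<le> t"
    define w where "w = iterate (\<theta>, \<xi>) t"
    define p where "p = played (play (\<theta>, \<xi>) t)"
    define g where "g = subgrad (play (\<theta>, \<xi>) t)"
    define \<gamma> where "\<gamma> = gau r R mem w (tol t)"
    define S where "S y = g - (if g \<bullet> w < 0 then (g \<bullet> p) *\<^sub>R
      (if 1 \<le> \<gamma> then snd (one_d_opt r R mem w (tol t) y) else 0) else 0)" for y
    have upd: "iterate (\<theta>, \<xi>(t := y)) t = w" "played (play (\<theta>, \<xi>(t := y)) t) = p"
      "subgrad (play (\<theta>, \<xi>(t := y)) t) = g" for y
      unfolding w_def p_def g_def
      by (intro iterate_cong_draws played_cong_draws subgrad_cong_draws t; simp)+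
    have surr: "surrogate (play (\<theta>, \<xi>(t := y)) t) = S y" for y
      unfolding surrogate_eq upd S_def \<gamma>_def by simp
    have p: "p = (if 1 \<le> \<gamma> then w /\<^sub>R \<gamma> else w)"
      unfolding p_def played_eq w_def \<gamma>_def ..
    have g_le: "norm g \<le> B" unfolding g_def by (rule norm_subgrad_le) (use \<theta> t in auto)
    have w_le: "norm w \<le> R" unfolding w_def by (rule norm_iterate_le)
    have K_le: "R / r + tol t / 20 \<le> K" using tol_bounds[OF t] by (simp add: K_def)
    have "(\<integral>\<^sup>+y. ennreal (exp (\<beta> * (sqrt 2 * R * (norm (S y))\<^sup>2 / c + g \<bullet> (p - x) - S y \<bullet> (w - x) - 2 * B * R * tol t))) \<partial>draw_measure)
        \<le> ennreal (exp k)"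
      unfolding S_def p \<gamma>_def k_def
      by (rule round_exponential_moment[OF mem mem_meas tol_bounds(1,3)[OF t] w_le x g_le B K_le c(1) less_imp_le[OF \<beta>] d m_def small])
    then have bound: "(\<integral>\<^sup>+y. ennreal (exp (\<beta> * q t (\<theta>, \<xi>(t := y)))) \<partial>draw_measure) \<le> ennreal (exp k)"
      unfolding q_def upd surr .
    have [measurable]: "(\<lambda>y. q t (\<theta>, \<xi>(t := y))) \<in> borel_measurable draw_measure"
    proof -
      have "(\<lambda>y. (w, y)) \<in> draw_measure \<rightarrow>\<^sub>M borel \<Otimes>\<^sub>M (draw_measure :: 'n draw measure)" by measurable
      from measurable_compose[OF this measurable_one_d_opt[OF mem_meas r_pos r_le_R tol_bounds(1,3)[OF t]]]
      have [measurable]: "(\<lambda>y. snd (one_d_opt r R mem w (tol t) y)) \<in> borel_measurable draw_measure" by simp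
      have [measurable]: "S \<in> borel_measurable draw_measure" unfolding S_def by measurable
      show ?thesis unfolding q_def upd surr by measurable
    qed
    have "(\<integral>\<^sup>+y. ennreal (exp (W t (\<theta>, \<xi>(t := y)))) \<partial>draw_measure) =
        (\<integral>\<^sup>+y. ennreal (exp (\<beta> * q t (\<theta>, \<xi>(t := y)))) * ennreal (exp (- k)) \<partial>draw_measure)"
      unfolding W_def by (intro nn_integral_cong) (simp add: ennreal_mult'[symmetric] exp_add[symmetric])
    also have "\<dots> = (\<integral>\<^sup>+y. ennreal (exp (\<beta> * q t (\<theta>, \<xi>(t := y)))) \<partial>draw_measure) * ennreal (exp (- k))"
      by (intro nn_integral_multc) measurable
    also have "\<dots> \<le> ennreal (exp k) * ennreal (exp (- k))" by (intro mult_right_mono bound) simp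
    also have "\<dots> = 1" by (simp add: ennreal_mult'[symmetric] exp_add[symmetric])
    finally show "(\<integral>\<^sup>+y. ennreal (exp (W t (\<theta>, \<xi>(t := y)))) \<partial>draw_measure) \<le> 1" .
  qed
  let ?bound = "8 * R * B * K * sqrt (d * real T * (3 + 2 * L)) + 4 * B * R * \<delta> * sqrt (real T)"
  have deterministic: "regret \<omega> T x \<le> ?bound"
    if W: "(\<Sum>t=1..T. W t \<omega>) \<le> L" for \<omega>
  proof -
    define V where "V = (\<Sum>t=1..T. (norm (surrogate (play \<omega> t)))\<^sup>2)"
    have V: "0 \<le> V" by (simp add: V_def sum_nonneg)
    define q' where "q' = (\<Sum>t=1..T. q t \<omega>)"
    have "\<beta> * q' \<le> real T * k + L"
      using W by (simp add: W_def q'_def sum_subtractf sum_distrib_left)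
    also have "\<dots> = \<beta> * (real T * (sqrt 2 * R * m / c) + real T * (\<beta> * (R\<^sup>2 * m * (4 * d * m / c\<^sup>2 + 2))) + L / \<beta>)"
      using \<beta> by (simp add: k_def algebra_simps power2_eq_square)
    finally have "q' \<le> real T * (sqrt 2 * R * m / c) + real T * (\<beta> * (R\<^sup>2 * m * (4 * d * m / c\<^sup>2 + 2))) + L / \<beta>"
      using \<beta> by simp
    also have "real T * (sqrt 2 * R * m / c) = R * n * (sqrt 2 * sqrt (real T))"
      using n T_pos by (simp add: c_def nm real_div_sqrt field_simps)
    also have "real T * (\<beta> * (R\<^sup>2 * m * (4 * d * m / c\<^sup>2 + 2))) = R * n * (l * (4 * d + 2 * real T))"
    proof -
      have "real T * (\<beta> * (R\<^sup>2 * m * (4 * d * m / c\<^sup>2 + 2))) =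
          (\<beta> * (R\<^sup>2 * m)) * (real T * (4 * d * m / c\<^sup>2 + 2))" by (simp only: mult_ac)
      also have "\<beta> * (R\<^sup>2 * m) = R * n * l"
        using n(1) R_pos by (simp add: \<beta>_def nm power2_eq_square)
      also have "real T * (4 * d * m / c\<^sup>2 + 2) = 4 * d + 2 * real T"
        using n(1) T_pos unfolding c(2) by (simp add: nm distrib_left)
      finally show ?thesis by (simp only: mult_ac)
    qed
    also have "L / \<beta> = R * n * (L / l)" by (simp add: \<beta>_def)
    finally have q_le: "q' \<le> R * n * (sqrt 2 * sqrt (real T)) + R * n * (l * (4 * d + 2 * real T)) + R * n * (L / l)" .
    have ftrl: "(\<Sum>t=1..T. surrogate (play \<omega> t) \<bullet> (iterate \<omega> t - x)) \<le> 2 * sqrt 2 * R * sqrt V"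
    proof -
      have "norm x \<le> R" using x sub_ball by auto
      from ftrl_proximal_regret[OF R_pos this, of "\<lambda>t. surrogate (play \<omega> t)" T]
      show ?thesis by (simp add: iterate_def V_def)
    qed
    have "2 * sqrt V \<le> c + V / c"
    proof -
      have "0 \<le> (c - sqrt V)\<^sup>2 / c" using c(1) by simp
      also have "(c - sqrt V)\<^sup>2 = c * c + V - 2 * sqrt V * c"
        using V by (simp add: power2_eq_square algebra_simps)
      finally show ?thesis using c(1) by (simp add: diff_divide_distrib add_divide_distrib)
    qed
    then have AMGM: "sqrt 2 * R * (2 * sqrt V) \<le> sqrt 2 * R * (c + V / c)"
      using R_pos by (intro mult_left_mono) auto
    have Rc: "sqrt 2 * R * c = R * n * (sqrt 2 * sqrt (real T))" by (simp add: c_def)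
    have ftrl': "(\<Sum>t=1..T. surrogate (play \<omega> t) \<bullet> (iterate \<omega> t - x)) \<le>
        R * n * (sqrt 2 * sqrt (real T)) + sqrt 2 * R * V / c"
    proof -
      have "2 * sqrt 2 * R * sqrt V = sqrt 2 * R * (2 * sqrt V)"
        "sqrt 2 * R * (c + V / c) = sqrt 2 * R * c + sqrt 2 * R * V / c"
        by (simp_all add: distrib_left)
      then show ?thesis
        using ftrl AMGM Rc by linarith
    qed
    have "(\<Sum>t=1..T. tol t) = \<delta> * (\<Sum>t=1..T. real t powr (- 1 / 2))"
      by (simp add: tol_def sum_distrib_left)
    also have "\<dots> \<le> \<delta> * (2 * sqrt (real T))"
      using \<delta> by (intro mult_left_mono sum_inverse_sqrt_le) auto
    finally have "2 * B * R * (\<Sum>t=1..T. tol t) \<le> 2 * B * R * (\<delta> * (2 * sqrt (real T)))"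
      using B R_pos by (intro mult_left_mono) auto
    moreover have "q' = sqrt 2 * R * V / c + regret \<omega> T x -
        (\<Sum>t=1..T. surrogate (play \<omega> t) \<bullet> (iterate \<omega> t - x)) - 2 * B * R * (\<Sum>t=1..T. tol t)"
      unfolding q'_def q_def V_def
      by (simp only: sum_subtractf sum.distrib sum_distrib_left sum_divide_distrib)
    ultimately have "regret \<omega> T x \<le>
        R * n * (sqrt 2 * sqrt (real T)) + R * n * (sqrt 2 * sqrt (real T)) +
        R * n * (l * (4 * d + 2 * real T)) + R * n * (L / l) + 4 * B * R * \<delta> * sqrt (real T)"
      using q_le ftrl' by linarith
    also have "\<dots> = R * n * (2 * sqrt 2 * sqrt (real T) + l * (4 * d + 2 * real T) + L / l) + 4 * B * R * \<delta> * sqrt (real T)"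
      by (simp add: distrib_left)
    also have "\<dots> \<le> R * n * (4 * sqrt (real T * (3 + 2 * L))) + 4 * B * R * \<delta> * sqrt (real T)"
      using tuned(3)[OF dL] R_pos n(1) by (intro add_right_mono mult_left_mono) auto
    also have "R * n * (4 * sqrt (real T * (3 + 2 * L))) = 8 * R * B * K * sqrt (d * real T * (3 + 2 * L))"
      by (simp add: n_def real_sqrt_mult mult.assoc)
    finally show ?thesis .
  qed
  have [measurable]: "(\<lambda>\<omega>. \<Sum>t=1..T. W t \<omega>) \<in> borel_measurable game"
    by (intro borel_measurable_sum W_meas) simp
  have [measurable]: "(\<lambda>\<omega>. regret \<omega> T x) \<in> borel_measurable game"
    using play_measurable_parts by (intro borel_measurable_sum borel_measurable_inner borel_measurable_diff) auto
  have "1 - exp (- L) \<le> G.prob {\<omega> \<in> space game. (\<Sum>t=1..T. W t \<omega>) \<le> L}"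
    by (rule G.exponential_markov[OF _ moment]) measurable
  also have "\<dots> \<le> G.prob {\<omega> \<in> space game.
      regret \<omega> T x \<le> ?bound}"
  proof (rule G.finite_measure_mono)
    show "{\<omega> \<in> space game. (\<Sum>t=1..T. W t \<omega>) \<le> L} \<subseteq>
        {\<omega> \<in> space game. regret \<omega> T x \<le> ?bound}"
      using deterministic by blast
  qed measurable
  finally show ?thesis using \<rho> by (simp add: L_def ln_div exp_minus)
qed

end

theorem theorem7:
  fixes C E :: "(real^'n) set"
    and r R B \<delta> \<kappa> d :: real
    and mem :: "real^'n \<Rightarrow> real \<Rightarrow> bool"
    and N :: "'s measure"
    and adv :: "'s \<Rightarrow> nat \<Rightarrow> (nat \<Rightarrow> real^'n) \<Rightarrow> real^'n \<Rightarrow> real"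
    and sg :: "nat \<Rightarrow> (real^'n \<Rightarrow> real) \<Rightarrow> real^'n \<Rightarrow> real^'n"
    and run :: "'s \<times> (nat \<Rightarrow> 'n draw) \<Rightarrow> nat \<Rightarrow> 'n round"
  assumes "closed C" and "convex C"
    and "0 < r" and "r \<le> R" and "cball 0 r \<subseteq> C" and "C \<subseteq> cball 0 R"
    and "\<kappa> = R / r" and "d = real CARD('n)"
    and "0 < \<delta>" and "\<delta> < 1 / 3" and "0 < B"
    and "membership_oracle C mem"
    and "\<And>\<epsilon>. \<epsilon> > 0 \<Longrightarrow> {x. mem x \<epsilon>} \<in> sets borel"
    and "prob_space N"
    and "C \<subseteq> E"
    and "\<And>\<theta> t h. \<lbrakk>\<theta> \<in> space N; t \<ge> 1; h \<in> {1..t} \<rightarrow>\<^sub>E C\<rbrakk> \<Longrightarrow>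
           convex_on E (adv \<theta> t h) \<and> subgradients_bounded C E B (adv \<theta> t h) \<and>
           sg t (adv \<theta> t h) (h t) \<in> subdifferential E (adv \<theta> t h) (h t)"
    and "\<And>t. t \<ge> 1 \<Longrightarrow>
           (\<lambda>(\<theta>, h). sg t (adv \<theta> t h) (h t)) \<in>
             borel_measurable (N \<Otimes>\<^sub>M (\<Pi>\<^sub>M s\<in>{1..t}. restrict_space borel C))"
    and "\<And>\<theta> \<xi>. run (\<theta>, \<xi>) =
           wrapper (ftrl_proximal R) (one_d_opt r R mem) (\<lambda>t. \<delta> * real t powr (-1 / 2))
             (adv \<theta>) sg \<xi>"
  shows "(\<forall>\<omega>\<in>space (game_space N). \<forall>t\<ge>1. played (run \<omega> t) \<in> C) \<and>
    (\<forall>\<rho> T x. 0 < \<rho> \<and> \<rho> < 1 \<and> real T \<ge> d * ln (1 / \<rho>) \<and> x \<in> C \<longrightarrow>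
       measure (game_space N)
         {\<omega> \<in> space (game_space N).
            (\<Sum>t=1..T. subgrad (run \<omega> t) \<bullet> (played (run \<omega> t) - x))
              \<le> 8 * R * B * (\<kappa> + \<delta>) * sqrt (d * real T * (3 + 2 * ln (1 / \<rho>)))
                + 2 * d * B * R * (2 * \<kappa> + 2 * \<delta> + 3 * \<delta> * sqrt (real T) / \<rho>)}
         \<ge> 1 - \<rho>)"
proof -
  have adversary: "subgradients_bounded C E B (adv \<theta> t h) \<and>
      sg t (adv \<theta> t h) (h t) \<in> subdifferential E (adv \<theta> t h) (h t)"
    if "\<theta> \<in> space N" "t \<ge> 1" "h \<in> {1..t} \<rightarrow>\<^sub>E C" for \<theta> t h
    using assms(16)[OF that] by blast
  interpret projection_free_game C r R E B \<delta> mem N adv sg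
  proof (intro projection_free_game.intro convex_body.intro projection_free_game_axioms.intro)
    show "{x. mem x \<epsilon>} \<in> sets borel" if "0 < \<epsilon>" for \<epsilon> by (rule assms(13)[OF that])
    show "subgradients_bounded C E B (adv \<theta> t h) \<and>
        sg t (adv \<theta> t h) (h t) \<in> subdifferential E (adv \<theta> t h) (h t)"
      if "\<theta> \<in> space N" "1 \<le> t" "h \<in> {1..t} \<rightarrow>\<^sub>E C" for \<theta> t h
      by (rule adversary[OF that])
    show "(\<lambda>(\<theta>, h). sg t (adv \<theta> t h) (h t)) \<in>
        borel_measurable (N \<Otimes>\<^sub>M (\<Pi>\<^sub>M s\<in>{1..t}. restrict_space borel C))" if "1 \<le> t" for t
      by (rule assms(17)[OF that])
  qed (fact assms)+
  have run: "run = play"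
  proof
    fix \<omega>
    show "run \<omega> = play \<omega>"
      using assms(18)[of "fst \<omega>" "snd \<omega>"] by (simp add: play_def tol_def[abs_def])
  qed
  have game: "game_space N = game" by (simp add: game_space_def)
  interpret G: prob_space game
    by (intro prob_space_pairI N prob_space_PiM prob_space_draw)
  have "1 - \<rho> \<le> measure game {\<omega> \<in> space game. regret \<omega> T x
        \<le> 8 * R * B * (\<kappa> + \<delta>) * sqrt (d * real T * (3 + 2 * ln (1 / \<rho>)))
          + 2 * d * B * R * (2 * \<kappa> + 2 * \<delta> + 3 * \<delta> * sqrt (real T) / \<rho>)}"
    if \<rho>: "0 < \<rho>" "\<rho> < 1" and T: "d * ln (1 / \<rho>) \<le> real T" and x: "x \<in> C" for \<rho> T x
  proof -
    let ?main = "8 * R * B * (\<kappa> + \<delta>) * sqrt (d * real T * (3 + 2 * ln (1 / \<rho>)))"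
    let ?rest = "2 * d * B * R * (2 * \<kappa> + 2 * \<delta> + 3 * \<delta> * sqrt (real T) / \<rho>)"
    have d1: "1 \<le> d" using assms(8) by (simp add: Suc_leI)
    have "\<delta> * sqrt (real T) * 1 \<le> \<delta> * sqrt (real T) * (1 / \<rho>)"
      using \<rho> \<delta> by (intro mult_left_mono) auto
    moreover have "0 \<le> \<kappa>" using assms(3,4,7) by simp
    moreover have "0 \<le> \<delta> * sqrt (real T)" using \<delta> by simp
    moreover have "3 * \<delta> * sqrt (real T) / \<rho> = 3 * (\<delta> * sqrt (real T) * (1 / \<rho>))" by simp
    ultimately have slack: "2 * (\<delta> * sqrt (real T)) \<le> 2 * \<kappa> + 2 * \<delta> + 3 * \<delta> * sqrt (real T) / \<rho>"
      using \<delta> by linarith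
    have "2 * B * R * 1 * (2 * (\<delta> * sqrt (real T))) \<le> 2 * B * R * d * (2 * \<kappa> + 2 * \<delta> + 3 * \<delta> * sqrt (real T) / \<rho>)"
      using B R_pos d1 \<delta> slack by (intro mult_mono mult_left_mono) auto
    then have weaker: "4 * B * R * \<delta> * sqrt (real T) \<le> ?rest"
      by (simp add: mult_ac)
    have [measurable]: "(\<lambda>\<omega>. regret \<omega> T x) \<in> borel_measurable game"
      using play_measurable_parts by (intro borel_measurable_sum borel_measurable_inner borel_measurable_diff) auto
    have "1 - \<rho> \<le> measure game {\<omega> \<in> space game. regret \<omega> T x \<le> ?main + 4 * B * R * \<delta> * sqrt (real T)}"
      unfolding assms(7) by (rule regret_bound[OF \<rho> assms(8) T x])
    also have "\<dots> \<le> measure game {\<omega> \<in> space game. regret \<omega> T x \<le> ?main + ?rest}"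
    proof (rule G.finite_measure_mono)
      show "{\<omega> \<in> space game. regret \<omega> T x \<le> ?main + 4 * B * R * \<delta> * sqrt (real T)} \<subseteq>
          {\<omega> \<in> space game. regret \<omega> T x \<le> ?main + ?rest}"
        using weaker by (intro Collect_mono) linarith
    qed measurable
    finally show ?thesis .
  qed
  then show ?thesis unfolding run game using played_in_C by auto
qed

end
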